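(* Fix constants $a,b$ with $0<b<\tfrac12$ and $\tfrac12-b<a<\tfrac12-\tfrac b2$, and let $\rho=n^{-b}$, $k=\rho n$, $\lambda=n^{-a}$, $\theta=\lambda k_+$. Let $L_n$ be any polylogarithmic sequence, i.e. $L_n\le(\log n)^A$ for some fixed $A<\infty$. Suppose there exists a polynomial-time estimator $\hat\mu$ for the Gaussian sequence model over $\theta K_{n,k}$ satisfying $$\sup_{\mu\in\theta K_{n,k}}\mathbb E_\mu\|\hat\mu-\mu\|_F^2\le L_n\,R^*(\theta K_{n,k}).$$ Then, from $\hat\mu$, one can construct in polynomial time an estimator $\tilde v=\tilde v(Y)\in[0,1]^n$ of the planted vector $v$ in the planted-submatrix model $Y=\lambda vv^\top+W$ such that $$\mathbb E\|\tilde v-v\|_2^2=o(k)=o(\rho n).$$ Consequently, after a permutation symmetrization, one obtains a polynomial-time estimator of a planted coordinate $v_1$ with mean-squared error $o(\rho)$. Therefore, under the low-degree conjecture for planted-submatrix estimation (stated in the context), there is no polynomial-time estimator $\hat\mu$ satisfying the displayed risk bound for any polylogarithmic approximation factor $L_n=(\log n)^{O(1)}$.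
   Context: $\mathbb S^n$ is the space of real symmetric $n\times n$ matrices, $\|\cdot\|_F$ the Frobenius norm. Integer-rounding issues are ignored. The body. Let $\delta_n\downarrow0$ with $\delta_n^2k\to\infty$ (e.g. $\delta_n=k^{-1/4}$), $k_\pm=(1\pm\delta_n)k$. Let $\mathcal C_{n,k}$ be the convex cone of $X\in\mathbb S^n$ with $X\succeq0$; $X_{ij}\ge0$, $X_{ij}\le X_{ii}$, $X_{ij}\le X_{jj}$ for all $i,j$; and $k_-X_{ii}\le\sum_{j=1}^nX_{ij}\le k_+X_{ii}$ for every $i$. Let $K_{n,k}^+=\{X\in\mathcal C_{n,k}:\mathrm{tr}(X)\le1\}$ and $K_{n,k}=\mathrm{conv}(K_{n,k}^+\cup(-K_{n,k}^+))$. Planted-submatrix model. $Y=\lambda vv^\top+W$ with $v_i$ i.i.d. $\mathrm{Bernoulli}(\rho)$, and $W\in\mathbb S^n$ Gaussian noise independent of $v$, with independent entries on and above the diagonal, $W_{ij}\sim N(0,1)$ for $i<j$ and $W_{ii}\sim N(0,2)$. Gaussian sequence model. $Z=\mu+W$ with $\mu\in\theta K_{n,k}$ and $W\in\mathbb S^n$ Gaussian noise with independent entries on and above the diagonal, $W_{ij}\sim N(0,1)$ for $i<j$ and $W_{ii}\sim N(0,2)$ (equivalently, isotropic Gaussian noise of constant-order variance $\sigma^2\asymp1$ on $\mathbb S^n$ with the Frobenius inner product), and $R^*(\theta K_{n,k})=\inf_{\hat\mu}\sup_{\mu\in\theta K_{n,k}}\mathbb E_\mu\|\hat\mu-\mu\|_F^2$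 is the minimax risk. Low-degree conjecture for planted-submatrix estimation. Schramm and Wein proved that when $\rho=n^{-b}$, $\lambda=n^{-a}$, $0<b<1/2$, $a>1/2-b$, for some $\epsilon=\epsilon(a,b)>0$ the minimum mean-squared error over polynomial estimators of $v_1$ of degree at most $n^{\epsilon}$ equals $\rho-(1+o(1))\rho^2$. The conjecture is that this barrier reflects a corresponding barrier for polynomial-time algorithms: in this regime, no polynomial-time estimator of $v_1$ achieves mean-squared error $o(\rho)$. *)

theory Defs
  imports "HOL-Probability.Probability"
begin

text \<open>
  An \<open>n \<times> n\<close> matrix, \<open>n\<close> varying, is a function of two indices \<open>< n\<close> that is \<open>0\<close> outside that
  range; an \<open>n\<close>-vector likewise. Indices start at \<open>0\<close>, so the coordinate usually called \<open>v\<^sub>1\<close>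
  has index \<open>0\<close>. The \<open>\<sigma>\<close>-algebra is the Borel algebra of the product topology, whose trace on
  \<open>Sym n\<close> is the usual Borel algebra of the finite-dimensional space.
\<close>

type_synonym rmat = "nat \<Rightarrow> nat \<Rightarrow> real"

definition Sym :: "nat \<Rightarrow> rmat set" where
  "Sym n = {X. (\<forall>i j. X i j = X j i) \<and> (\<forall>i j. n \<le> i \<or> n \<le> j \<longrightarrow> X i j = 0)}"

definition sym_space :: "nat \<Rightarrow> rmat measure" where
  "sym_space n = restrict_space borel (Sym n)"

definition frob_sq :: "nat \<Rightarrow> rmat \<Rightarrow> real" where
  "frob_sq n X = (\<Sum>i<n. \<Sum>j<n. (X i j)\<^sup>2)"

definition psd :: "nat \<Rightarrow> rmat \<Rightarrow> bool" where
  "psd n X \<longleftrightarrow> (\<forall>x. 0 \<le> (\<Sum>i<n. \<Sum>j<n. x i * X i j * x j))"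

definition cone :: "nat \<Rightarrow> real \<Rightarrow> real \<Rightarrow> rmat set" where
  "cone n kminus kplus = {X \<in> Sym n. psd n X
     \<and> (\<forall>i<n. \<forall>j<n. 0 \<le> X i j \<and> X i j \<le> X i i \<and> X i j \<le> X j j)
     \<and> (\<forall>i<n. kminus * X i i \<le> (\<Sum>j<n. X i j) \<and> (\<Sum>j<n. X i j) \<le> kplus * X i i)}"

definition body_plus :: "nat \<Rightarrow> real \<Rightarrow> real \<Rightarrow> rmat set" where
  "body_plus n kminus kplus = {X \<in> cone n kminus kplus. (\<Sum>i<n. X i i) \<le> 1}"

text \<open>The library's \<open>convex hull\<close> needs a \<open>real_vector\<close> type, which functions are not.\<close>

definition conv :: "rmat set \<Rightarrow> rmat set" where
  "conv S = {(\<lambda>i j. \<Sum>X\<in>F. c X * X i j) | F c.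
     finite F \<and> F \<subseteq> S \<and> (\<forall>X\<in>F. (0::real) \<le> c X) \<and> sum c F = 1}"

definition scale :: "real \<Rightarrow> rmat set \<Rightarrow> rmat set" where
  "scale t S = (\<lambda>X i j. t * X i j) ` S"

definition body :: "nat \<Rightarrow> real \<Rightarrow> real \<Rightarrow> rmat set" where
  "body n kminus kplus =
     conv (body_plus n kminus kplus \<union> scale (-1) (body_plus n kminus kplus))"

definition noise :: "nat \<Rightarrow> rmat measure" where
  "noise n =
     distr (PiM {(i, j). i \<le> j \<and> j < n}
              (\<lambda>(i, j). density lborel (normal_density 0 (if i = j then sqrt 2 else 1))))
           (sym_space n)
           (\<lambda>g i j. if i < n \<and> j < n then g (min i j, max i j) else 0)"

definition bernoulli_vec :: "nat \<Rightarrow> real \<Rightarrow> (nat \<Rightarrow> bool) measure" where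
  "bernoulli_vec n \<rho> = PiM {..<n} (\<lambda>_. measure_pmf (bernoulli_pmf \<rho>))"

definition planted :: "nat \<Rightarrow> real \<Rightarrow> (nat \<Rightarrow> bool) \<Rightarrow> rmat \<Rightarrow> rmat" where
  "planted n snr v W =
     (\<lambda>i j. if i < n \<and> j < n then snr * of_bool (v i) * of_bool (v j) + W i j else 0)"

text \<open>
  Internal randomness of an algorithm: an independent sequence of uniform variables. An estimator
  is a function of the data and of this seed; deterministic estimators ignore the seed.
\<close>

type_synonym seed = "nat \<Rightarrow> real"

definition seed_space :: "seed measure" where
  "seed_space = PiM UNIV (\<lambda>_. uniform_measure lborel {0..1})"

text \<open>Risks are \<open>ennreal\<close>-valued, so that a non-integrable loss has risk \<open>\<infinity>\<close> rather than \<open>0\<close>.\<close>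

definition gauss_risk :: "nat \<Rightarrow> (rmat \<Rightarrow> seed \<Rightarrow> rmat) \<Rightarrow> rmat \<Rightarrow> ennreal" where
  "gauss_risk n f \<mu> =
     (\<integral>\<^sup>+ (W, \<omega>). ennreal (frob_sq n (\<lambda>i j. f (\<lambda>i j. \<mu> i j + W i j) \<omega> i j - \<mu> i j))
        \<partial>(noise n \<Otimes>\<^sub>M seed_space))"

definition minimax_risk :: "nat \<Rightarrow> rmat set \<Rightarrow> ennreal" where
  "minimax_risk n \<Theta> =
     (INF f \<in> measurable (sym_space n) (sym_space n).
        SUP \<mu>\<in>\<Theta>. \<integral>\<^sup>+ W. ennreal (frob_sq n (\<lambda>i j. f (\<lambda>i j. \<mu> i j + W i j) i j - \<mu> i j))
          \<partial>(noise n))"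

definition planted_vec_risk ::
    "nat \<Rightarrow> real \<Rightarrow> real \<Rightarrow> (rmat \<Rightarrow> seed \<Rightarrow> nat \<Rightarrow> real) \<Rightarrow> ennreal" where
  "planted_vec_risk n snr \<rho> f =
     (\<integral>\<^sup>+ (v, W, \<omega>). ennreal (\<Sum>i<n. (f (planted n snr v W) \<omega> i - of_bool (v i))\<^sup>2)
        \<partial>(bernoulli_vec n \<rho> \<Otimes>\<^sub>M (noise n \<Otimes>\<^sub>M seed_space)))"

definition planted_coord_risk ::
    "nat \<Rightarrow> real \<Rightarrow> real \<Rightarrow> (rmat \<Rightarrow> seed \<Rightarrow> real) \<Rightarrow> ennreal" where
  "planted_coord_risk n snr \<rho> f =
     (\<integral>\<^sup>+ (v, W, \<omega>). ennreal ((f (planted n snr v W) \<omega> - of_bool (v 0))\<^sup>2)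
        \<partial>(bernoulli_vec n \<rho> \<Otimes>\<^sub>M (noise n \<Otimes>\<^sub>M seed_space)))"

text \<open>
  The memory consists of natural-number registers and of two-dimensional arrays of reals, both
  named by numerals fixed in the program text; an array is addressed by computed indices. Reals
  are exact, with unit-cost \<open>+\<close>, \<open>-\<close>, \<open>*\<close>, \<open>/\<close>, square root and comparison. The only constants are
  natural numbers, there is no multiplication of naturals and no conversion (rounding) from reals
  to naturals, so that the model does not acquire the well-known spurious power of unit-cost
  truncation. \<open>Random i\<close> reads the \<open>i\<close>-th seed variable. \<open>Clear\<close> resets a whole array at unit cost;
  this is only a convenience, as it can be simulated by lazy initialisation.
\<close>

datatype nexp =
    NConst nat
  | NReg nat
  | NAdd nexp nexp
  | NSub nexp nexp

datatype rexp =
    RNat nexp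
  | Cell nat nexp nexp
  | Random nexp
  | RAdd rexp rexp
  | RSub rexp rexp
  | RMul rexp rexp
  | RDiv rexp rexp
  | RSqrt rexp

datatype bexp =
    NLess nexp nexp
  | RLess rexp rexp
  | BNot bexp
  | BAnd bexp bexp

datatype com =
    NAssign nat nexp
  | RAssign nat nexp nexp rexp
  | Clear nat
  | Seq com com
  | Cond bexp com com
  | Loop bexp com

type_synonym state = "(nat \<Rightarrow> nat) \<times> (nat \<Rightarrow> rmat)"

primrec nval :: "state \<Rightarrow> nexp \<Rightarrow> nat" where
  "nval s (NConst m) = m"
| "nval s (NReg x) = fst s x"
| "nval s (NAdd e e') = nval s e + nval s e'"
| "nval s (NSub e e') = nval s e - nval s e'"

primrec rval :: "seed \<Rightarrow> state \<Rightarrow> rexp \<Rightarrow> real" where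
  "rval \<omega> s (RNat e) = real (nval s e)"
| "rval \<omega> s (Cell r e e') = snd s r (nval s e) (nval s e')"
| "rval \<omega> s (Random e) = \<omega> (nval s e)"
| "rval \<omega> s (RAdd x y) = rval \<omega> s x + rval \<omega> s y"
| "rval \<omega> s (RSub x y) = rval \<omega> s x - rval \<omega> s y"
| "rval \<omega> s (RMul x y) = rval \<omega> s x * rval \<omega> s y"
| "rval \<omega> s (RDiv x y) = rval \<omega> s x / rval \<omega> s y"
| "rval \<omega> s (RSqrt x) = sqrt (rval \<omega> s x)"

primrec bval :: "seed \<Rightarrow> state \<Rightarrow> bexp \<Rightarrow> bool" where
  "bval \<omega> s (NLess e e') \<longleftrightarrow> nval s e < nval s e'"
| "bval \<omega> s (RLess x y) \<longleftrightarrow> rval \<omega> s x < rval \<omega> s y"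
| "bval \<omega> s (BNot p) \<longleftrightarrow> \<not> bval \<omega> s p"
| "bval \<omega> s (BAnd p q) \<longleftrightarrow> bval \<omega> s p \<and> bval \<omega> s q"

text \<open>\<open>exec \<omega> c s t s'\<close>: with seed \<open>\<omega>\<close>, program \<open>c\<close> started in \<open>s\<close> halts in \<open>s'\<close> after \<open>t\<close> steps.\<close>

inductive exec :: "seed \<Rightarrow> com \<Rightarrow> state \<Rightarrow> nat \<Rightarrow> state \<Rightarrow> bool" for \<omega> :: seed where
  NAssign: "exec \<omega> (NAssign x e) s 1 ((fst s)(x := nval s e), snd s)"
| RAssign: "exec \<omega> (RAssign r e e' x) s 1
     (fst s,
      (snd s)(r := (snd s r)(nval s e := (snd s r (nval s e))(nval s e' := rval \<omega> s x))))"
| Clear: "exec \<omega> (Clear r) s 1 (fst s, (snd s)(r := (\<lambda>_ _. 0)))"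
| Seq: "exec \<omega> c s t s' \<Longrightarrow> exec \<omega> c' s' t' s'' \<Longrightarrow> exec \<omega> (Seq c c') s (t + t') s''"
| CondTrue: "bval \<omega> s p \<Longrightarrow> exec \<omega> c s t s' \<Longrightarrow> exec \<omega> (Cond p c c') s (t + 1) s'"
| CondFalse: "\<not> bval \<omega> s p \<Longrightarrow> exec \<omega> c' s t s' \<Longrightarrow> exec \<omega> (Cond p c c') s (t + 1) s'"
| LoopFalse: "\<not> bval \<omega> s p \<Longrightarrow> exec \<omega> (Loop p c) s 1 s"
| LoopTrue: "bval \<omega> s p \<Longrightarrow> exec \<omega> c s t s' \<Longrightarrow> exec \<omega> (Loop p c) s' t' s''
     \<Longrightarrow> exec \<omega> (Loop p c) s (t + t' + 1) s''"

primrec rexp_seedless :: "rexp \<Rightarrow> bool" where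
  "rexp_seedless (RNat e) \<longleftrightarrow> True"
| "rexp_seedless (Cell r e e') \<longleftrightarrow> True"
| "rexp_seedless (Random e) \<longleftrightarrow> False"
| "rexp_seedless (RAdd x y) \<longleftrightarrow> rexp_seedless x \<and> rexp_seedless y"
| "rexp_seedless (RSub x y) \<longleftrightarrow> rexp_seedless x \<and> rexp_seedless y"
| "rexp_seedless (RMul x y) \<longleftrightarrow> rexp_seedless x \<and> rexp_seedless y"
| "rexp_seedless (RDiv x y) \<longleftrightarrow> rexp_seedless x \<and> rexp_seedless y"
| "rexp_seedless (RSqrt x) \<longleftrightarrow> rexp_seedless x"

primrec bexp_seedless :: "bexp \<Rightarrow> bool" where
  "bexp_seedless (NLess e e') \<longleftrightarrow> True"
| "bexp_seedless (RLess x y) \<longleftrightarrow> rexp_seedless x \<and> rexp_seedless y"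
| "bexp_seedless (BNot p) \<longleftrightarrow> bexp_seedless p"
| "bexp_seedless (BAnd p q) \<longleftrightarrow> bexp_seedless p \<and> bexp_seedless q"

primrec seedless :: "com \<Rightarrow> bool" where
  "seedless (NAssign x e) \<longleftrightarrow> True"
| "seedless (RAssign r e e' x) \<longleftrightarrow> rexp_seedless x"
| "seedless (Clear r) \<longleftrightarrow> True"
| "seedless (Seq c c') \<longleftrightarrow> seedless c \<and> seedless c'"
| "seedless (Cond p c c') \<longleftrightarrow> bexp_seedless p \<and> seedless c \<and> seedless c'"
| "seedless (Loop p c) \<longleftrightarrow> bexp_seedless p \<and> seedless c"

text \<open>
  Input: \<open>n\<close> in register \<open>0\<close>, the data matrix in array \<open>0\<close>, and the known model parameters
  \<open>snr\<close> (\<open>= \<lambda>\<close>) and \<open>\<rho>\<close> in cells \<open>(0,0)\<close>, \<open>(0,1)\<close> of array \<open>1\<close>. The output is left in array \<open>0\<close>.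
\<close>

definition init :: "nat \<Rightarrow> real \<Rightarrow> real \<Rightarrow> rmat \<Rightarrow> state" where
  "init n snr \<rho> Y =
     ((\<lambda>_. 0)(0 := n),
      (\<lambda>_ _ _. 0)(0 := Y, 1 := (\<lambda>_ _. 0)(0 := (\<lambda>_. 0)(0 := snr, 1 := \<rho>))))"

definition matrix_out :: "nat \<Rightarrow> state \<Rightarrow> rmat" where
  "matrix_out n s = (\<lambda>i j. if i < n \<and> j < n then snd s 0 i j else 0)"

definition vector_out :: "nat \<Rightarrow> state \<Rightarrow> nat \<Rightarrow> real" where
  "vector_out n s = (\<lambda>i. if i < n then snd s 0 i 0 else 0)"

definition scalar_out :: "nat \<Rightarrow> state \<Rightarrow> real" where
  "scalar_out n s = snd s 0 0 0"

text \<open>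
  One program serves all \<open>n\<close>, and its running time is polynomial in \<open>n\<close> in the worst case. The flag
  \<open>rnd\<close> tells whether randomised algorithms are admitted.
\<close>

definition poly_time ::
    "bool \<Rightarrow> (nat \<Rightarrow> real) \<Rightarrow> (nat \<Rightarrow> real) \<Rightarrow> (nat \<Rightarrow> state \<Rightarrow> 'r)
      \<Rightarrow> (nat \<Rightarrow> rmat \<Rightarrow> seed \<Rightarrow> 'r) \<Rightarrow> bool" where
  "poly_time rnd lam rho out f \<longleftrightarrow>
     (\<exists>c C d. (rnd \<or> seedless c) \<and>
        (\<forall>n\<ge>1. \<forall>Y\<in>Sym n. \<forall>\<omega>. \<exists>t s.
           exec \<omega> c (init n (lam n) (rho n) Y) t s \<and> t \<le> C * n ^ d \<and> f n Y \<omega> = out n s))"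

definition rho :: "real \<Rightarrow> nat \<Rightarrow> real" where
  "rho b n = real n powr (- b)"

definition lam :: "real \<Rightarrow> nat \<Rightarrow> real" where
  "lam a n = real n powr (- a)"

definition kval :: "real \<Rightarrow> nat \<Rightarrow> real" where
  "kval b n = rho b n * real n"

definition theta_body :: "real \<Rightarrow> real \<Rightarrow> (nat \<Rightarrow> real) \<Rightarrow> nat \<Rightarrow> rmat set" where
  "theta_body a b \<delta> n =
     (let kminus = (1 - \<delta> n) * kval b n; kplus = (1 + \<delta> n) * kval b n
      in scale (lam a n * kplus) (body n kminus kplus))"

definition polylog :: "(nat \<Rightarrow> real) \<Rightarrow> bool" where
  "polylog L \<longleftrightarrow> (\<exists>A. \<forall>\<^sub>F n in sequentially. L n \<le> ln (real n) powr A)"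

text \<open>
  Outputs of a program are automatically Borel functions of data and seed; measurability is
  required explicitly so that the risks are visibly expectations. The programs are told \<open>n\<close>,
  \<open>\<lambda>\<close> and \<open>\<rho>\<close>; the tolerance \<open>\<delta>\<close> of the body has to be computed by the program itself, which
  for instance is possible exactly for \<open>\<delta> n = k powr (-1/4)\<close>.
\<close>

definition poly_time_matrix_estimator ::
    "bool \<Rightarrow> real \<Rightarrow> real \<Rightarrow> (nat \<Rightarrow> rmat \<Rightarrow> seed \<Rightarrow> rmat) \<Rightarrow> bool" where
  "poly_time_matrix_estimator rnd a b f \<longleftrightarrow>
     poly_time rnd (lam a) (rho b) matrix_out f \<and>
     (\<forall>n\<ge>1. case_prod (f n) \<in> measurable (sym_space n \<Otimes>\<^sub>M seed_space) (sym_space n))"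

definition poly_time_vector_estimator ::
    "bool \<Rightarrow> real \<Rightarrow> real \<Rightarrow> (nat \<Rightarrow> rmat \<Rightarrow> seed \<Rightarrow> nat \<Rightarrow> real) \<Rightarrow> bool" where
  "poly_time_vector_estimator rnd a b f \<longleftrightarrow>
     poly_time rnd (lam a) (rho b) vector_out f \<and>
     (\<forall>n\<ge>1. case_prod (f n) \<in> borel_measurable (sym_space n \<Otimes>\<^sub>M seed_space))"

definition poly_time_scalar_estimator ::
    "bool \<Rightarrow> real \<Rightarrow> real \<Rightarrow> (nat \<Rightarrow> rmat \<Rightarrow> seed \<Rightarrow> real) \<Rightarrow> bool" where
  "poly_time_scalar_estimator rnd a b f \<longleftrightarrow>
     poly_time rnd (lam a) (rho b) scalar_out f \<and>
     (\<forall>n\<ge>1. case_prod (f n) \<in> borel_measurable (sym_space n \<Otimes>\<^sub>M seed_space))"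

definition near_minimax ::
    "real \<Rightarrow> real \<Rightarrow> (nat \<Rightarrow> real) \<Rightarrow> (nat \<Rightarrow> real) \<Rightarrow> (nat \<Rightarrow> rmat \<Rightarrow> seed \<Rightarrow> rmat) \<Rightarrow> bool" where
  "near_minimax a b \<delta> L f \<longleftrightarrow>
     (\<forall>\<^sub>F n in sequentially.
        (SUP \<mu>\<in>theta_body a b \<delta> n. gauss_risk n (f n) \<mu>)
          \<le> ennreal (L n) * minimax_risk n (theta_body a b \<delta> n))"

definition vector_error_small ::
    "real \<Rightarrow> real \<Rightarrow> (nat \<Rightarrow> rmat \<Rightarrow> seed \<Rightarrow> nat \<Rightarrow> real) \<Rightarrow> bool" where
  "vector_error_small a b f \<longleftrightarrow>
     (\<lambda>n. planted_vec_risk n (lam a n) (rho b n) (f n) / ennreal (kval b n)) \<longlonglongrightarrow> 0"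

definition coord_error_small ::
    "real \<Rightarrow> real \<Rightarrow> (nat \<Rightarrow> rmat \<Rightarrow> seed \<Rightarrow> real) \<Rightarrow> bool" where
  "coord_error_small a b f \<longleftrightarrow>
     (\<lambda>n. planted_coord_risk n (lam a n) (rho b n) (f n) / ennreal (rho b n)) \<longlonglongrightarrow> 0"

text \<open>
  The known lower bound for estimators that are low-degree polynomials is the evidence for the
  conjecture; the conjecture itself is the corresponding assertion about algorithms.
\<close>

definition low_degree_conjecture :: "bool \<Rightarrow> bool" where
  "low_degree_conjecture rnd \<longleftrightarrow>
     (\<forall>a b. 0 < b \<and> b < 1/2 \<and> 1/2 - b < a \<longrightarrow>
        \<not> (\<exists>f. poly_time_scalar_estimator rnd a b f \<and> coord_error_small a b f))"

end

theory Submission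
  imports Defs "HOL-Real_Asymp.Real_Asymp"
begin

text \<open>
  The minimax risk over \<open>\<theta>K\<close> is much smaller than \<open>\<theta>\<^sup>2\<close>, although the Gaussian width of \<open>K\<close> is not:
  rows with a small diagonal entry have negligible Frobenius norm, so that up to a squared error of
  order \<open>1/r\<close> a point of \<open>K\<close> is supported on \<open>rk\<close> coordinates, and there it is a signed average of
  unit rank one matrices \<open>uu\<^sup>T\<close> (because \<open>X \<succeq> 0\<close>), which Maurey's argument replaces by \<open>r\<close> of them. The
  resulting net has log-cardinality of order \<open>r\<^sup>2k log n\<close>, and the net point nearest to the data has
  risk of order \<open>\<theta>\<^sup>2/r + r\<^sup>2k log n\<close>. As \<open>\<lambda>\<^sup>2k\<close> is a positive power of \<open>n\<close>, a small power \<open>r\<close> of \<open>n\<close>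
  makes this \<open>o(\<lambda>\<^sup>2k\<^sup>2)\<close> with polynomial room for \<open>L\<close>.

  Since \<open>\<lambda>vv\<^sup>T \<in> \<theta>K\<close> with high probability, the given estimator recovers \<open>\<lambda>vv\<^sup>T\<close> up to \<open>o(\<lambda>\<^sup>2k\<^sup>2)\<close>, and
  row \<open>i\<close> of \<open>\<lambda>vv\<^sup>T\<close> has squared norm about \<open>\<lambda>\<^sup>2k\<close> or \<open>0\<close> according to \<open>v\<^sub>i\<close>: each wrong decision at the
  threshold \<open>\<lambda>\<^sup>2k/4\<close> costs \<open>\<lambda>\<^sup>2k/5\<close> of the error. For a single coordinate, the output coordinates are
  averaged over the transpositions \<open>(0 j)\<close> applied to the data, which preserve the model; this needs
  no randomness.
\<close>

section \<open>Approximating the body by a finite net\<close>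

text \<open>The minimax risk is only a benchmark, so the net estimator that bounds it may take
  exponential time. One scale of approximation suffices because of the polynomial room: with
  \<open>4 * c = 1 - b - 2 * a\<close> one has \<lambda>^2k = n^(4c), and for r = n^c the terms
  \<theta>^2/r and r^2k log n, divided by \<lambda>^2k^2, are of order n^(-c) and n^(-2c) log n. Any
  power of log n is absorbed.

  The given estimator is controlled only for means inside \<theta>K. Hence the planted vector is
  fixed first and the Gaussian risk is applied to one deterministic mean; exceptional sizes of the
  planted set are handled in the manner of Chebyshev, and their contribution relative to k is of
  order 1/(\<delta>^2k).

  Programs have no procedures. A given program becomes a subroutine by keeping the registers and
  arrays of the wrapper above all numbers in its text, and by restoring the initial state below them
  before each call of a repeated run. The averaged runs all read the same seed; convexity of the
  square replaces independence.\<close>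

definition frob_inner :: "nat \<Rightarrow> rmat \<Rightarrow> rmat \<Rightarrow> real" where
  "frob_inner n X Y = (\<Sum>i<n. \<Sum>j<n. X i j * Y i j)"

definition restr :: "nat set \<Rightarrow> rmat \<Rightarrow> rmat" where
  "restr S X = (\<lambda>i j. if i \<in> S \<and> j \<in> S then X i j else 0)"

lemma frob_sq_nonneg: "0 \<le> frob_sq n X"
  by (auto simp: frob_sq_def intro!: sum_nonneg)

section \<open>Decomposing positive semidefinite matrices into rank one matrices\<close>

text \<open>Moving along one coordinate is used twice below: letting \<open>t\<close> range over all
  reals forces the row of a zero diagonal entry to vanish, and \<open>t = - c / X p p\<close>
  minimises the form, which gives positivity of the Schur complement.\<close>

lemma quadratic_form_shift:
  fixes X :: rmat and x :: "nat \<Rightarrow> real" and t :: real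
  assumes sym: "\<And>i j. X i j = X j i" and p: "p < n"
  defines "y \<equiv> \<lambda>i. x i + (if i = p then t else 0)"
  shows "(\<Sum>i<n. \<Sum>j<n. y i * X i j * y j)
     = (\<Sum>i<n. \<Sum>j<n. x i * X i j * x j) + 2 * t * (\<Sum>j<n. X p j * x j) + t\<^sup>2 * X p p"
proof -
  have e: "y i * X i j * y j = x i * X i j * x j + (if j = p then x i * X i j * t else 0)
       + (if i = p then t * X i j * x j else 0) + (if i = p then if j = p then t\<^sup>2 * X i j else 0 else 0)"
    for i j by (auto simp: y_def algebra_simps power2_eq_square)
  have s: "(\<Sum>j<n. (if i = p then f j else 0)) = (if i = p then (\<Sum>j<n. f j) else 0)" for i and f :: "nat \<Rightarrow> real"
    by auto
  have c: "(\<Sum>i<n. x i * X i p * t) = (\<Sum>j<n. t * X p j * x j)"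
    by (intro sum.cong refl) (metis mult.assoc mult.commute sym)
  show ?thesis
    unfolding e sum.distrib s using p
    by (simp add: sum.delta c) (simp add: sum_distrib_left mult.assoc)
qed

lemma affine_nonneg_imp_zero:
  fixes q c :: real
  assumes "\<And>t. 0 \<le> q + 2 * t * c"
  shows "c = 0"
proof (rule ccontr)
  assume "c \<noteq> 0"
  with assms[of "(- q - 1) / (2 * c)"] show False by (simp add: field_simps)
qed

text \<open>Symmetric elimination as in Cholesky's method, instead of diagonalisation. The induction
  counts the rows \<open>k\<close> not yet cleared: a zero pivot has a zero row by positivity, and a
  positive pivot is removed together with its row by subtracting one rank one matrix.\<close>

lemma psd_sum_rank_one:
  assumes "X \<in> Sym n" "psd n X"
  obtains u :: "nat \<Rightarrow> nat \<Rightarrow> real"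
    where "\<And>i j. i < n \<Longrightarrow> j < n \<Longrightarrow> X i j = (\<Sum>l<n. u l i * u l j)"
proof -
  have "\<exists>u::nat \<Rightarrow> nat \<Rightarrow> real. \<forall>i<n. \<forall>j<n. X i j = (\<Sum>l<k. u l i * u l j)"
    if "k \<le> n" "\<And>i j. X i j = X j i" "psd n X" "\<And>i j. i < n - k \<Longrightarrow> j < n \<Longrightarrow> X i j = 0" for k X
    using that
  proof (induction k arbitrary: X)
    case 0
    then show ?case by auto
  next
    case (Suc k)
    define p where "p = n - Suc k"
    have p: "p < n" using Suc.prems(1) by (auto simp: p_def)
    have sym: "\<And>i j. X i j = X j i" by fact
    have q: "0 \<le> (\<Sum>i<n. \<Sum>j<n. x i * X i j * x j) + 2 * t * (\<Sum>j<n. X p j * x j) + t\<^sup>2 * X p p" for x t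
      using Suc.prems(3)[unfolded psd_def, rule_format, of "\<lambda>i. x i + (if i = p then t else 0)"]
      by (simp only: quadratic_form_shift[OF sym p])
    have d: "0 \<le> X p p" using q[of "\<lambda>_. 0" 1] by simp
    show ?case
    proof (cases "X p p = 0")
      case True
      have z: "X p j = 0" if "j < n" for j
      proof -
        have "(\<Sum>i<n. X p i * (if i = j then 1 else 0)) = X p j"
          using that by (simp add: if_distrib sum.delta cong: if_cong)
        then show ?thesis
          using affine_nonneg_imp_zero[OF q[of "\<lambda>i. if i = j then 1 else 0", unfolded True, simplified]] by simp
      qed
      have "X i j = 0" if "i < n - k" "j < n" for i j
        using that z Suc.prems(4) p_def by (cases "i = p") auto
      then obtain u where u: "\<forall>i<n. \<forall>j<n. X i j = (\<Sum>l<k. u l i * u l j)"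
        using Suc.IH[of X] Suc.prems by auto
      show ?thesis by (rule exI[of _ "u(k := \<lambda>_. 0)"]) (use u in auto)
    next
      case False
      with d have d: "0 < X p p" by simp
      define w where "w = (\<lambda>i. X p i / sqrt (X p p))"
      have w: "w i * w j = X p i * X p j / X p p" for i j using d by (simp add: w_def)
      \<comment> \<open>The Schur complement: row and column \<open>p\<close> of \<open>Y\<close>
        vanish, so one more row is cleared.\<close>
      define Y where "Y = (\<lambda>i j. X i j - w i * w j)"
      have "0 \<le> (\<Sum>i<n. \<Sum>j<n. x i * Y i j * x j)" for x
      proof -
        define c where "c = (\<Sum>j<n. X p j * x j)"
        have "(\<Sum>i<n. \<Sum>j<n. x i * (w i * w j) * x j) = (\<Sum>i<n. \<Sum>j<n. (X p i * x i) * (X p j * x j)) / X p p"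
          unfolding w sum_divide_distrib by (intro sum.cong refl) (simp add: field_simps)
        also have "\<dots> = c\<^sup>2 / X p p"
          by (simp add: c_def power2_eq_square sum_product)
        finally have e: "(\<Sum>i<n. \<Sum>j<n. x i * Y i j * x j) = (\<Sum>i<n. \<Sum>j<n. x i * X i j * x j) - c\<^sup>2 / X p p"
          by (simp add: Y_def algebra_simps sum_subtractf)
        have "2 * (- c / X p p) * c + (- c / X p p)\<^sup>2 * X p p = - (c\<^sup>2 / X p p)"
          using d by (simp add: power2_eq_square field_simps)
        then show ?thesis using q[of x "- c / X p p"] e unfolding c_def[symmetric] by linarith
      qed
      then have "psd n Y" by (simp add: psd_def)
      moreover have "Y i j = 0" if "i < n - k" "j < n" for i j
      proof (cases "i = p")
        case True
        then show ?thesis using d by (simp add: Y_def w)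
      next
        case False
        then have "i < n - Suc k" using that p_def by auto
        then have "X i j = 0" "X i p = 0" using Suc.prems(4) that p by auto
        then show ?thesis using sym[of p i] by (simp add: Y_def w)
      qed
      moreover have "Y i j = Y j i" for i j using sym[of i j] by (simp add: Y_def)
      ultimately obtain u where u: "\<forall>i<n. \<forall>j<n. Y i j = (\<Sum>l<k. u l i * u l j)"
        using Suc.IH[of Y] Suc.prems(1) by (metis Suc_leD)
      have "\<forall>i<n. \<forall>j<n. X i j = (\<Sum>l<Suc k. (u(k := w)) l i * (u(k := w)) l j)"
        using u by (auto simp: Y_def diff_eq_eq)
      then show ?thesis by blast
    qed
  qed
  from this[of n X] assms that show ?thesis by (auto simp: Sym_def)
qed

section \<open>The body as a hull of rank one atoms\<close>

text \<open>A ball rather than a sphere, so that the zero vector belongs to it even for empty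
  \<open>S\<close>; \<open>greedy_atoms\<close> uses this to see that its candidate bound is
  non-negative.\<close>

definition unit_on :: "nat \<Rightarrow> nat set \<Rightarrow> (nat \<Rightarrow> real) set" where
  "unit_on n S = {u. (\<forall>i. i \<notin> S \<longrightarrow> u i = 0) \<and> (\<Sum>i<n. (u i)\<^sup>2) \<le> 1}"

text \<open>Cutting the vectors of a rank one decomposition of \<open>X\<close> down to
  \<open>S\<close> decomposes \<open>restr S X\<close>, and their squared norms sum to at most the
  trace. In dual form this says that \<open>restr S X\<close> lies in the hull of \<open>0\<close>
  and the atoms supported on \<open>S\<close>; testing against all \<open>R\<close> is the form in
  which it is used.\<close>

lemma psd_support_bound:
  assumes X: "X \<in> Sym n" "psd n X" and tr: "(\<Sum>i<n. X i i) \<le> 1" and \<tau>: "0 \<le> \<tau>"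
    and bound: "\<And>u. u \<in> unit_on n S \<Longrightarrow> frob_inner n R (\<lambda>i j. u i * u j) \<le> \<tau>"
  shows "frob_inner n R (restr S X) \<le> \<tau>"
proof -
  obtain u where u: "\<And>i j. i < n \<Longrightarrow> j < n \<Longrightarrow> X i j = (\<Sum>l<n. u l i * u l j)"
    using psd_sum_rank_one[OF X] by blast
  define w where "w = (\<lambda>l i. if i \<in> S then u l i else 0)"
  have one: "frob_inner n R (\<lambda>i j. w l i * w l j) \<le> \<tau> * (\<Sum>i<n. (w l i)\<^sup>2)" for l
  proof (cases "(\<Sum>i<n. (w l i)\<^sup>2) = 0")
    case True
    then have "w l i = 0" if "i < n" for i using that by (subst (asm) sum_nonneg_eq_0_iff) auto
    then show ?thesis by (simp add: frob_inner_def)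
  next
    case False
    define N where "N = (\<Sum>i<n. (w l i)\<^sup>2)"
    have N: "0 < N" using False unfolding N_def by (simp add: less_le sum_nonneg)
    have "(\<lambda>i. w l i / sqrt N) \<in> unit_on n S"
      using N by (auto simp: unit_on_def w_def power_divide N_def[symmetric] simp flip: sum_divide_distrib)
        (simp add: N_def w_def)
    from bound[OF this] have "frob_inner n R (\<lambda>i j. w l i / sqrt N * (w l j / sqrt N)) \<le> \<tau>" .
    moreover have "frob_inner n R (\<lambda>i j. w l i / sqrt N * (w l j / sqrt N)) = frob_inner n R (\<lambda>i j. w l i * w l j) / N"
      unfolding frob_inner_def sum_divide_distrib using N by (intro sum.cong refl) simp
    ultimately have "frob_inner n R (\<lambda>i j. w l i * w l j) / N \<le> \<tau>" by metis
    then show ?thesis using N by (simp only: N_def[symmetric] pos_divide_le_eq)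
  qed
  have "frob_inner n R (restr S X) = (\<Sum>i<n. \<Sum>j<n. \<Sum>l<n. R i j * (w l i * w l j))"
    unfolding frob_inner_def by (intro sum.cong refl) (auto simp: restr_def u w_def sum_distrib_left)
  also have "\<dots> = (\<Sum>l<n. frob_inner n R (\<lambda>i j. w l i * w l j))"
    unfolding frob_inner_def by (subst (2) sum.swap, subst sum.swap, rule refl)
  also have "\<dots> \<le> (\<Sum>l<n. \<tau> * (\<Sum>i<n. (w l i)\<^sup>2))"
    by (intro sum_mono one)
  also have "\<dots> = \<tau> * (\<Sum>i<n. \<Sum>l<n. (w l i)\<^sup>2)"
    unfolding sum_distrib_left[symmetric] by (subst sum.swap) simp
  also have "\<dots> \<le> \<tau> * (\<Sum>i<n. X i i)"
  proof (intro mult_left_mono \<tau> sum_mono)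
    fix i assume "i \<in> {..<n}"
    then show "(\<Sum>l<n. (w l i)\<^sup>2) \<le> X i i"
      by (cases "i \<in> S") (simp_all add: u w_def power2_eq_square sum_nonneg)
  qed
  also have "\<dots> \<le> \<tau>" using tr \<tau> by (simp add: mult_left_le)
  finally show ?thesis .
qed

lemma frob_inner_linear_right:
  "frob_inner n R (\<lambda>i j. \<Sum>x\<in>F. c x * f x i j) = (\<Sum>x\<in>F. c x * frob_inner n R (f x))"
proof -
  have "frob_inner n R (\<lambda>i j. \<Sum>x\<in>F. c x * f x i j) = (\<Sum>i<n. \<Sum>j<n. \<Sum>x\<in>F. c x * (R i j * f x i j))"
    unfolding frob_inner_def by (simp add: sum_distrib_left mult.left_commute)
  also have "\<dots> = (\<Sum>x\<in>F. \<Sum>i<n. \<Sum>j<n. c x * (R i j * f x i j))"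
    by (subst sum.swap[where A = F], rule sum.cong[OF refl], rule sum.swap)
  finally show ?thesis by (simp add: frob_inner_def sum_distrib_left)
qed

lemma frob_inner_minus_right: "frob_inner n R (\<lambda>i j. - X i j) = - frob_inner n R X"
  by (simp add: frob_inner_def sum_negf)

lemma frob_inner_minus_left: "frob_inner n (\<lambda>i j. - X i j) Y = - frob_inner n X Y"
  by (simp add: frob_inner_def sum_negf)

lemma bodyE:
  assumes "Z \<in> body n km kp"
  obtains F c where "finite F" "F \<subseteq> body_plus n km kp \<union> scale (-1) (body_plus n km kp)"
    "\<And>X. X \<in> F \<Longrightarrow> 0 \<le> c X" "sum c F = 1" "Z = (\<lambda>i j. \<Sum>X\<in>F. c X * X i j)"
  using assms by (auto simp: body_def conv_def)

text \<open>A linear functional bounded on the generators is bounded on their convex combinations.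
  The absolute value in the hypothesis accounts for the reflected half of the body.\<close>

lemma body_support_bound:
  assumes Z: "Z \<in> body n km kp" and \<tau>: "0 \<le> \<tau>"
    and bound: "\<And>u. u \<in> unit_on n S \<Longrightarrow> \<bar>frob_inner n R (\<lambda>i j. u i * u j)\<bar> \<le> \<tau>"
  shows "frob_inner n R (restr S Z) \<le> \<tau>"
proof -
  obtain F c where F: "finite F" "F \<subseteq> body_plus n km kp \<union> scale (-1) (body_plus n km kp)"
    "\<And>X. X \<in> F \<Longrightarrow> 0 \<le> c X" "sum c F = 1" "Z = (\<lambda>i j. \<Sum>X\<in>F. c X * X i j)"
    by (rule bodyE[OF Z]) blast
  have one: "frob_inner n R (restr S X) \<le> \<tau>" if X: "X \<in> F" for X
  proof -
    consider "X \<in> body_plus n km kp" | Y where "Y \<in> body_plus n km kp" "X = (\<lambda>i j. - Y i j)"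
      using subsetD[OF F(2) X] by (auto simp: scale_def)
    then show ?thesis
    proof cases
      case 1
      then show ?thesis
        by (intro psd_support_bound \<tau>) (use bound in \<open>auto simp: body_plus_def cone_def abs_le_iff\<close>)
    next
      case 2
      have "frob_inner n (\<lambda>i j. - R i j) (restr S Y) \<le> \<tau>"
        by (intro psd_support_bound \<tau>)
           (use bound 2 in \<open>auto simp: body_plus_def cone_def abs_le_iff frob_inner_minus_left\<close>)
      moreover have "restr S X = (\<lambda>i j. - restr S Y i j)"
        unfolding 2 restr_def by (intro ext) simp
      ultimately show ?thesis by (simp add: frob_inner_minus_left frob_inner_minus_right)
    qed
  qed
  have "restr S Z = (\<lambda>i j. \<Sum>X\<in>F. c X * restr S X i j)"
    unfolding F(5) restr_def by (intro ext) auto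
  then have "frob_inner n R (restr S Z) = (\<Sum>X\<in>F. c X * frob_inner n R (restr S X))"
    by (simp add: frob_inner_linear_right)
  also have "\<dots> \<le> (\<Sum>X\<in>F. c X * \<tau>)"
    by (intro sum_mono mult_left_mono one F(3))
  also have "\<dots> = \<tau>" by (simp add: F(4) flip: sum_distrib_right)
  finally show ?thesis .
qed

section \<open>Truncation to few coordinates\<close>

text \<open>The envelope \<open>A\<close> is the same convex combination with all signs made positive.\<close>

lemma body_envelope:
  assumes Z: "Z \<in> body n km kp"
  obtains A :: rmat where
    "\<And>i j. \<bar>Z i j\<bar> \<le> A i j" "\<And>i j. A i j = A j i"
    "\<And>i j. i < n \<Longrightarrow> j < n \<Longrightarrow> A i j \<le> A i i"
    "\<And>i. i < n \<Longrightarrow> (\<Sum>j<n. A i j) \<le> kp * A i i" "(\<Sum>i<n. A i i) \<le> 1"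
proof -
  obtain F c where F: "finite F" "F \<subseteq> body_plus n km kp \<union> scale (-1) (body_plus n km kp)"
    "\<And>X. X \<in> F \<Longrightarrow> 0 \<le> c X" "sum c F = 1" "Z = (\<lambda>i j. \<Sum>X\<in>F. c X * X i j)"
    by (rule bodyE[OF Z]) blast
  define A where "A = (\<lambda>i j. \<Sum>X\<in>F. c X * \<bar>X i j\<bar>)"
  \<comment> \<open>Members of \<open>body_plus\<close> have non-negative entries, so taking
    absolute values merely undoes the reflection of the negative generators.\<close>
  have P: "(\<lambda>i j. \<bar>X i j\<bar>) \<in> body_plus n km kp" if "X \<in> F" for X
  proof -
    have a: "(\<lambda>i j. \<bar>Y i j\<bar>) = Y" if Y: "Y \<in> body_plus n km kp" for Y
    proof (intro ext)
      fix i j show "\<bar>Y i j\<bar> = Y i j" using Y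
        by (cases "i < n \<and> j < n") (auto simp: body_plus_def cone_def Sym_def)
    qed
    have "(\<lambda>i j. \<bar>X i j\<bar>) = X \<and> X \<in> body_plus n km kp
       \<or> (\<exists>Y\<in>body_plus n km kp. (\<lambda>i j. \<bar>X i j\<bar>) = (\<lambda>i j. \<bar>Y i j\<bar>))"
      using subsetD[OF F(2) that] a by (auto simp: scale_def)
    then show ?thesis using a by auto
  qed
  show thesis
  proof
    show "\<bar>Z i j\<bar> \<le> A i j" for i j
      unfolding F(5) A_def by (rule sum_abs[THEN order_trans]) (simp add: abs_mult F(3))
    show "A i j = A j i" for i j
      unfolding A_def using P by (intro sum.cong refl) (auto simp: body_plus_def cone_def Sym_def)
    show "A i j \<le> A i i" if "i < n" "j < n" for i j
      unfolding A_def using P that by (intro sum_mono mult_left_mono F(3)) (auto simp: body_plus_def cone_def)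
    show "(\<Sum>j<n. A i j) \<le> kp * A i i" if "i < n" for i
    proof -
      have "(\<Sum>j<n. A i j) = (\<Sum>X\<in>F. c X * (\<Sum>j<n. \<bar>X i j\<bar>))"
        unfolding A_def by (subst sum.swap) (simp add: sum_distrib_left)
      also have "\<dots> \<le> (\<Sum>X\<in>F. c X * (kp * \<bar>X i i\<bar>))"
        using P that by (intro sum_mono mult_left_mono F(3)) (auto simp: body_plus_def cone_def)
      finally show ?thesis by (simp add: A_def sum_distrib_left mult_ac)
    qed
    have "(\<Sum>i<n. A i i) = (\<Sum>X\<in>F. c X * (\<Sum>i<n. \<bar>X i i\<bar>))"
      unfolding A_def by (subst sum.swap) (simp add: sum_distrib_left)
    also have "\<dots> \<le> (\<Sum>X\<in>F. c X * 1)"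
      using P by (intro sum_mono mult_left_mono F(3)) (auto simp: body_plus_def)
    finally show "(\<Sum>i<n. A i i) \<le> 1" by (simp add: F(4))
  qed
qed

text \<open>
  Rows whose diagonal entry is at most \<open>1 / (r * kp)\<close> carry little Frobenius mass, because the
  squares of row \<open>i\<close> sum to at most \<open>A i i * (kp * A i i)\<close>; the trace bound leaves few other rows.
\<close>

lemma body_truncation:
  assumes Z: "Z \<in> body n km kp" and kp: "0 < kp" and r: "0 < r"
  obtains S where "S \<subseteq> {..<n}" "real (card S) \<le> r * kp"
    "frob_sq n (\<lambda>i j. Z i j - restr S Z i j) \<le> 2 / r"
proof -
  obtain A :: rmat where A: "\<And>i j. \<bar>Z i j\<bar> \<le> A i j" "\<And>i j. A i j = A j i"
    "\<And>i j. i < n \<Longrightarrow> j < n \<Longrightarrow> A i j \<le> A i i"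
    "\<And>i. i < n \<Longrightarrow> (\<Sum>j<n. A i j) \<le> kp * A i i" "(\<Sum>i<n. A i i) \<le> 1"
    using body_envelope[OF Z] by blast
  have A0: "0 \<le> A i j" for i j using A(1)[of i j] by linarith
  define S where "S = {i. i < n \<and> 1 / (r * kp) < A i i}"
  show thesis
  proof
    show "S \<subseteq> {..<n}" by (auto simp: S_def)
    have "(\<Sum>i\<in>S. 1 / (r * kp)) \<le> (\<Sum>i\<in>S. A i i)" by (intro sum_mono) (auto simp: S_def)
    also have "\<dots> \<le> (\<Sum>i<n. A i i)" by (intro sum_mono2) (auto simp: S_def A0)
    finally have "real (card S) / (r * kp) \<le> 1" using A(5) by simp
    then show "real (card S) \<le> r * kp" using kp r by (simp add: pos_divide_le_eq)
    \<comment> \<open>An entry removed by \<open>restr\<close> has its row or its column outside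
      \<open>S\<close>. Columns are treated as rows by symmetry of the envelope, which doubles the
      bound \<open>1 / r\<close> for the rows.\<close>
    define h where "h = (\<lambda>i j. if i \<notin> S then (A i j)\<^sup>2 else 0)"
    have row: "(\<Sum>j<n. h i j) \<le> A i i / r" if i: "i < n" for i
    proof (cases "i \<in> S")
      case True then show ?thesis using A0 r by (simp add: h_def)
    next
      case False
      then have le: "A i i * kp \<le> 1 / r" using i kp r by (simp add: S_def field_simps)
      have "(\<Sum>j<n. h i j) \<le> (\<Sum>j<n. A i i * A i j)"
        using False i A(3) A0 by (intro sum_mono) (auto simp: h_def power2_eq_square intro: mult_right_mono)
      also have "\<dots> \<le> A i i * (kp * A i i)"
        using A(4)[OF i] A0 by (simp flip: sum_distrib_left add: mult_left_mono)
      also have "\<dots> \<le> A i i * (1 / r)"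
        using le A0 by (intro mult_left_mono) (auto simp: mult.commute)
      finally show ?thesis by simp
    qed
    have tot: "(\<Sum>i<n. \<Sum>j<n. h i j) \<le> 1 / r"
    proof -
      have "(\<Sum>i<n. \<Sum>j<n. h i j) \<le> (\<Sum>i<n. A i i / r)" by (intro sum_mono row) simp
      also have "\<dots> \<le> 1 / r" using A(5) r by (simp flip: sum_divide_distrib add: divide_right_mono)
      finally show ?thesis .
    qed
    have "frob_sq n (\<lambda>i j. Z i j - restr S Z i j) \<le> (\<Sum>i<n. \<Sum>j<n. h i j + h j i)"
      unfolding frob_sq_def
    proof (intro sum_mono)
      fix i j
      have "(Z i j)\<^sup>2 \<le> (A i j)\<^sup>2" using A(1)[of i j] by (rule power2_le_iff_abs_le[THEN iffD2, OF A0])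
      moreover from this have "(Z i j)\<^sup>2 \<le> 2 * (A i j)\<^sup>2"
        using zero_le_power2[of "A i j"] by linarith
      ultimately show "(Z i j - restr S Z i j)\<^sup>2 \<le> h i j + h j i"
        using A(2)[of j i] by (auto simp: restr_def h_def)
    qed
    also have "\<dots> = 2 * (\<Sum>i<n. \<Sum>j<n. h i j)"
      unfolding sum.distrib using sum.swap[of "\<lambda>i j. h j i" "{..<n}" "{..<n}"] by simp
    finally show "frob_sq n (\<lambda>i j. Z i j - restr S Z i j) \<le> 2 / r" using tot by simp
  qed
qed

section \<open>Finite grids of sparse vectors and nets of atoms\<close>

text \<open>Overwriting one coordinate per step makes the cardinality bound immediate. Coordinates
  may be overwritten repeatedly or with \<open>0\<close>, so smaller supports are included.\<close>

primrec sparse_grid :: "nat \<Rightarrow> nat \<Rightarrow> nat \<Rightarrow> (nat \<Rightarrow> real) set" where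
  "sparse_grid n q 0 = {\<lambda>_. 0}"
| "sparse_grid n q (Suc s) = (\<lambda>(u, i, z). u(i := real_of_int z / real q)) `
     (sparse_grid n q s \<times> {..<n} \<times> {- int q..int q})"

lemma finite_sparse_grid [simp]: "finite (sparse_grid n q s)"
  by (induction s) auto

lemma card_sparse_grid: "card (sparse_grid n q s) \<le> (n * (2 * q + 1)) ^ s"
proof (induction s)
  case (Suc s)
  have "card (sparse_grid n q (Suc s)) \<le> card (sparse_grid n q s \<times> {..<n} \<times> {- int q..int q})"
    unfolding sparse_grid.simps by (rule card_image_le) auto
  also have "\<dots> = card (sparse_grid n q s) * (n * (2 * q + 1))"
    by (simp add: card_cartesian_product nat_add_distrib nat_mult_distrib)
  also have "\<dots> \<le> (n * (2 * q + 1)) ^ Suc s" using Suc by simp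
  finally show ?case .
qed simp

lemma sparse_grid_support: "u \<in> sparse_grid n q s \<Longrightarrow> n \<le> i \<Longrightarrow> u i = 0"
  by (induction s arbitrary: u) auto

lemma sparse_gridI:
  assumes "0 < n" "0 < q" "T \<subseteq> {..<n}" "card T \<le> s" "\<And>i. i \<notin> T \<Longrightarrow> u i = 0"
    "\<And>i. \<exists>z\<in>{- int q..int q}. u i = real_of_int z / real q"
  shows "u \<in> sparse_grid n q s"
  using assms(3-)
proof (induction s arbitrary: T u)
  case 0
  then have "finite T" by (auto intro: finite_subset)
  with 0 have "T = {}" by simp
  with 0 have "u = (\<lambda>_. 0)" by auto
  then show ?case by simp
next
  case (Suc s)
  have fin: "finite T" using Suc.prems(1) by (auto intro: finite_subset)
  \<comment> \<open>For non-empty \<open>T\<close> the step must spend its write inside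
    \<open>T\<close> to lower the cardinality. For empty \<open>T\<close> it rewrites the value
    \<open>0\<close> at an arbitrary index, which exists because \<open>0 < n\<close>.\<close>
  obtain i where i: "i < n" "T \<noteq> {} \<Longrightarrow> i \<in> T"
    using Suc.prems(1) assms(1) by (cases "T = {}") auto
  have "u(i := 0) \<in> sparse_grid n q s"
  proof (rule Suc.IH[of "T - {i}"])
    show "card (T - {i}) \<le> s"
      using i(2) Suc.prems(2) fin by (cases "T = {}") (auto simp: card_Diff_singleton)
    show "\<exists>z\<in>{- int q..int q}. (u(i := 0)) j = real_of_int z / real q" for j
      using Suc.prems(4)[of j] by (cases "j = i") (auto intro: bexI[of _ 0])
  qed (use Suc.prems in auto)
  moreover obtain z where "z \<in> {- int q..int q}" "u i = real_of_int z / real q"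
    using Suc.prems(4) by blast
  moreover have "u = (u(i := 0))(i := u i)" by simp
  ultimately show ?case
    unfolding sparse_grid.simps using i(1)
    by (intro image_eqI[of _ _ "(u(i := 0), i, z)"]) auto
qed

lemma unit_on_abs_le:
  assumes "u \<in> unit_on n S" "S \<subseteq> {..<n}"
  shows "\<bar>u i\<bar> \<le> 1"
proof (cases "i \<in> S")
  case True
  then have "(u i)\<^sup>2 \<le> (\<Sum>i<n. (u i)\<^sup>2)" using assms(2) by (intro member_le_sum) auto
  then have "(u i)\<^sup>2 \<le> 1" using assms(1) by (simp add: unit_on_def)
  then show ?thesis by (simp add: abs_square_le_1)
qed (use assms in \<open>auto simp: unit_on_def\<close>)

lemma unit_on_round:
  assumes u: "u \<in> unit_on n S" and S: "S \<subseteq> {..<n}" "card S \<le> s" and nq: "0 < n" "0 < q"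
  obtains w where "w \<in> sparse_grid n q s" "\<And>i j. \<bar>u i * u j - w i * w j\<bar> \<le> 2 / real q"
proof -
  \<comment> \<open>Rounding down to multiples of \<open>1 / q\<close> fixes \<open>0\<close>, so
    the support survives, and keeps values in the interval from -1 to 1.\<close>
  define w where "w = (\<lambda>i. real_of_int \<lfloor>u i * real q\<rfloor> / real q)"
  have le: "- 1 \<le> u i" "u i \<le> 1" for i using unit_on_abs_le[OF u S(1), of i] by auto
  have z: "- int q \<le> \<lfloor>u i * real q\<rfloor> \<and> \<lfloor>u i * real q\<rfloor> \<le> int q" for i
  proof
    have "- real q \<le> u i * real q" using mult_right_mono[OF le(1)[of i], of "real q"] by simp
    then show "- int q \<le> \<lfloor>u i * real q\<rfloor>" by (simp add: le_floor_iff)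
    have "u i * real q \<le> real q" using mult_right_mono[OF le(2)[of i], of "real q"] by simp
    then show "\<lfloor>u i * real q\<rfloor> \<le> int q" by (simp add: floor_le_iff)
  qed
  have close: "\<bar>u i - w i\<bar> \<le> 1 / real q" for i
  proof -
    have "u i - w i = (u i * real q - real_of_int \<lfloor>u i * real q\<rfloor>) / real q"
      using nq by (simp add: w_def field_simps)
    moreover have "\<bar>u i * real q - real_of_int \<lfloor>u i * real q\<rfloor>\<bar> \<le> 1" by linarith
    ultimately show ?thesis using nq by (simp add: divide_right_mono)
  qed
  have w1: "\<bar>w i\<bar> \<le> 1" for i
    using z[of i] nq by (auto simp: w_def abs_le_iff field_simps)
  show thesis
  proof
    show "w \<in> sparse_grid n q s"
    proof (rule sparse_gridI[OF nq S])
      show "w i = 0" if "i \<notin> S" for i using that u by (simp add: w_def unit_on_def)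
      show "\<exists>z\<in>{- int q..int q}. w i = real_of_int z / real q" for i
        using z[of i] by (auto simp: w_def)
    qed
    show "\<bar>u i * u j - w i * w j\<bar> \<le> 2 / real q" for i j
    proof -
      have "\<bar>u i * u j - w i * w j\<bar> = \<bar>u i * (u j - w j) + (u i - w i) * w j\<bar>"
        by (simp add: algebra_simps)
      also have "\<dots> \<le> \<bar>u i\<bar> * \<bar>u j - w j\<bar> + \<bar>u i - w i\<bar> * \<bar>w j\<bar>"
        by (rule abs_triangle_ineq[THEN order_trans]) (simp add: abs_mult)
      also have "\<dots> \<le> 1 * (1 / real q) + (1 / real q) * 1"
        by (intro add_mono mult_mono close w1 unit_on_abs_le[OF u S(1)]) auto
      finally show ?thesis by simp
    qed
  qed
qed

text \<open>Sums rather than averages: the greedy induction then adds an atom without rescaling the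
  earlier ones. The division by the number of atoms happens in \<open>body_net\<close>.\<close>

primrec atom_net :: "nat \<Rightarrow> nat \<Rightarrow> nat \<Rightarrow> nat \<Rightarrow> rmat set" where
  "atom_net n q s 0 = {\<lambda>_ _. 0}"
| "atom_net n q s (Suc t) = (\<lambda>(m, \<sigma>, u) i j. m i j + \<sigma> * (u i * u j)) `
     (atom_net n q s t \<times> {-1, 1} \<times> sparse_grid n q s)"

lemma finite_atom_net [simp]: "finite (atom_net n q s t)"
  by (induction t) auto

lemma card_atom_net: "card (atom_net n q s t) \<le> (2 * (n * (2 * q + 1)) ^ s) ^ t"
proof (induction t)
  case (Suc t)
  have "card (atom_net n q s (Suc t)) \<le> card (atom_net n q s t \<times> {-1, 1::real} \<times> sparse_grid n q s)"
    unfolding atom_net.simps by (rule card_image_le) auto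
  also have "\<dots> = card (atom_net n q s t) * (2 * card (sparse_grid n q s))"
    by (simp add: card_cartesian_product)
  also have "\<dots> \<le> (2 * (n * (2 * q + 1)) ^ s) ^ t * (2 * (n * (2 * q + 1)) ^ s)"
    by (intro mult_le_mono Suc card_sparse_grid) auto
  finally show ?case by (simp only: power_Suc2)
qed simp

lemma atom_net_Sym: "m \<in> atom_net n q s t \<Longrightarrow> m \<in> Sym n"
proof (induction t arbitrary: m)
  case 0
  then show ?case by (simp add: Sym_def)
next
  case (Suc t)
  then obtain m' \<sigma> u where m': "m' \<in> atom_net n q s t" "u \<in> sparse_grid n q s"
    "m = (\<lambda>i j. m' i j + \<sigma> * (u i * u j))" by auto
  then show ?case using Suc.IH[OF m'(1)] sparse_grid_support[OF m'(2)] by (auto simp: Sym_def)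
qed

lemma frob_sq_add:
  "frob_sq n (\<lambda>i j. X i j + Y i j) = frob_sq n X + 2 * frob_inner n X Y + frob_sq n Y"
  by (simp add: frob_sq_def frob_inner_def power2_sum sum.distrib sum_distrib_left mult_ac)

lemma frob_sq_diff:
  "frob_sq n (\<lambda>i j. X i j - Y i j) = frob_sq n X - 2 * frob_inner n X Y + frob_sq n Y"
  by (simp add: frob_sq_def frob_inner_def power2_diff sum.distrib sum_subtractf sum_distrib_left mult_ac)

lemma frob_inner_diff_right:
  "frob_inner n R (\<lambda>i j. X i j - Y i j) = frob_inner n R X - frob_inner n R Y"
  by (simp add: frob_inner_def algebra_simps sum_subtractf)

lemma frob_inner_scale_right: "frob_inner n R (\<lambda>i j. c * X i j) = c * frob_inner n R X"
  by (simp add: frob_inner_def sum_distrib_left mult_ac)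

lemma frob_inner_self: "frob_inner n X X = frob_sq n X"
  by (simp add: frob_inner_def frob_sq_def power2_eq_square)

lemma frob_sq_scale: "frob_sq n (\<lambda>i j. c * X i j) = c\<^sup>2 * frob_sq n X"
  by (simp add: frob_sq_def sum_distrib_left power_mult_distrib)

lemma frob_inner_le: "2 * \<bar>frob_inner n X Y\<bar> \<le> frob_sq n X + frob_sq n Y"
  using frob_sq_nonneg[of n "\<lambda>i j. X i j + Y i j"] frob_sq_nonneg[of n "\<lambda>i j. X i j - Y i j"]
  unfolding frob_sq_add frob_sq_diff by linarith

lemma frob_sq_diff_le: "frob_sq n (\<lambda>i j. X i j - Y i j) \<le> 2 * frob_sq n X + 2 * frob_sq n Y"
  using frob_inner_le[of n X Y] unfolding frob_sq_diff by linarith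

lemma frob_sq_outer: "frob_sq n (\<lambda>i j. u i * u j) = (\<Sum>i<n. (u i)\<^sup>2)\<^sup>2"
  by (simp add: frob_sq_def power_mult_distrib power2_eq_square[of "sum _ _"] sum_product)

lemma frob_sq_outer_unit: "u \<in> unit_on n S \<Longrightarrow> frob_sq n (\<lambda>i j. u i * u j) \<le> 1"
  unfolding frob_sq_outer by (auto simp: unit_on_def power_le_one sum_nonneg)

text \<open>The truncated matrix is used as its own test functional. Atoms have norm at most
  \<open>1\<close>, so the functional is at most \<open>(frob_sq n R + 1) / 2\<close> on them, hence
  also at \<open>R\<close> itself, where its value is \<open>frob_sq n R\<close>.\<close>

lemma restr_body_norm:
  assumes Z: "Z \<in> body n km kp"
  shows "frob_sq n (restr S Z) \<le> 1"
proof -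
  define R where "R = restr S Z"
  have "frob_inner n R (restr S Z) \<le> (frob_sq n R + 1) / 2"
  proof (rule body_support_bound[OF Z])
    show "0 \<le> (frob_sq n R + 1) / 2" using frob_sq_nonneg[of n R] by simp
    show "\<bar>frob_inner n R (\<lambda>i j. u i * u j)\<bar> \<le> (frob_sq n R + 1) / 2" if "u \<in> unit_on n S" for u
      using frob_inner_le[of n R "\<lambda>i j. u i * u j"] frob_sq_outer_unit[OF that] by simp
  qed
  then show ?thesis by (simp add: R_def frob_inner_self)
qed

text \<open>
  A greedy form of Maurey's lemma: as \<open>Z\<close> lies in the hull of the atoms \<open>\<plusminus>uu\<^sup>T\<close>, each new atom can be
  chosen almost non-negatively correlated with the current residual, so that the squared norm of
  the residual grows only linearly in the number of atoms.
\<close>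

lemma greedy_atoms:
  assumes Z: "Z \<in> body n km kp" and S: "S \<subseteq> {..<n}" "card S \<le> s" and nq: "0 < n" "0 < q"
  shows "\<exists>m0. \<exists>m\<in>atom_net n q s t. frob_sq n (\<lambda>i j. real t * restr S Z i j - m0 i j) \<le> 6 * real t
     \<and> (\<forall>i j. \<bar>m0 i j - m i j\<bar> \<le> real t * (2 / real q))"
proof (induction t)
  case 0
  show ?case by (intro exI[of _ "\<lambda>_ _. 0"]) (auto simp: frob_sq_def)
next
  case (Suc t)
  \<comment> \<open>The greedy choice follows the exact sum \<open>m0\<close>; the net element
    \<open>m\<close> only shadows it with rounded atoms. Thus rounding errors never feed back into
    the residual.\<close>
  then obtain m0 m where m: "m \<in> atom_net n q s t"
    "frob_sq n (\<lambda>i j. real t * restr S Z i j - m0 i j) \<le> 6 * real t"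
    "\<And>i j. \<bar>m0 i j - m i j\<bar> \<le> real t * (2 / real q)" by blast
  define Q where "Q = restr S Z"
  define R where "R = (\<lambda>i j. real t * Q i j - m0 i j)"
  \<comment> \<open>If all signed atoms fell short of the correlation with \<open>Q\<close> by more
    than \<open>1\<close>, the support bound would give the same shortfall for \<open>Q\<close>
    itself. The slack \<open>1\<close> avoids having to attain a supremum.\<close>
  have "\<exists>u\<in>unit_on n S. \<exists>\<sigma>\<in>{-1, 1}. frob_inner n R Q - 1 \<le> \<sigma> * frob_inner n R (\<lambda>i j. u i * u j)"
  proof (rule ccontr)
    assume neg: "\<not> ?thesis"
    have *: "\<sigma> * frob_inner n R (\<lambda>i j. u i * u j) < frob_inner n R Q - 1"
      if "u \<in> unit_on n S" "\<sigma> \<in> {-1, 1}" for u \<sigma>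
      using neg that by (meson not_le_imp_less)
    have b: "\<bar>frob_inner n R (\<lambda>i j. u i * u j)\<bar> \<le> frob_inner n R Q - 1" if "u \<in> unit_on n S" for u
      using *[OF that, of 1] *[OF that, of "-1"] by (auto simp: abs_le_iff)
    have "(\<lambda>_. 0) \<in> unit_on n S" by (simp add: unit_on_def)
    from b[OF this] have "0 \<le> frob_inner n R Q - 1" by linarith
    then have "frob_inner n R (restr S Z) \<le> frob_inner n R Q - 1"
      by (rule body_support_bound[OF Z _ b])
    then show False by (simp add: Q_def)
  qed
  then obtain u \<sigma> where u: "u \<in> unit_on n S" "\<sigma> \<in> {-1, 1::real}"
    and \<sigma>: "frob_inner n R Q - 1 \<le> \<sigma> * frob_inner n R (\<lambda>i j. u i * u j)" by blast
  define a where "a = (\<lambda>i j. \<sigma> * (u i * u j))"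
  have "frob_sq n a = \<sigma>\<^sup>2 * frob_sq n (\<lambda>i j. u i * u j)" unfolding a_def by (rule frob_sq_scale)
  then have a1: "frob_sq n a \<le> 1" using u(2) frob_sq_outer_unit[OF u(1)] by auto
  have "frob_inner n R a = \<sigma> * frob_inner n R (\<lambda>i j. u i * u j)"
    unfolding a_def by (rule frob_inner_scale_right)
  then have ip: "frob_inner n R (\<lambda>i j. Q i j - a i j) \<le> 1"
    using \<sigma> by (simp add: frob_inner_diff_right)
  have nn: "frob_sq n (\<lambda>i j. Q i j - a i j) \<le> 4"
    using frob_sq_diff_le[of n Q a] a1 restr_body_norm[OF Z, of S] by (simp add: Q_def)
  obtain w where w: "w \<in> sparse_grid n q s" "\<And>i j. \<bar>u i * u j - w i * w j\<bar> \<le> 2 / real q"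
    using unit_on_round[OF u(1) S nq] by blast
  define m' where "m' = (\<lambda>i j. m i j + \<sigma> * (w i * w j))"
  define m0' where "m0' = (\<lambda>i j. m0 i j + a i j)"
  have "m' \<in> atom_net n q s (Suc t)"
    unfolding atom_net.simps m'_def by (rule image_eqI[of _ _ "(m, \<sigma>, w)"]) (use m(1) u(2) w(1) in auto)
  \<comment> \<open>The increment \<open>6 = 2 * 1 + 4\<close> is twice the slack in the correlation
    plus the bound \<open>4\<close> on the squared norm of \<open>Q - a\<close>.\<close>
  moreover have "frob_sq n (\<lambda>i j. real (Suc t) * Q i j - m0' i j) \<le> 6 * real (Suc t)"
  proof -
    have "(\<lambda>i j. real (Suc t) * Q i j - m0' i j) = (\<lambda>i j. R i j + (Q i j - a i j))"
      by (auto simp: R_def m0'_def algebra_simps)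
    then have "frob_sq n (\<lambda>i j. real (Suc t) * Q i j - m0' i j)
        = frob_sq n R + 2 * frob_inner n R (\<lambda>i j. Q i j - a i j) + frob_sq n (\<lambda>i j. Q i j - a i j)"
      by (simp add: frob_sq_add)
    also have "\<dots> \<le> 6 * real t + 2 * 1 + 4"
      by (intro add_mono mult_left_mono ip nn) (use m(2) in \<open>auto simp: R_def Q_def\<close>)
    finally show ?thesis by simp
  qed
  moreover have "\<bar>m0' i j - m' i j\<bar> \<le> real (Suc t) * (2 / real q)" for i j
  proof -
    have "m0' i j - m' i j = (m0 i j - m i j) + \<sigma> * (u i * u j - w i * w j)"
      by (simp add: m0'_def m'_def a_def algebra_simps)
    also have "\<bar>\<dots>\<bar> \<le> \<bar>m0 i j - m i j\<bar> + \<bar>\<sigma> * (u i * u j - w i * w j)\<bar>" by (rule abs_triangle_ineq)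
    also have "\<dots> \<le> real t * (2 / real q) + 2 / real q"
      using u(2) w(2)[of i j] by (intro add_mono m(3)) (auto simp: abs_mult)
    finally show ?thesis by (simp add: distrib_right add_divide_distrib)
  qed
  ultimately show ?case unfolding Q_def by blast
qed

lemma body_net:
  assumes kp: "0 < kp" and n: "0 < n" and r: "0 < r" and s: "real r * kp \<le> real s"
  obtains M where "finite M" "M \<noteq> {}" "M \<subseteq> Sym n"
    "card M \<le> (2 * (n * (2 * (n * r) + 1)) ^ s) ^ r"
    "\<And>\<mu>. \<mu> \<in> scale \<theta> (body n km kp) \<Longrightarrow> \<exists>m\<in>M. frob_sq n (\<lambda>i j. \<mu> i j - m i j) \<le> 36 * \<theta>\<^sup>2 / real r"
proof -
  \<comment> \<open>A mesh this fine makes the \<open>n * n\<close> entrywise rounding errors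
    contribute only \<open>4 / r^2\<close> in total, yet costs merely a logarithm in the size of the
    net.\<close>
  define q where "q = n * r"
  have q: "0 < q" using n r by (simp add: q_def)
  define M where "M = (\<lambda>m i j. (\<theta> / real r) * m i j) ` atom_net n q s r"
  have approx: "\<exists>m\<in>M. frob_sq n (\<lambda>i j. \<mu> i j - m i j) \<le> 36 * \<theta>\<^sup>2 / real r"
    if \<mu>: "\<mu> \<in> scale \<theta> (body n km kp)" for \<mu>
  proof -
    obtain Z where Z: "Z \<in> body n km kp" "\<mu> = (\<lambda>i j. \<theta> * Z i j)"
      using \<mu> unfolding scale_def by blast
    obtain S where S: "S \<subseteq> {..<n}" "real (card S) \<le> real r * kp"
      "frob_sq n (\<lambda>i j. Z i j - restr S Z i j) \<le> 2 / real r"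
      using body_truncation[OF Z(1) kp, of "real r"] r by auto
    have "card S \<le> s" using S(2) s by linarith
    from greedy_atoms[OF Z(1) S(1) this n q, of r] obtain m0 m where
      m: "m \<in> atom_net n q s r" "frob_sq n (\<lambda>i j. real r * restr S Z i j - m0 i j) \<le> 6 * real r"
        "\<And>i j. \<bar>m0 i j - m i j\<bar> \<le> real r * (2 / real q)" by blast
    \<comment> \<open>Truncation, greedy averaging and rounding, with squared norms at most
      \<open>2 / r\<close>, \<open>6 / r\<close> and \<open>4 / r\<close>. The square of a sum of
      three terms costs a factor \<open>3\<close>, whence \<open>36\<close>.\<close>
    define x y z where "x = (\<lambda>i j. Z i j - restr S Z i j)"
      and "y = (\<lambda>i j. restr S Z i j - m0 i j / real r)" and "z = (\<lambda>i j. (m0 i j - m i j) / real r)"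
    have y: "frob_sq n y \<le> 6 / real r"
    proof -
      have "y = (\<lambda>i j. (1 / real r) * (real r * restr S Z i j - m0 i j))"
        using r by (auto simp: y_def field_simps)
      then have "frob_sq n y = (1 / real r)\<^sup>2 * frob_sq n (\<lambda>i j. real r * restr S Z i j - m0 i j)"
        by (simp only: frob_sq_scale)
      also have "\<dots> \<le> (1 / real r)\<^sup>2 * (6 * real r)" by (intro mult_left_mono m) auto
      finally show ?thesis using r by (simp add: power2_eq_square)
    qed
    have z: "frob_sq n z \<le> 4 / real r"
    proof -
      have "(z i j)\<^sup>2 \<le> (2 / real q)\<^sup>2" for i j
      proof (rule power2_le_iff_abs_le[THEN iffD2])
        have "\<bar>z i j\<bar> = \<bar>m0 i j - m i j\<bar> / real r" by (simp add: z_def)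
        also have "\<dots> \<le> (real r * (2 / real q)) / real r" by (intro divide_right_mono m) simp
        finally show "\<bar>z i j\<bar> \<le> 2 / real q" using r by simp
      qed simp
      then have "frob_sq n z \<le> (\<Sum>i<n. \<Sum>j<n. (2 / real q)\<^sup>2)"
        unfolding frob_sq_def by (intro sum_mono)
      also have "\<dots> = 4 / (real r)\<^sup>2"
        using n r by (simp add: q_def power2_eq_square field_simps)
      also have "\<dots> \<le> 4 / real r" using r by (simp add: field_simps power2_eq_square)
      finally show ?thesis .
    qed
    have "frob_sq n (\<lambda>i j. Z i j - m i j / real r) \<le> (\<Sum>i<n. \<Sum>j<n. 3 * ((x i j)\<^sup>2 + (y i j)\<^sup>2 + (z i j)\<^sup>2))"
      unfolding frob_sq_def
    proof (intro sum_mono)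
      fix i j
      have "Z i j - m i j / real r = x i j + y i j + z i j"
        by (simp add: x_def y_def z_def diff_divide_distrib)
      moreover have "(p + q + t)\<^sup>2 \<le> 3 * (p\<^sup>2 + q\<^sup>2 + t\<^sup>2)" for p q t :: real
        using zero_le_power2[of "p - q"] zero_le_power2[of "p - t"] zero_le_power2[of "q - t"]
        by (simp add: power2_eq_square algebra_simps)
      ultimately show "(Z i j - m i j / real r)\<^sup>2 \<le> 3 * ((x i j)\<^sup>2 + (y i j)\<^sup>2 + (z i j)\<^sup>2)"
        by simp
    qed
    also have "\<dots> = 3 * (frob_sq n x + frob_sq n y + frob_sq n z)"
      by (simp add: frob_sq_def sum.distrib sum_distrib_left)
    also have "\<dots> \<le> 3 * (2 / real r + 6 / real r + 4 / real r)"
      using S(3) y z by (simp add: x_def)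
    finally have *: "frob_sq n (\<lambda>i j. Z i j - m i j / real r) \<le> 36 / real r" by simp
    have "(\<lambda>i j. \<mu> i j - \<theta> / real r * m i j) = (\<lambda>i j. \<theta> * (Z i j - m i j / real r))"
      by (simp add: Z(2) algebra_simps)
    then have "frob_sq n (\<lambda>i j. \<mu> i j - \<theta> / real r * m i j) = \<theta>\<^sup>2 * frob_sq n (\<lambda>i j. Z i j - m i j / real r)"
      by (simp only: frob_sq_scale)
    also have "\<dots> \<le> \<theta>\<^sup>2 * (36 / real r)" by (intro mult_left_mono *) simp
    finally show ?thesis using m(1) by (auto simp: M_def mult.commute)
  qed
  have ne: "atom_net n q s t \<noteq> {}" for t
  proof (induction t)
    case (Suc t)
    have "sparse_grid n q s \<noteq> {}" using n by (induction s) auto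
    with Suc show ?case by auto
  qed simp
  have "card M \<le> card (atom_net n q s r)" unfolding M_def by (rule card_image_le) simp
  also have "\<dots> \<le> (2 * (n * (2 * (n * r) + 1)) ^ s) ^ r" unfolding q_def by (rule card_atom_net)
  finally show thesis
    by (intro that[OF _ _ _ _ approx]) (use ne atom_net_Sym in \<open>auto simp: M_def Sym_def\<close>)
qed

section \<open>Gaussian noise and the minimax risk\<close>

text \<open>Completing the square turns the tilted density into a multiple of the normal density
  with mean \<open>t * \<sigma>\<^sup>2\<close>.\<close>

lemma normal_mgf:
  assumes "0 < \<sigma>"
  shows "(\<integral>\<^sup>+x. ennreal (exp (t * x)) \<partial>density lborel (normal_density 0 \<sigma>)) = ennreal (exp (t\<^sup>2 * \<sigma>\<^sup>2 / 2))"
proof -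
  have "(\<integral>\<^sup>+x. ennreal (exp (t * x)) \<partial>density lborel (normal_density 0 \<sigma>))
      = (\<integral>\<^sup>+x. ennreal (normal_density 0 \<sigma> x) * ennreal (exp (t * x)) \<partial>lborel)"
    by (subst nn_integral_density) auto
  also have "\<dots> = (\<integral>\<^sup>+x. ennreal (exp (t\<^sup>2 * \<sigma>\<^sup>2 / 2)) * ennreal (normal_density (t * \<sigma>\<^sup>2) \<sigma> x) \<partial>lborel)"
  proof (intro nn_integral_cong)
    fix x
    have "- x\<^sup>2 / (2 * \<sigma>\<^sup>2) + t * x = t\<^sup>2 * \<sigma>\<^sup>2 / 2 + - (x - t * \<sigma>\<^sup>2)\<^sup>2 / (2 * \<sigma>\<^sup>2)"
      using assms by (simp add: field_simps power2_eq_square)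
    then have "exp (- x\<^sup>2 / (2 * \<sigma>\<^sup>2)) * exp (t * x)
        = exp (t\<^sup>2 * \<sigma>\<^sup>2 / 2) * exp (- (x - t * \<sigma>\<^sup>2)\<^sup>2 / (2 * \<sigma>\<^sup>2))"
      by (simp only: exp_add [symmetric])
    then have "normal_density 0 \<sigma> x * exp (t * x) = exp (t\<^sup>2 * \<sigma>\<^sup>2 / 2) * normal_density (t * \<sigma>\<^sup>2) \<sigma> x"
      by (simp add: normal_density_def mult_ac)
    then show "ennreal (normal_density 0 \<sigma> x) * ennreal (exp (t * x))
        = ennreal (exp (t\<^sup>2 * \<sigma>\<^sup>2 / 2)) * ennreal (normal_density (t * \<sigma>\<^sup>2) \<sigma> x)"
      by (simp flip: ennreal_mult)
  qed
  also have "\<dots> = ennreal (exp (t\<^sup>2 * \<sigma>\<^sup>2 / 2)) * (\<integral>\<^sup>+x. ennreal (normal_density (t * \<sigma>\<^sup>2) \<sigma> x) \<partial>lborel)"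
    by (rule nn_integral_cmult) auto
  also have "(\<integral>\<^sup>+x. ennreal (normal_density (t * \<sigma>\<^sup>2) \<sigma> x) \<partial>lborel) = 1"
    using prob_space.emeasure_space_1[OF prob_space_normal_density[OF assms, of "t * \<sigma>\<^sup>2"]]
    by (simp add: emeasure_density)
  finally show ?thesis by simp
qed

definition tri :: "nat \<Rightarrow> (nat \<times> nat) set" where
  "tri n = {(i, j). i \<le> j \<and> j < n}"

lemma finite_tri [simp]: "finite (tri n)"
  by (rule finite_subset[of _ "{..<n} \<times> {..<n}"]) (auto simp: tri_def)

text \<open>Translates Frobenius sums, where off-diagonal entries occur twice, into sums over the
  independent coordinates of the noise.\<close>

lemma sum_symmetric_tri:
  fixes h :: "nat \<Rightarrow> nat \<Rightarrow> real"
  assumes "\<And>i j. h i j = h j i"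
  shows "(\<Sum>i<n. \<Sum>j<n. h i j) = (\<Sum>p\<in>tri n. (if fst p = snd p then 1 else 2) * h (fst p) (snd p))"
proof -
  have "(\<Sum>i<n. \<Sum>j<n. h i j) = (\<Sum>j<n. \<Sum>i\<le>j. (if i = j then 1 else 2) * h i j)"
  proof (induction n)
    case (Suc n)
    have "(\<Sum>i<n. h n i) = (\<Sum>i<n. h i n)" by (intro sum.cong refl assms)
    moreover have "(\<Sum>i<n. (if i = n then 1 else 2) * h i n) = 2 * (\<Sum>i<n. h i n)"
      by (simp add: sum_distrib_left)
    ultimately show ?case using Suc by (simp add: sum.distrib lessThan_Suc_atMost[symmetric])
  qed simp
  also have "\<dots> = (\<Sum>p\<in>tri n. (if fst p = snd p then 1 else 2) * h (fst p) (snd p))"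
    by (subst sum.Sigma, simp, simp,
      rule sum.reindex_bij_witness[of _ "\<lambda>(i, j). (j, i)" "\<lambda>(j, i). (i, j)"])
      (auto simp: tri_def)
  finally show ?thesis .
qed

abbreviation gauss_coord :: "nat \<times> nat \<Rightarrow> real measure" where
  "gauss_coord \<equiv> \<lambda>(i, j). density lborel (normal_density 0 (if i = j then sqrt 2 else 1))"

lemma prob_space_gauss_coord: "prob_space (gauss_coord p)"
  by (cases p) (auto intro!: prob_space_normal_density)

lemma sets_gauss_coord [simp, measurable_cong]: "sets (gauss_coord p) = sets borel"
  by (cases p) simp

lemma space_sym_space [simp]: "space (sym_space n) = Sym n"
  by (simp add: sym_space_def space_restrict_space)

lemma measurable_sym_spaceI:
  assumes "\<And>x. x \<in> space N \<Longrightarrow> f x \<in> Sym n" "\<And>i j. (\<lambda>x. f x i j) \<in> borel_measurable N"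
  shows "f \<in> measurable N (sym_space n)"
  unfolding sym_space_def using assms
  by (intro measurable_restrict_space2 measurable_coordinatewise_then_product) auto

lemma measurable_sym_spaceD:
  assumes "f \<in> measurable N (sym_space n)"
  shows "(\<lambda>x. f x i j) \<in> borel_measurable N"
  using measurable_restrict_space2_iff[THEN iffD1, OF assms[unfolded sym_space_def]]
  by (auto intro: measurable_product_then_coordinatewise)

definition sym_of_tri :: "nat \<Rightarrow> (nat \<times> nat \<Rightarrow> real) \<Rightarrow> rmat" where
  "sym_of_tri n g = (\<lambda>i j. if i < n \<and> j < n then g (min i j, max i j) else 0)"

lemma measurable_sym_of_tri [measurable]:
  "sym_of_tri n \<in> measurable (PiM (tri n) gauss_coord) (sym_space n)"
proof (rule measurable_sym_spaceI)
  show "sym_of_tri n g \<in> Sym n" for g by (auto simp: Sym_def sym_of_tri_def min.commute max.commute)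
  show "(\<lambda>g. sym_of_tri n g i j) \<in> borel_measurable (PiM (tri n) gauss_coord)" for i j
  proof (cases "i < n \<and> j < n")
    case True
    then have "(min i j, max i j) \<in> tri n" by (auto simp: tri_def)
    then have "(\<lambda>g. g (min i j, max i j)) \<in> measurable (PiM (tri n) gauss_coord) (gauss_coord (min i j, max i j))"
      by (rule measurable_component_singleton)
    then show ?thesis using True unfolding sym_of_tri_def
      by (simp cong: measurable_cong_sets)
  qed (auto simp: sym_of_tri_def)
qed

lemma noise_eq: "noise n = distr (PiM (tri n) gauss_coord) (sym_space n) (sym_of_tri n)"
  unfolding noise_def tri_def sym_of_tri_def ..

lemma sets_noise [simp, measurable_cong]: "sets (noise n) = sets (sym_space n)"
  by (simp add: noise_eq)

lemma space_noise [simp]: "space (noise n) = Sym n"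
  by (simp add: noise_eq)

lemma prob_space_noise: "prob_space (noise n)"
  unfolding noise_eq
  by (intro prob_space.prob_space_distr prob_space_PiM prob_space_gauss_coord measurable_sym_of_tri)

lemma frob_inner_measurable:
  assumes "f \<in> measurable N (sym_space n)" "g \<in> measurable N (sym_space n)"
  shows "(\<lambda>x. frob_inner n (f x) (g x)) \<in> borel_measurable N"
  unfolding frob_inner_def
  by (intro borel_measurable_sum borel_measurable_times measurable_sym_spaceD[OF assms(1)]
      measurable_sym_spaceD[OF assms(2)])

text \<open>The noise is isotropic: \<open>frob_inner n D W\<close> is centred Gaussian with
  variance \<open>2 * frob_sq n D\<close>, since the double occurrence of off-diagonal entries is
  balanced by the doubled variance on the diagonal. Hence the normalisation is exact.\<close>

lemma noise_exponential_moment: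
  assumes D: "D \<in> Sym n"
  shows "(\<integral>\<^sup>+W. ennreal (exp (t * frob_inner n D W - t\<^sup>2 * frob_sq n D)) \<partial>noise n) = 1"
proof -
  interpret product_sigma_finite gauss_coord
    by (intro product_sigma_finite.intro prob_space_imp_sigma_finite prob_space_gauss_coord)
  define c where "c = (\<lambda>p::nat \<times> nat. if fst p = snd p then 1 else 2::real)"
  define d where "d = (\<lambda>p. D (fst p) (snd p))"
  have sym: "D i j = D j i" for i j using D by (simp add: Sym_def)
  have inner: "frob_inner n D (sym_of_tri n g) = (\<Sum>p\<in>tri n. c p * (d p * g p))" for g
    unfolding frob_inner_def
    by (subst sum_symmetric_tri)
       (auto simp: sym_of_tri_def c_def d_def sym min.commute max.commute tri_def
          min_def max_def intro!: sum.cong)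
  have norm: "frob_sq n D = (\<Sum>p\<in>tri n. c p * (d p)\<^sup>2)"
    unfolding frob_sq_def by (subst sum_symmetric_tri) (auto simp: sym c_def d_def)
  have m: "(\<lambda>W. ennreal (exp (t * frob_inner n D W - t\<^sup>2 * frob_sq n D))) \<in> borel_measurable (sym_space n)"
    by (intro measurable_compose[OF _ measurable_ennreal] borel_measurable_exp
        measurable_compose[OF _ borel_measurable_exp] borel_measurable_diff borel_measurable_times
        frob_inner_measurable measurable_const) (use D in auto)
  have "(\<integral>\<^sup>+W. ennreal (exp (t * frob_inner n D W - t\<^sup>2 * frob_sq n D)) \<partial>noise n)
     = (\<integral>\<^sup>+g. ennreal (exp (t * frob_inner n D (sym_of_tri n g) - t\<^sup>2 * frob_sq n D)) \<partial>PiM (tri n) gauss_coord)"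
    unfolding noise_eq by (rule nn_integral_distr[OF measurable_sym_of_tri]) (simp add: m)
  also have "\<dots> = (\<integral>\<^sup>+g. (\<Prod>p\<in>tri n. ennreal (exp (t * c p * d p * g p - t\<^sup>2 * c p * (d p)\<^sup>2))) \<partial>PiM (tri n) gauss_coord)"
    by (intro nn_integral_cong)
       (simp add: inner norm prod_ennreal exp_sum[symmetric] sum_subtractf sum_distrib_left mult.assoc)
  also have "\<dots> = (\<Prod>p\<in>tri n. \<integral>\<^sup>+x. ennreal (exp (t * c p * d p * x - t\<^sup>2 * c p * (d p)\<^sup>2)) \<partial>gauss_coord p)"
    by (rule product_nn_integral_prod) auto
  also have "\<dots> = (\<Prod>p\<in>tri n. 1)"
  proof (intro prod.cong refl)
    fix p :: "nat \<times> nat"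
    obtain i j where p: "p = (i, j)" by (cases p)
    define \<sigma> :: real where "\<sigma> = (if i = j then sqrt 2 else 1)"
    have s: "0 < \<sigma>" by (simp add: \<sigma>_def)
    have g: "gauss_coord p = density lborel (normal_density 0 \<sigma>)" by (simp add: p \<sigma>_def)
    have "(\<integral>\<^sup>+x. ennreal (exp (t * c p * d p * x - t\<^sup>2 * c p * (d p)\<^sup>2)) \<partial>gauss_coord p)
      = (\<integral>\<^sup>+x. ennreal (exp (- (t\<^sup>2 * c p * (d p)\<^sup>2))) * ennreal (exp (t * c p * d p * x)) \<partial>gauss_coord p)"
      by (intro nn_integral_cong) (simp flip: ennreal_mult exp_add)
    also have "\<dots> = ennreal (exp (- (t\<^sup>2 * c p * (d p)\<^sup>2))) * (\<integral>\<^sup>+x. ennreal (exp (t * c p * d p * x)) \<partial>gauss_coord p)"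
      by (rule nn_integral_cmult) simp
    also have "\<dots> = ennreal (exp (- (t\<^sup>2 * c p * (d p)\<^sup>2))) * ennreal (exp ((t * c p * d p)\<^sup>2 * \<sigma>\<^sup>2 / 2))"
      unfolding g normal_mgf[OF s] ..
    \<comment> \<open>In both cases \<open>c p * \<sigma>\<^sup>2 = 2\<close>, as
      \<open>1 * 2\<close> on the diagonal and \<open>2 * 1\<close> off it, so the exponents
      cancel.\<close>
    also have "\<dots> = 1"
      by (simp add: p c_def \<sigma>_def power_mult_distrib flip: ennreal_mult exp_add)
    finally show "(\<integral>\<^sup>+x. ennreal (exp (t * c p * d p * x - t\<^sup>2 * c p * (d p)\<^sup>2)) \<partial>gauss_coord p) = 1" .
  qed
  finally show ?thesis by simp
qed

section \<open>The nearest net point as an estimator\<close>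

text \<open>A list recursion fixes the choice among ties, and measurability reduces to finitely many
  measurable case distinctions.\<close>

primrec nearest :: "nat \<Rightarrow> rmat \<Rightarrow> rmat list \<Rightarrow> rmat \<Rightarrow> rmat" where
  "nearest n m0 [] Z = m0"
| "nearest n m0 (m # ms) Z =
     (if frob_sq n (\<lambda>i j. m i j - Z i j) \<le> frob_sq n (\<lambda>i j. nearest n m0 ms Z i j - Z i j)
      then m else nearest n m0 ms Z)"

lemma nearest_in: "nearest n m0 ms Z \<in> insert m0 (set ms)"
  by (induction ms) auto

lemma nearest_le:
  "m \<in> insert m0 (set ms) \<Longrightarrow>
     frob_sq n (\<lambda>i j. nearest n m0 ms Z i j - Z i j) \<le> frob_sq n (\<lambda>i j. m i j - Z i j)"
  by (induction ms) (auto intro: order_trans)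

lemma frob_sq_measurable:
  assumes "\<And>i j. (\<lambda>x. f x i j) \<in> borel_measurable N"
  shows "(\<lambda>x. frob_sq n (f x)) \<in> borel_measurable N"
  unfolding frob_sq_def by (intro borel_measurable_sum borel_measurable_power assms)

lemma nearest_measurable:
  assumes "insert m0 (set ms) \<subseteq> Sym n"
  shows "nearest n m0 ms \<in> measurable (sym_space n) (sym_space n)"
  using assms
proof (induction ms)
  case Nil
  then show ?case by simp
next
  case (Cons m ms)
  then have IH: "nearest n m0 ms \<in> measurable (sym_space n) (sym_space n)" by simp
  have id: "(\<lambda>Z. Z i j) \<in> borel_measurable (sym_space n)" for i j
    using measurable_sym_spaceD[of "\<lambda>Z. Z"] by simp
  have "{Z \<in> space (sym_space n). frob_sq n (\<lambda>i j. m i j - Z i j)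
          \<le> frob_sq n (\<lambda>i j. nearest n m0 ms Z i j - Z i j)} \<in> sets (sym_space n)"
    by (intro borel_measurable_le frob_sq_measurable borel_measurable_diff id
        measurable_sym_spaceD[OF IH] measurable_const) auto
  then show ?case unfolding nearest.simps
    using Cons.prems by (intro measurable_If IH) auto
qed

text \<open>The usual basic inequality for a least squares choice, relative to the net point
  \<open>m\<close> close to \<open>\<mu>\<close>. The maximum of the noise over the net is replaced
  by a normalised sum of exponentials, whose mean is known exactly, so no tail probabilities are
  needed.\<close>

lemma nearest_error:
  assumes W: "W \<in> Sym n" and M: "finite M" "f \<in> M" "m \<in> M"
    and f: "frob_sq n (\<lambda>i j. f i j - (\<mu> i j + W i j)) \<le> frob_sq n (\<lambda>i j. m i j - (\<mu> i j + W i j))"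
    and m: "frob_sq n (\<lambda>i j. \<mu> i j - m i j) \<le> E"
  defines "D \<equiv> \<lambda>m'. (\<lambda>i j. m' i j - m i j)"
  shows "frob_sq n (\<lambda>i j. f i j - \<mu> i j) \<le> 18 * E + 64 * ln (card M)
     + 64 / card M * (\<Sum>m'\<in>M. exp (1/8 * frob_inner n (D m') W - (1/8)\<^sup>2 * frob_sq n (D m')))"
proof -
  \<comment> \<open>The factor \<open>1/8\<close> leaves half of the left side:
    \<open>2 * frob_inner n (D f) W\<close> equals \<open>16 * e f + frob_sq n (D f) / 4\<close>,
    and the approximation error costs another quarter. So \<open>frob_sq n (D f)\<close> is at most
    \<open>8 * E + 32 * \<xi>\<close>, and passing from \<open>m\<close> to \<open>\<mu>\<close>
    gives \<open>18\<close> and \<open>64\<close>.\<close>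
  define e where "e = (\<lambda>m'. 1/8 * frob_inner n (D m') W - (1/8)\<^sup>2 * frob_sq n (D m'))"
  define x where "x = (\<lambda>i j. \<mu> i j - m i j)"
  define y where "y = (\<lambda>i j. m i j - (\<mu> i j + W i j))"
  define N where "N = real (card M)"
  have N: "0 < N" using M by (auto simp: N_def card_gt_0_iff)
  define \<xi> where "\<xi> = ln N + (\<Sum>m'\<in>M. exp (e m')) / N"
  have "frob_sq n (\<lambda>i j. D f i j + y i j) \<le> frob_sq n y"
  proof -
    have "(\<lambda>i j. D f i j + y i j) = (\<lambda>i j. f i j - (\<mu> i j + W i j))"
      by (intro ext) (simp add: D_def y_def)
    then show ?thesis using f by (simp add: y_def)
  qed
  then have "frob_sq n (D f) \<le> - 2 * frob_inner n (D f) y" by (simp add: frob_sq_add)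
  also have "frob_inner n (D f) y = - frob_inner n (D f) x - frob_inner n (D f) W"
    unfolding frob_inner_def by (simp add: x_def y_def algebra_simps sum.distrib sum_subtractf sum_negf)
  finally have 1: "frob_sq n (D f) \<le> 2 * frob_inner n (D f) x + 2 * frob_inner n (D f) W" by simp
  have "2 * frob_inner n (\<lambda>i j. 1/2 * D f i j) (\<lambda>i j. 2 * x i j) \<le> (1/2)\<^sup>2 * frob_sq n (D f) + 2\<^sup>2 * frob_sq n x"
    using frob_inner_le[of n "\<lambda>i j. 1/2 * D f i j" "\<lambda>i j. 2 * x i j"] unfolding frob_sq_scale by linarith
  moreover have "frob_inner n (\<lambda>i j. 1/2 * D f i j) (\<lambda>i j. 2 * x i j) = frob_inner n (D f) x"
    by (simp add: frob_inner_def)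
  ultimately have 2: "2 * frob_inner n (D f) x \<le> frob_sq n (D f) / 4 + 4 * E"
    using m by (simp add: x_def power2_eq_square)
  \<comment> \<open>A soft maximum: shift by \<open>ln N\<close>, use that a number is below its
    exponential, and keep only one term of the sum.\<close>
  have 3: "e f \<le> \<xi>"
  proof -
    have "e f - ln N \<le> exp (e f - ln N)" using exp_ge_add_one_self[of "e f - ln N"] by linarith
    also have "\<dots> = exp (e f) / N" using N by (simp add: exp_diff)
    also have "\<dots> \<le> (\<Sum>m'\<in>M. exp (e m')) / N"
      using N M by (intro divide_right_mono member_le_sum) auto
    finally show ?thesis by (simp add: \<xi>_def)
  qed
  have 4: "frob_sq n (D f) \<le> 8 * E + 32 * \<xi>"
    using 1 2 3 unfolding e_def by (simp add: power2_eq_square)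
  have "(\<lambda>i j. f i j - \<mu> i j) = (\<lambda>i j. D f i j - x i j)" by (simp add: D_def x_def)
  then have "frob_sq n (\<lambda>i j. f i j - \<mu> i j) \<le> 2 * frob_sq n (D f) + 2 * frob_sq n x"
    using frob_sq_diff_le[of n "D f" x] by simp
  also have "\<dots> \<le> 2 * (8 * E + 32 * \<xi>) + 2 * E" using 4 m by (simp add: x_def)
  finally show ?thesis by (simp add: \<xi>_def N_def e_def)
qed

text \<open>In expectation each exponential of \<open>nearest_error\<close> contributes
  \<open>1\<close>, so the normalised sum contributes \<open>64\<close> whatever the size of the
  net; only \<open>ln (card M)\<close> remains.\<close>

lemma minimax_risk_le_net:
  assumes M: "finite M" "M \<noteq> {}" "M \<subseteq> Sym n" and E: "0 \<le> E"
    and net: "\<And>\<mu>. \<mu> \<in> \<Theta> \<Longrightarrow> \<exists>m\<in>M. frob_sq n (\<lambda>i j. \<mu> i j - m i j) \<le> E"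
    and \<Theta>: "\<Theta> \<subseteq> Sym n"
  shows "minimax_risk n \<Theta> \<le> ennreal (18 * E + 64 * (ln (card M) + 1))"
proof -
  interpret noise: prob_space "noise n" by (rule prob_space_noise)
  obtain ms where ms: "set ms = M" using M finite_list by blast
  obtain m0 where m0: "m0 \<in> M" using M by blast
  then have ins: "insert m0 (set ms) = M" using ms by auto
  define f where "f = nearest n m0 ms"
  have f: "f \<in> measurable (sym_space n) (sym_space n)"
    unfolding f_def by (rule nearest_measurable) (use ins M in auto)
  have N: "0 < real (card M)" "1 \<le> real (card M)" using M by (auto simp: card_gt_0_iff Suc_le_eq)
  have "(\<integral>\<^sup>+W. ennreal (frob_sq n (\<lambda>i j. f (\<lambda>i j. \<mu> i j + W i j) i j - \<mu> i j)) \<partial>noise n)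
      \<le> ennreal (18 * E + 64 * (ln (card M) + 1))" if \<mu>: "\<mu> \<in> \<Theta>" for \<mu>
  proof -
    obtain m where m: "m \<in> M" "frob_sq n (\<lambda>i j. \<mu> i j - m i j) \<le> E" using net[OF \<mu>] by blast
    define D where "D = (\<lambda>m'::rmat. (\<lambda>i j. m' i j - m i j))"
    define e where "e = (\<lambda>m' W. exp (1/8 * frob_inner n (D m') W - (1/8)\<^sup>2 * frob_sq n (D m')))"
    define K where "K = 18 * E + 64 * ln (card M)"
    have K: "0 \<le> K" using E N by (simp add: K_def)
    have D: "D m' \<in> Sym n" if "m' \<in> M" for m'
      using subsetD[OF M(3) that] subsetD[OF M(3) m(1)] by (auto simp: D_def Sym_def)
    have em: "(\<lambda>W. ennreal (e m' W)) \<in> borel_measurable (noise n)" if "m' \<in> M" for m'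
      unfolding e_def using D[OF that]
      by (intro measurable_compose[OF _ measurable_ennreal] measurable_compose[OF _ borel_measurable_exp]
          borel_measurable_diff borel_measurable_times frob_inner_measurable measurable_const)
         (auto simp: measurable_ident_sets)
    have "(\<integral>\<^sup>+W. ennreal (frob_sq n (\<lambda>i j. f (\<lambda>i j. \<mu> i j + W i j) i j - \<mu> i j)) \<partial>noise n)
      \<le> (\<integral>\<^sup>+W. ennreal K + ennreal (64 / card M) * (\<Sum>m'\<in>M. ennreal (e m' W)) \<partial>noise n)"
    proof (rule nn_integral_mono)
      fix W assume "W \<in> space (noise n)"
      then have W: "W \<in> Sym n" by simp
      have fM: "f (\<lambda>i j. \<mu> i j + W i j) \<in> M" using nearest_in[of n m0 ms] ins by (auto simp: f_def)
      have "frob_sq n (\<lambda>i j. f (\<lambda>i j. \<mu> i j + W i j) i j - \<mu> i j) \<le> K + 64 / card M * (\<Sum>m'\<in>M. e m' W)"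
        unfolding K_def e_def D_def
        by (rule nearest_error[OF W M(1) fM m(1) _ m(2)])
           (use nearest_le[of m m0 ms n] m(1) ins in \<open>auto simp: f_def\<close>)
      then have "ennreal (frob_sq n (\<lambda>i j. f (\<lambda>i j. \<mu> i j + W i j) i j - \<mu> i j))
          \<le> ennreal (K + 64 / card M * (\<Sum>m'\<in>M. e m' W))" by (rule ennreal_leI)
      also have "\<dots> = ennreal K + ennreal (64 / card M) * (\<Sum>m'\<in>M. ennreal (e m' W))"
      proof -
        have "0 \<le> (\<Sum>m'\<in>M. e m' W)" by (simp add: e_def sum_nonneg)
        moreover have "(\<Sum>m'\<in>M. ennreal (e m' W)) = ennreal (\<Sum>m'\<in>M. e m' W)"
          by (simp add: e_def sum_ennreal)
        ultimately show ?thesis using K N by (simp only: ennreal_plus ennreal_mult mult_nonneg_nonneg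
              divide_nonneg_nonneg zero_le_numeral of_nat_0_le_iff)
      qed
      finally show "ennreal (frob_sq n (\<lambda>i j. f (\<lambda>i j. \<mu> i j + W i j) i j - \<mu> i j))
          \<le> ennreal K + ennreal (64 / card M) * (\<Sum>m'\<in>M. ennreal (e m' W))" .
    qed
    also have "\<dots> = ennreal K + ennreal (64 / card M) * (\<Sum>m'\<in>M. \<integral>\<^sup>+W. ennreal (e m' W) \<partial>noise n)"
      using em by (simp add: nn_integral_add nn_integral_cmult nn_integral_sum
          noise.emeasure_space_1[unfolded space_noise])
    also have "(\<Sum>m'\<in>M. \<integral>\<^sup>+W. ennreal (e m' W) \<partial>noise n) = (\<Sum>m'\<in>M. 1)"
      unfolding e_def by (intro sum.cong refl noise_exponential_moment D)
    also have "ennreal K + ennreal (64 / card M) * (\<Sum>m'\<in>M. 1) = ennreal (K + 64)"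
    proof -
      have "ennreal (64 / card M) * (\<Sum>m'\<in>M. 1) = ennreal (64 / card M) * ennreal (card M)"
        by (simp add: ennreal_of_nat_eq_real_of_nat)
      also have "\<dots> = ennreal 64" using N by (subst ennreal_mult[symmetric]) auto
      finally show ?thesis using K by simp
    qed
    finally show ?thesis by (simp add: K_def algebra_simps)
  qed
  then have "(SUP \<mu>\<in>\<Theta>. \<integral>\<^sup>+W. ennreal (frob_sq n (\<lambda>i j. f (\<lambda>i j. \<mu> i j + W i j) i j - \<mu> i j)) \<partial>noise n)
      \<le> ennreal (18 * E + 64 * (ln (card M) + 1))"
    by (rule SUP_least)
  then show ?thesis unfolding minimax_risk_def by (rule INF_lower2[OF f])
qed

text \<open>Here \<open>648 = 18 * 36\<close> combines the constants of the oracle inequality and of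
  the net; the factor \<open>2\<close> for the sign of an atom enters the logarithm as
  \<open>ln 2\<close>, bounded by \<open>1\<close>.\<close>

lemma minimax_risk_body:
  assumes kp: "0 < kp" and n: "0 < n" and r: "0 < r" and s: "real r * kp \<le> real s"
  shows "minimax_risk n (scale \<theta> (body n km kp))
     \<le> ennreal (648 * \<theta>\<^sup>2 / r + 64 * (real r * (1 + real s * ln (n * (2 * (n * r) + 1))) + 1))"
proof -
  obtain M where M: "finite M" "M \<noteq> {}" "M \<subseteq> Sym n"
    "card M \<le> (2 * (n * (2 * (n * r) + 1)) ^ s) ^ r"
    "\<And>\<mu>. \<mu> \<in> scale \<theta> (body n km kp) \<Longrightarrow> \<exists>m\<in>M. frob_sq n (\<lambda>i j. \<mu> i j - m i j) \<le> 36 * \<theta>\<^sup>2 / real r"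
    using body_net[OF assms] by blast
  define w where "w = n * (2 * (n * r) + 1)"
  have w: "0 < w" using n by (simp add: w_def)
  have pos: "0 < card M" using M by (simp add: card_gt_0_iff)
  have "ln (real (card M)) \<le> ln (real ((2 * w ^ s) ^ r))"
    using M(4) pos w by (intro ln_mono) (auto simp: w_def simp del: of_nat_power of_nat_mult)
  also have "\<dots> = real r * (ln 2 + real s * ln w)"
  proof -
    have "real ((2 * w ^ s) ^ r) = (2 * real w ^ s) ^ r" by simp
    then show ?thesis using w by (simp add: ln_realpow ln_mult distrib_left)
  qed
  also have "\<dots> \<le> real r * (1 + real s * ln w)"
    using ln_2_less_1 by (intro mult_left_mono) auto
  finally have le: "ln (real (card M)) \<le> real r * (1 + real s * ln w)" .
  have "minimax_risk n (scale \<theta> (body n km kp)) \<le> ennreal (18 * (36 * \<theta>\<^sup>2 / real r) + 64 * (ln (card M) + 1))"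
  proof (rule minimax_risk_le_net[OF M(1-3) _ M(5)])
    show "scale \<theta> (body n km kp) \<subseteq> Sym n"
    proof
      fix X assume "X \<in> scale \<theta> (body n km kp)"
      then obtain Z where Z: "Z \<in> body n km kp" "X = (\<lambda>i j. \<theta> * Z i j)" unfolding scale_def by blast
      obtain F c where F: "finite F" "F \<subseteq> body_plus n km kp \<union> scale (-1) (body_plus n km kp)"
        "\<And>X. X \<in> F \<Longrightarrow> 0 \<le> c X" "sum c F = 1" "Z = (\<lambda>i j. \<Sum>X\<in>F. c X * X i j)"
        by (rule bodyE[OF Z(1)]) blast
      have "F \<subseteq> Sym n"
        using F(2) by (fastforce simp: body_plus_def cone_def scale_def Sym_def)
      then show "X \<in> Sym n" unfolding Z(2) F(5) Sym_def
        by (auto intro!: arg_cong[of _ _ "\<lambda>x. \<theta> * x"] sum.cong sum.neutral)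
    qed
  qed auto
  also have "\<dots> \<le> ennreal (648 * \<theta>\<^sup>2 / r + 64 * (real r * (1 + real s * ln w) + 1))"
    using le by (intro ennreal_leI) simp
  finally show ?thesis by (simp add: w_def algebra_simps)
qed

section \<open>Programs\<close>

primrec nexp_bound :: "nexp \<Rightarrow> nat" where
  "nexp_bound (NConst m) = 0"
| "nexp_bound (NReg x) = Suc x"
| "nexp_bound (NAdd e e') = max (nexp_bound e) (nexp_bound e')"
| "nexp_bound (NSub e e') = max (nexp_bound e) (nexp_bound e')"

primrec rexp_bound :: "rexp \<Rightarrow> nat" where
  "rexp_bound (RNat e) = nexp_bound e"
| "rexp_bound (Cell r e e') = max (Suc r) (max (nexp_bound e) (nexp_bound e'))"
| "rexp_bound (Random e) = nexp_bound e"
| "rexp_bound (RAdd x y) = max (rexp_bound x) (rexp_bound y)"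
| "rexp_bound (RSub x y) = max (rexp_bound x) (rexp_bound y)"
| "rexp_bound (RMul x y) = max (rexp_bound x) (rexp_bound y)"
| "rexp_bound (RDiv x y) = max (rexp_bound x) (rexp_bound y)"
| "rexp_bound (RSqrt x) = rexp_bound x"

primrec bexp_bound :: "bexp \<Rightarrow> nat" where
  "bexp_bound (NLess e e') = max (nexp_bound e) (nexp_bound e')"
| "bexp_bound (RLess x y) = max (rexp_bound x) (rexp_bound y)"
| "bexp_bound (BNot p) = bexp_bound p"
| "bexp_bound (BAnd p q) = max (bexp_bound p) (bexp_bound q)"

primrec com_bound :: "com \<Rightarrow> nat" where
  "com_bound (NAssign x e) = max (Suc x) (nexp_bound e)"
| "com_bound (RAssign r e e' x) = max (Suc r) (max (rexp_bound x) (max (nexp_bound e) (nexp_bound e')))"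
| "com_bound (Clear r) = Suc r"
| "com_bound (Seq c c') = max (com_bound c) (com_bound c')"
| "com_bound (Cond p c c') = max (bexp_bound p) (max (com_bound c) (com_bound c'))"
| "com_bound (Loop p c) = max (bexp_bound p) (com_bound c)"

definition agree :: "nat \<Rightarrow> state \<Rightarrow> state \<Rightarrow> bool" where
  "agree M s s' \<longleftrightarrow> (\<forall>x<M. fst s x = fst s' x \<and> snd s x = snd s' x)"

definition same_above :: "nat \<Rightarrow> state \<Rightarrow> state \<Rightarrow> bool" where
  "same_above M s s' \<longleftrightarrow> (\<forall>x\<ge>M. fst s x = fst s' x \<and> snd s x = snd s' x)"

lemma nval_agree: "nexp_bound e \<le> M \<Longrightarrow> agree M s s' \<Longrightarrow> nval s' e = nval s e"
  by (induction e) (auto simp: agree_def)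

lemma rval_agree: "rexp_bound x \<le> M \<Longrightarrow> agree M s s' \<Longrightarrow> rval \<omega> s' x = rval \<omega> s x"
  by (induction x) (auto simp: nval_agree, auto simp: agree_def)

lemma bval_agree: "bexp_bound p \<le> M \<Longrightarrow> agree M s s' \<Longrightarrow> bval \<omega> s' p = bval \<omega> s p"
  by (induction p) (auto simp: nval_agree rval_agree)

text \<open>Registers and arrays are named by numerals in the program text, and computed indices
  only select cells within an array. A program therefore neither reads nor writes at or above its
  bound, and it takes the same number of steps when embedded in a larger one.\<close>

lemma exec_frame:
  assumes "exec \<omega> c s t s1" "com_bound c \<le> M" "agree M s s'"
  shows "\<exists>s1'. exec \<omega> c s' t s1' \<and> agree M s1 s1' \<and> same_above M s' s1'"
  using assms
proof (induction arbitrary: s' rule: exec.induct)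
  case (NAssign x e s)
  then have "nval s' e = nval s e" by (intro nval_agree[of e M]) auto
  with NAssign exec.NAssign[of \<omega> x e s'] show ?case by (fastforce simp: agree_def same_above_def)
next
  case (RAssign r e e' x s)
  then have "nval s' e = nval s e" "nval s' e' = nval s e'" "rval \<omega> s' x = rval \<omega> s x"
    by (auto intro: nval_agree[of _ M] rval_agree[of _ M])
  with RAssign exec.RAssign[of \<omega> r e e' x s'] show ?case by (fastforce simp: agree_def same_above_def)
next
  case (Clear r s)
  with exec.Clear[of \<omega> r s'] show ?case by (fastforce simp: agree_def same_above_def)
next
  case (Seq c s t s1 c' t' s2)
  obtain s1' where 1: "exec \<omega> c s' t s1'" "agree M s1 s1'" "same_above M s' s1'"
    using Seq.IH(1)[of s'] Seq.prems by auto
  obtain s2' where 2: "exec \<omega> c' s1' t' s2'" "agree M s2 s2'" "same_above M s1' s2'"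
    using Seq.IH(2)[of s1'] Seq.prems 1 by auto
  have "same_above M s' s2'" using 1 2 by (simp add: same_above_def)
  with exec.Seq[OF 1(1) 2(1)] 2(2) show ?case by blast
next
  case (CondTrue s p c t s1 c')
  obtain s1' where 1: "exec \<omega> c s' t s1'" "agree M s1 s1'" "same_above M s' s1'"
    using CondTrue.IH[of s'] CondTrue.prems by auto
  have "bval \<omega> s' p" using CondTrue.hyps CondTrue.prems bval_agree[of p M s s'] by simp
  from exec.CondTrue[OF this 1(1)] 1 show ?case by blast
next
  case (CondFalse s p c' t s1 c)
  obtain s1' where 1: "exec \<omega> c' s' t s1'" "agree M s1 s1'" "same_above M s' s1'"
    using CondFalse.IH[of s'] CondFalse.prems by auto
  have "\<not> bval \<omega> s' p" using CondFalse.hyps CondFalse.prems bval_agree[of p M s s'] by simp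
  from exec.CondFalse[OF this 1(1)] 1 show ?case by blast
next
  case (LoopFalse s p c)
  have "\<not> bval \<omega> s' p" using LoopFalse.hyps LoopFalse.prems bval_agree[of p M s s'] by simp
  from exec.LoopFalse[OF this] LoopFalse.prems(2) show ?case
    by (intro exI[of _ s']) (simp add: same_above_def)
next
  case (LoopTrue s p c t s1 t' s2)
  obtain s1' where 1: "exec \<omega> c s' t s1'" "agree M s1 s1'" "same_above M s' s1'"
    using LoopTrue.IH(1)[of s'] LoopTrue.prems by auto
  obtain s2' where 2: "exec \<omega> (Loop p c) s1' t' s2'" "agree M s2 s2'" "same_above M s1' s2'"
    using LoopTrue.IH(2)[of s1'] LoopTrue.prems 1 by auto
  have "bval \<omega> s' p" using LoopTrue.hyps LoopTrue.prems bval_agree[of p M s s'] by simp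
  note ex = exec.LoopTrue[OF this 1(1) 2(1)]
  have "same_above M s' s2'" using 1 2 by (simp add: same_above_def)
  with ex 2(2) show ?case by blast
qed

section \<open>Time-bounded program logic\<close>

text \<open>A total correctness judgement with a time budget. Its nesting in \<open>runs_Seq\<close>
  lets postconditions be computed backwards, as with weakest preconditions.\<close>

definition runs :: "seed \<Rightarrow> com \<Rightarrow> state \<Rightarrow> nat \<Rightarrow> (state \<Rightarrow> bool) \<Rightarrow> bool" where
  "runs \<omega> c s T Q \<longleftrightarrow> (\<exists>t s'. exec \<omega> c s t s' \<and> t \<le> T \<and> Q s')"

lemma runs_weaken:
  "runs \<omega> c s T Q \<Longrightarrow> T \<le> T' \<Longrightarrow> (\<And>s'. Q s' \<Longrightarrow> Q' s') \<Longrightarrow> runs \<omega> c s T' Q'"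
  unfolding runs_def by (meson order_trans)

lemma runs_NAssign: "Q ((fst s)(x := nval s e), snd s) \<Longrightarrow> runs \<omega> (NAssign x e) s 1 Q"
  unfolding runs_def using exec.NAssign by blast

lemma runs_RAssign:
  "Q (fst s, (snd s)(r := (snd s r)(nval s e := (snd s r (nval s e))(nval s e' := rval \<omega> s x))))
     \<Longrightarrow> runs \<omega> (RAssign r e e' x) s 1 Q"
  unfolding runs_def using exec.RAssign by blast

lemma runs_Clear: "Q (fst s, (snd s)(r := (\<lambda>_ _. 0))) \<Longrightarrow> runs \<omega> (Clear r) s 1 Q"
  unfolding runs_def using exec.Clear by blast

lemma runs_Seq:
  "runs \<omega> c s T (\<lambda>s'. runs \<omega> c' s' T' Q) \<Longrightarrow> runs \<omega> (Seq c c') s (T + T') Q"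
proof -
  assume "runs \<omega> c s T (\<lambda>s'. runs \<omega> c' s' T' Q)"
  then obtain t s1 t' s2 where "exec \<omega> c s t s1" "t \<le> T" "exec \<omega> c' s1 t' s2" "t' \<le> T'" "Q s2"
    unfolding runs_def by blast
  then show ?thesis unfolding runs_def
    by (intro exI[of _ "t + t'"] exI[of _ s2]) (auto intro: exec.Seq)
qed

lemma runs_Cond:
  assumes "bval \<omega> s p \<Longrightarrow> runs \<omega> c s T Q" "\<not> bval \<omega> s p \<Longrightarrow> runs \<omega> c' s T Q"
  shows "runs \<omega> (Cond p c c') s (T + 1) Q"
proof -
  obtain t s' where "if bval \<omega> s p then exec \<omega> c s t s' else exec \<omega> c' s t s'" "t \<le> T" "Q s'"
    using assms unfolding runs_def by (cases "bval \<omega> s p") auto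
  then show ?thesis unfolding runs_def
    using exec.CondTrue[of \<omega> s p c t s' c'] exec.CondFalse[of \<omega> s p c' t s' c]
    by (intro exI[of _ "t + 1"] exI[of _ s']) (auto split: if_splits)
qed

definition For :: "nat \<Rightarrow> nat \<Rightarrow> com \<Rightarrow> com" where
  "For x m c = Seq (NAssign x (NConst 0))
     (Loop (NLess (NReg x) (NReg m)) (Seq c (NAssign x (NAdd (NReg x) (NConst 1)))))"

lemma seedless_For [simp]: "seedless (For x m c) \<longleftrightarrow> seedless c"
  by (simp add: For_def)

text \<open>Each round pays for the body, the increment and the test; the final \<open>2\<close> are
  the initialisation and the failing test. The invariant is required after the increment of the
  counter, because it speaks of the whole state.\<close>

lemma runs_For:
  assumes m: "fst s m = n" "x \<noteq> m"
    and I0: "I 0 ((fst s)(x := 0), snd s)"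
    and step: "\<And>i s. i < n \<Longrightarrow> I i s \<Longrightarrow> fst s x = i \<Longrightarrow> fst s m = n \<Longrightarrow>
        runs \<omega> c s T (\<lambda>s'. fst s' x = i \<and> fst s' m = n \<and> I (Suc i) ((fst s')(x := Suc i), snd s'))"
  shows "runs \<omega> (For x m c) s (n * (T + 2) + 2) (\<lambda>s'. I n s' \<and> fst s' m = n)"
proof -
  let ?body = "Seq c (NAssign x (NAdd (NReg x) (NConst 1)))"
  \<comment> \<open>Induction on the number \<open>k\<close> of rounds still to come, since the
    counter runs upwards.\<close>
  have "\<exists>t s'. exec \<omega> (Loop (NLess (NReg x) (NReg m)) ?body) s t s' \<and> t \<le> k * (T + 2) + 1 \<and> I n s' \<and> fst s' m = n"
    if "k \<le> n" "I (n - k) s" "fst s x = n - k" "fst s m = n" for k s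
    using that
  proof (induction k arbitrary: s)
    case 0
    then have "exec \<omega> (Loop (NLess (NReg x) (NReg m)) ?body) s 1 s"
      by (intro exec.LoopFalse) simp
    with 0 show ?case by (intro exI[of _ 1] exI[of _ s]) simp
  next
    case (Suc k)
    define i where "i = n - Suc k"
    have i: "i < n" "Suc i = n - k" using Suc.prems(1) by (auto simp: i_def)
    obtain t s1 where 1: "exec \<omega> c s t s1" "t \<le> T" "fst s1 x = i" "fst s1 m = n"
      "I (Suc i) ((fst s1)(x := Suc i), snd s1)"
      using step[OF i(1), of s] Suc.prems unfolding runs_def i_def by blast
    define s2 where "s2 = ((fst s1)(x := Suc i), snd s1)"
    have "exec \<omega> (NAssign x (NAdd (NReg x) (NConst 1))) s1 1 s2"
      using exec.NAssign[of \<omega> x "NAdd (NReg x) (NConst 1)" s1] 1 by (simp add: s2_def)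
    from exec.Seq[OF 1(1) this] have b: "exec \<omega> ?body s (t + 1) s2" .
    obtain t' s' where 2: "exec \<omega> (Loop (NLess (NReg x) (NReg m)) ?body) s2 t' s'"
      "t' \<le> k * (T + 2) + 1" "I n s'" "fst s' m = n"
      using Suc.IH[of s2] Suc.prems(1) 1 m(2) i(2) by (auto simp: s2_def)
    have "exec \<omega> (Loop (NLess (NReg x) (NReg m)) ?body) s (t + 1 + t' + 1) s'"
      by (rule exec.LoopTrue[OF _ b 2(1)]) (use Suc.prems i in \<open>simp add: i_def\<close>)
    moreover have "t + 1 + t' + 1 \<le> Suc k * (T + 2) + 1" using 1(2) 2(2) by simp
    ultimately show ?case using 2 by blast
  qed
  from this[of n "((fst s)(x := 0), snd s)"] I0 m
  obtain t s' where l: "exec \<omega> (Loop (NLess (NReg x) (NReg m)) ?body) ((fst s)(x := 0), snd s) t s'"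
    "t \<le> n * (T + 2) + 1" "I n s'" "fst s' m = n" by auto
  have "exec \<omega> (NAssign x (NConst 0)) s 1 ((fst s)(x := 0), snd s)"
    using exec.NAssign[of \<omega> x "NConst 0" s] by simp
  from exec.Seq[OF this l(1)] have "exec \<omega> (For x m c) s (1 + t) s'" by (simp add: For_def)
  then show ?thesis using l unfolding runs_def by (intro exI[of _ "1 + t"] exI[of _ s']) simp
qed

lemma runs_frame:
  assumes ex: "exec \<omega> c s0 t s1" and t: "t \<le> T" and c: "com_bound c \<le> M" and a: "agree M s0 s"
    and Q: "\<And>s'. agree M s1 s' \<Longrightarrow> same_above M s s' \<Longrightarrow> Q s'"
  shows "runs \<omega> c s T Q"
  using exec_frame[OF ex c a] t Q unfolding runs_def by blast

lemma poly_time_bound: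
  assumes "0 < (n::nat)" "t \<le> A + B * n + C * n\<^sup>2 + D * n ^ d + E * n ^ Suc d"
  shows "t \<le> (A + B + C + D + E) * n ^ (d + 2)"
proof -
  have p: "n ^ i \<le> n ^ (d + 2)" if "i \<le> d + 2" for i
    using that assms(1) by (intro power_increasing) auto
  have "A * 1 + B * n + C * n\<^sup>2 + D * n ^ d + E * n ^ Suc d
      \<le> A * n ^ (d + 2) + B * n ^ (d + 2) + C * n ^ (d + 2) + D * n ^ (d + 2) + E * n ^ (d + 2)"
    using p[of 0] p[of 1] p[of 2] p[of d] p[of "Suc d"]
    by (intro add_mono mult_le_mono order_refl) (simp_all del: power_Suc)
  then show ?thesis using assms(2) by (simp only: distrib_right mult_1_right)
qed

section \<open>The rounding program\<close>

text \<open>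
  The first condition caps the number of ones by \<open>16k\<close> for every \<open>U\<close>: when the size of the planted
  set is atypical, \<open>\<lambda>vv\<^sup>T\<close> may lie outside \<open>\<theta>K\<close> and nothing is known about \<open>U\<close>.
\<close>

definition thresh :: "nat \<Rightarrow> real \<Rightarrow> real \<Rightarrow> rmat \<Rightarrow> nat \<Rightarrow> real" where
  "thresh n snr \<rho> U i =
     (if i < n \<and> frob_sq n U \<le> 4 * (snr * snr) * ((\<rho> * real n) * (\<rho> * real n))
         \<and> snr * snr * (\<rho> * real n) / 4 \<le> (\<Sum>j<n. (U i j)\<^sup>2)
      then 1 else 0)"

text \<open>
  The programs below wrap a program whose registers and arrays have numbers less than \<open>M\<close>. Register
  \<open>M\<close> keeps \<open>n\<close>, registers from \<open>M + 1\<close> on are loop counters and indices; array \<open>M\<close> keeps the data,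
  array \<open>M + 1\<close> the parameters, and array \<open>M + 2\<close> accumulates sums.
\<close>

definition square_cell :: "nat \<Rightarrow> rexp" where
  "square_cell M = RMul (Cell 0 (NReg (M + 1)) (NReg (M + 2))) (Cell 0 (NReg (M + 1)) (NReg (M + 2)))"

text \<open>Row sums go to column \<open>0\<close> of array \<open>M + 2\<close> and their total to
  cell \<open>(0, 1)\<close>, so they do not collide. The array is still zero at this point, because
  the wrapped program cannot reach it.\<close>

definition row_norms_prog :: "nat \<Rightarrow> com" where
  "row_norms_prog M = For (M + 1) M (For (M + 2) M
     (Seq (RAssign (M + 2) (NReg (M + 1)) (NConst 0)
            (RAdd (Cell (M + 2) (NReg (M + 1)) (NConst 0)) (square_cell M)))
          (RAssign (M + 2) (NConst 0) (NConst 1)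
            (RAdd (Cell (M + 2) (NConst 0) (NConst 1)) (square_cell M)))))"

definition snr_square :: "nat \<Rightarrow> rexp" where
  "snr_square M = RMul (Cell (M + 1) (NConst 0) (NConst 0)) (Cell (M + 1) (NConst 0) (NConst 0))"

definition size_exp :: "nat \<Rightarrow> rexp" where
  "size_exp M = RMul (Cell (M + 1) (NConst 0) (NConst 1)) (RNat (NReg M))"

text \<open>Non-strict inequalities are negated strict ones. All comparisons read arrays
  \<open>M + 1\<close> and \<open>M + 2\<close> only, so writing the answers over the estimate in
  array \<open>0\<close> is harmless.\<close>

definition threshold_prog :: "nat \<Rightarrow> com" where
  "threshold_prog M = For (M + 1) M
     (Cond (BAnd
        (BNot (RLess (RMul (RMul (RNat (NConst 4)) (snr_square M)) (RMul (size_exp M) (size_exp M)))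
                     (Cell (M + 2) (NConst 0) (NConst 1))))
        (BNot (RLess (Cell (M + 2) (NReg (M + 1)) (NConst 0))
                     (RDiv (RMul (snr_square M) (size_exp M)) (RNat (NConst 4))))))
        (RAssign 0 (NReg (M + 1)) (NConst 0) (RNat (NConst 1)))
        (RAssign 0 (NReg (M + 1)) (NConst 0) (RNat (NConst 0))))"

text \<open>The wrapped program may overwrite its inputs, including register \<open>0\<close>, so
  \<open>n\<close> and the parameters are copied out of its reach.\<close>

definition save_params :: "nat \<Rightarrow> com" where
  "save_params M = Seq (NAssign M (NReg 0))
     (Seq (RAssign (M + 1) (NConst 0) (NConst 0) (Cell 1 (NConst 0) (NConst 0)))
          (RAssign (M + 1) (NConst 0) (NConst 1) (Cell 1 (NConst 0) (NConst 1))))"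

definition round_prog :: "nat \<Rightarrow> com \<Rightarrow> com" where
  "round_prog M c = Seq (save_params M) (Seq c (Seq (row_norms_prog M) (threshold_prog M)))"

lemma runs_save_params:
  assumes "2 \<le> M"
  shows "runs \<omega> (save_params M) (init n snr \<rho> Y) 3
    (\<lambda>s. agree M (init n snr \<rho> Y) s \<and> fst s M = n \<and> snd s M = (\<lambda>_ _. 0)
       \<and> snd s (M + 1) 0 0 = snr \<and> snd s (M + 1) 0 1 = \<rho> \<and> snd s (M + 2) = (\<lambda>_ _. 0))"
proof -
  have "runs \<omega> (save_params M) (init n snr \<rho> Y) (1 + (1 + 1))
    (\<lambda>s. agree M (init n snr \<rho> Y) s \<and> fst s M = n \<and> snd s M = (\<lambda>_ _. 0)
       \<and> snd s (M + 1) 0 0 = snr \<and> snd s (M + 1) 0 1 = \<rho> \<and> snd s (M + 2) = (\<lambda>_ _. 0))"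
    unfolding save_params_def
    apply (rule runs_Seq, rule runs_NAssign)
    apply (rule runs_Seq, rule runs_RAssign)
    apply (rule runs_RAssign)
    using assms by (auto simp: init_def agree_def)
  then show ?thesis by (rule runs_weaken) auto
qed

lemma runs_row_norms:
  assumes s: "fst s M = n" "snd s (M + 2) = (\<lambda>_ _. 0)" and M: "2 \<le> M"
  shows "runs \<omega> (row_norms_prog M) s (n * (n * 4 + 4) + 2)
    (\<lambda>s'. fst s' M = n \<and> snd s' 0 = snd s 0 \<and> snd s' (M + 1) = snd s (M + 1)
       \<and> (\<forall>i<n. snd s' (M + 2) i 0 = (\<Sum>j<n. (snd s 0 i j)\<^sup>2))
       \<and> snd s' (M + 2) 0 1 = frob_sq n (snd s 0))"
proof -
  define a where "a = snd s 0"
  define g where "g = snd s (M + 1)"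
  define I where "I = (\<lambda>(i::nat) (s'::state). snd s' 0 = a \<and> snd s' (M + 1) = g
    \<and> (\<forall>p. snd s' (M + 2) p 0 = (if p < i then (\<Sum>j<n. (a p j)\<^sup>2) else 0))
    \<and> snd s' (M + 2) 0 1 = (\<Sum>p<i. \<Sum>j<n. (a p j)\<^sup>2))"
  have inner: "runs \<omega> (For (M + 2) M
     (Seq (RAssign (M + 2) (NReg (M + 1)) (NConst 0)
            (RAdd (Cell (M + 2) (NReg (M + 1)) (NConst 0)) (square_cell M)))
          (RAssign (M + 2) (NConst 0) (NConst 1)
            (RAdd (Cell (M + 2) (NConst 0) (NConst 1)) (square_cell M))))) s1 (n * (2 + 2) + 2)
     (\<lambda>s'. fst s' (M + 1) = i \<and> fst s' M = n \<and> I (Suc i) ((fst s')(M + 1 := Suc i), snd s'))"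
    if i: "i < n" "I i s1" "fst s1 (M + 1) = i" "fst s1 M = n" for i s1
  proof -
    define J where "J = (\<lambda>(j::nat) (s'::state). fst s' (M + 1) = i \<and> snd s' 0 = a \<and> snd s' (M + 1) = g
      \<and> (\<forall>p. snd s' (M + 2) p 0 = (if p < i then (\<Sum>j<n. (a p j)\<^sup>2) else if p = i then (\<Sum>q<j. (a i q)\<^sup>2) else 0))
      \<and> snd s' (M + 2) 0 1 = (\<Sum>p<i. \<Sum>j<n. (a p j)\<^sup>2) + (\<Sum>q<j. (a i q)\<^sup>2))"
    show ?thesis
    proof (rule runs_weaken[OF runs_For[where I = J]])
      show "fst s1 M = n" by fact
      show "M + 2 \<noteq> M" by simp
      show "J 0 ((fst s1)(M + 2 := 0), snd s1)"
        using i by (auto simp: J_def I_def)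
      show "runs \<omega> (Seq (RAssign (M + 2) (NReg (M + 1)) (NConst 0)
            (RAdd (Cell (M + 2) (NReg (M + 1)) (NConst 0)) (square_cell M)))
          (RAssign (M + 2) (NConst 0) (NConst 1)
            (RAdd (Cell (M + 2) (NConst 0) (NConst 1)) (square_cell M)))) s2 (1 + 1)
        (\<lambda>s'. fst s' (M + 2) = j \<and> fst s' M = n \<and> J (Suc j) ((fst s')(M + 2 := Suc j), snd s'))"
        if "j < n" "J j s2" "fst s2 (M + 2) = j" "fst s2 M = n" for j s2
        apply (rule runs_Seq, rule runs_RAssign, rule runs_RAssign)
        using that by (auto simp: J_def square_cell_def power2_eq_square)
      show "fst s' (M + 1) = i \<and> fst s' M = n \<and> I (Suc i) ((fst s')(M + 1 := Suc i), snd s')"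
        if "J n s' \<and> fst s' M = n" for s'
        using that by (auto simp: J_def I_def less_Suc_eq)
    qed simp
  qed
  show ?thesis unfolding row_norms_prog_def
  proof (rule runs_weaken[OF runs_For[where I = I, OF _ _ _ inner]])
    show "fst s M = n" by fact
    show "I 0 ((fst s)(M + 1 := 0), snd s)" using s by (simp add: I_def a_def g_def)
    show "fst s' M = n \<and> snd s' 0 = snd s 0 \<and> snd s' (M + 1) = snd s (M + 1)
       \<and> (\<forall>i<n. snd s' (M + 2) i 0 = (\<Sum>j<n. (snd s 0 i j)\<^sup>2))
       \<and> snd s' (M + 2) 0 1 = frob_sq n (snd s 0)" if "I n s' \<and> fst s' M = n" for s'
      using that by (simp add: I_def a_def g_def frob_sq_def)
  qed (simp_all add: algebra_simps)
qed

lemma runs_threshold: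
  assumes s: "fst s M = n" "snd s (M + 1) 0 0 = snr" "snd s (M + 1) 0 1 = \<rho>"
    "\<And>i. i < n \<Longrightarrow> snd s (M + 2) i 0 = (\<Sum>j<n. (U i j)\<^sup>2)" "snd s (M + 2) 0 1 = frob_sq n U"
    and M: "2 \<le> M"
  shows "runs \<omega> (threshold_prog M) s (n * 4 + 2) (\<lambda>s'. \<forall>i<n. snd s' 0 i 0 = thresh n snr \<rho> U i)"
proof -
  define I where "I = (\<lambda>(i::nat) (s'::state). snd s' (M + 1) = snd s (M + 1) \<and> snd s' (M + 2) = snd s (M + 2)
    \<and> (\<forall>p<i. snd s' 0 p 0 = thresh n snr \<rho> U p))"
  show ?thesis unfolding threshold_prog_def
  proof (rule runs_weaken[OF runs_For[where I = I]])
    show "fst s M = n" by fact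
    show "M + 1 \<noteq> M" by simp
    show "I 0 ((fst s)(M + 1 := 0), snd s)" by (simp add: I_def)
    show "runs \<omega> (Cond (BAnd
        (BNot (RLess (RMul (RMul (RNat (NConst 4)) (snr_square M)) (RMul (size_exp M) (size_exp M)))
                     (Cell (M + 2) (NConst 0) (NConst 1))))
        (BNot (RLess (Cell (M + 2) (NReg (M + 1)) (NConst 0))
                     (RDiv (RMul (snr_square M) (size_exp M)) (RNat (NConst 4))))))
        (RAssign 0 (NReg (M + 1)) (NConst 0) (RNat (NConst 1)))
        (RAssign 0 (NReg (M + 1)) (NConst 0) (RNat (NConst 0)))) s1 (1 + 1)
        (\<lambda>s'. fst s' (M + 1) = i \<and> fst s' M = n \<and> I (Suc i) ((fst s')(M + 1 := Suc i), snd s'))"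
      if "i < n" "I i s1" "fst s1 (M + 1) = i" "fst s1 M = n" for i s1
      apply (rule runs_Cond; rule runs_RAssign)
      using that s M by (auto simp: I_def thresh_def snr_square_def size_exp_def less_Suc_eq not_less)
  qed (simp_all add: I_def)
qed

lemma runs_round_prog:
  assumes c: "com_bound c \<le> M" and M: "2 \<le> M"
    and ex: "exec \<omega> c (init n snr \<rho> Y) t s" and t: "t \<le> T"
  shows "runs \<omega> (round_prog M c) (init n snr \<rho> Y) (T + (7 + 8 * n + 4 * n\<^sup>2))
    (\<lambda>s'. vector_out n s' = thresh n snr \<rho> (matrix_out n s))"
proof -
  have eq: "(\<Sum>j<n. (snd s 0 i j)\<^sup>2) = (\<Sum>j<n. (matrix_out n s i j)\<^sup>2)" if "i < n" for i
    using that by (simp add: matrix_out_def)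
  have eq': "frob_sq n (snd s 0) = frob_sq n (matrix_out n s)"
    by (simp add: frob_sq_def eq)
  have "runs \<omega> (round_prog M c) (init n snr \<rho> Y)
      (3 + (T + ((n * (n * 4 + 4) + 2) + (n * 4 + 2))))
    (\<lambda>s'. vector_out n s' = thresh n snr \<rho> (matrix_out n s))"
    unfolding round_prog_def
  proof (rule runs_Seq, rule runs_weaken[OF runs_save_params[OF M] order_refl], rule runs_Seq,
      rule runs_frame[OF ex t c], blast, rule runs_Seq)
    fix s1 s2
    assume s1: "agree M (init n snr \<rho> Y) s1 \<and> fst s1 M = n \<and> snd s1 M = (\<lambda>_ _. 0)
       \<and> snd s1 (M + 1) 0 0 = snr \<and> snd s1 (M + 1) 0 1 = \<rho> \<and> snd s1 (M + 2) = (\<lambda>_ _. 0)"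
      and s2: "agree M s s2" "same_above M s1 s2"
    have a: "snd s2 0 = snd s 0" using s2(1) M by (simp add: agree_def)
    show "runs \<omega> (row_norms_prog M) s2 (n * (n * 4 + 4) + 2)
      (\<lambda>s'. runs \<omega> (threshold_prog M) s' (n * 4 + 2)
          (\<lambda>s'. vector_out n s' = thresh n snr \<rho> (matrix_out n s)))"
    proof (rule runs_weaken[OF runs_row_norms[OF _ _ M] order_refl])
      show "fst s2 M = n" "snd s2 (M + 2) = (\<lambda>_ _. 0)" using s1 s2(2) by (simp_all add: same_above_def)
      fix s3
      assume s3: "fst s3 M = n \<and> snd s3 0 = snd s2 0 \<and> snd s3 (M + 1) = snd s2 (M + 1)
       \<and> (\<forall>i<n. snd s3 (M + 2) i 0 = (\<Sum>j<n. (snd s2 0 i j)\<^sup>2))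
       \<and> snd s3 (M + 2) 0 1 = frob_sq n (snd s2 0)"
      have p: "snd s2 (M + 1) = snd s1 (M + 1)" using s2(2) by (simp add: same_above_def)
      show "runs \<omega> (threshold_prog M) s3 (n * 4 + 2)
          (\<lambda>s'. vector_out n s' = thresh n snr \<rho> (matrix_out n s))"
        by (rule runs_weaken[OF runs_threshold[OF _ _ _ _ _ M, where U = "matrix_out n s" and snr = snr and \<rho> = \<rho>] order_refl])
           (use s1 s3 p a eq eq' in \<open>auto simp: vector_out_def thresh_def\<close>)
    qed
  qed
  then show ?thesis by (rule runs_weaken) (auto simp: power2_eq_square algebra_simps)
qed

lemma poly_time_round:
  assumes "poly_time rnd lm rh matrix_out f"
  shows "poly_time rnd lm rh vector_out (\<lambda>n Y \<omega>. thresh n (lm n) (rh n) (f n Y \<omega>))"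
proof -
  obtain c C d where c: "rnd \<or> seedless c"
    "\<And>n Y \<omega>. 1 \<le> n \<Longrightarrow> Y \<in> Sym n \<Longrightarrow> \<exists>t s. exec \<omega> c (init n (lm n) (rh n) Y) t s \<and> t \<le> C * n ^ d \<and> f n Y \<omega> = matrix_out n s"
    using assms unfolding poly_time_def by blast
  define M where "M = max 2 (com_bound c)"
  have M: "2 \<le> M" "com_bound c \<le> M" by (auto simp: M_def)
  have "\<exists>t s. exec \<omega> (round_prog M c) (init n (lm n) (rh n) Y) t s \<and> t \<le> (7 + 8 + 4 + C + 0) * n ^ (d + 2)
      \<and> thresh n (lm n) (rh n) (f n Y \<omega>) = vector_out n s" if n: "1 \<le> n" "Y \<in> Sym n" for n Y \<omega>
  proof -
    obtain t s where "exec \<omega> c (init n (lm n) (rh n) Y) t s" "t \<le> C * n ^ d" "f n Y \<omega> = matrix_out n s"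
      using c(2)[OF n] by blast
    with runs_round_prog[OF M(2,1)] obtain t' s' where
      "exec \<omega> (round_prog M c) (init n (lm n) (rh n) Y) t' s'" "t' \<le> C * n ^ d + (7 + 8 * n + 4 * n\<^sup>2)"
      "vector_out n s' = thresh n (lm n) (rh n) (f n Y \<omega>)" unfolding runs_def by metis
    moreover from this have "t' \<le> (7 + 8 + 4 + C + 0) * n ^ (d + 2)"
      using n by (intro poly_time_bound) auto
    ultimately show ?thesis by metis
  qed
  moreover have "rnd \<or> seedless (round_prog M c)"
    using c(1) by (auto simp: round_prog_def save_params_def row_norms_prog_def threshold_prog_def
        square_cell_def snr_square_def size_exp_def)
  ultimately show ?thesis unfolding poly_time_def by blast
qed

section \<open>The symmetrisation program\<close>

definition swap0 :: "nat \<Rightarrow> nat \<Rightarrow> nat" where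
  "swap0 j i = (if i = 0 then j else if i = j then 0 else i)"

definition swap_mat :: "nat \<Rightarrow> rmat \<Rightarrow> rmat" where
  "swap_mat j X = (\<lambda>p q. X (swap0 j p) (swap0 j q))"

lemma swap0_less: "j < n \<Longrightarrow> swap0 j i < n \<longleftrightarrow> i < n"
  by (auto simp: swap0_def)

lemma swap0_swap0 [simp]: "swap0 j (swap0 j i) = i"
  by (auto simp: swap0_def)

lemma swap_mat_Sym: "X \<in> Sym n \<Longrightarrow> j < n \<Longrightarrow> swap_mat j X \<in> Sym n"
  using swap0_less[of j n] by (auto simp: Sym_def swap_mat_def not_less[symmetric])

text \<open>The naturals offer only strict comparison: the outer test recognises \<open>0\<close>,
  and equality with register \<open>j\<close> is the failure of both strict comparisons.\<close>

definition swap_reg :: "nat \<Rightarrow> nat \<Rightarrow> nat \<Rightarrow> com" where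
  "swap_reg r p j = Cond (NLess (NConst 0) (NReg p))
     (Cond (BAnd (BNot (NLess (NReg p) (NReg j))) (BNot (NLess (NReg j) (NReg p))))
        (NAssign r (NConst 0)) (NAssign r (NReg p)))
     (NAssign r (NReg j))"

lemma runs_swap_reg:
  assumes "r \<noteq> j" "Q ((fst s)(r := swap0 (fst s j) (fst s p)), snd s)"
  shows "runs \<omega> (swap_reg r p j) s 3 Q"
proof -
  have "runs \<omega> (swap_reg r p j) s ((1 + 1) + 1) Q"
    unfolding swap_reg_def
    apply (rule runs_Cond)
     apply (rule runs_Cond; rule runs_NAssign)
    subgoal using assms by (auto simp: swap0_def)
    subgoal using assms by (auto simp: swap0_def)
    by (rule runs_weaken[OF runs_NAssign[where Q = Q]]) (use assms in \<open>auto simp: swap0_def\<close>)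
  then show ?thesis by (rule runs_weaken) auto
qed

text \<open>There is no skip command; \<open>Clear 0\<close> replaces it because array \<open>0\<close> is to be cleared anyway.\<close>

primrec reset_prog :: "nat \<Rightarrow> com" where
  "reset_prog 0 = Clear 0"
| "reset_prog (Suc m) = Seq (reset_prog m) (Seq (NAssign m (NConst 0)) (Clear m))"

text \<open>The bound is \<open>max 1 m\<close> because the base case clears array \<open>0\<close>
  even when \<open>m = 0\<close>.\<close>

lemma runs_reset_prog:
  assumes "\<And>s'. same_above (max 1 m) s s' \<Longrightarrow>
     (\<forall>x<m. fst s' x = 0 \<and> snd s' x = (\<lambda>_ _. 0)) \<Longrightarrow> Q s'"
  shows "runs \<omega> (reset_prog m) s (2 * m + 1) Q"
  using assms
proof (induction m arbitrary: Q)
  case 0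
  show ?case unfolding reset_prog.simps mult_0_right add_0
    by (rule runs_Clear, rule "0.prems") (auto simp: same_above_def)
next
  case (Suc m)
  have "runs \<omega> (reset_prog (Suc m)) s ((2 * m + 1) + (1 + 1)) Q"
    unfolding reset_prog.simps
    apply (rule runs_Seq, rule Suc.IH, rule runs_Seq, rule runs_NAssign, rule runs_Clear, rule Suc.prems)
    by (auto simp: same_above_def less_Suc_eq)
  then show ?case by (rule runs_weaken) auto
qed

definition save_input :: "nat \<Rightarrow> com" where
  "save_input M = Seq (save_params M) (For (M + 2) M (For (M + 3) M
     (RAssign M (NReg (M + 2)) (NReg (M + 3)) (Cell 0 (NReg (M + 2)) (NReg (M + 3))))))"

text \<open>Earlier calls leave arbitrary values below \<open>M\<close>, while the correctness of
  the given program is known only from its initial state. So everything below \<open>M\<close> is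
  rebuilt, with permuted data. Register \<open>M + 2\<close> is a loop counter here and unrelated to
  the accumulating array \<open>M + 2\<close>.\<close>

definition load_input :: "nat \<Rightarrow> com" where
  "load_input M = Seq (reset_prog M) (Seq (NAssign 0 (NReg M))
     (Seq (RAssign 1 (NConst 0) (NConst 0) (Cell (M + 1) (NConst 0) (NConst 0)))
     (Seq (RAssign 1 (NConst 0) (NConst 1) (Cell (M + 1) (NConst 0) (NConst 1)))
       (For (M + 2) M (For (M + 3) M
         (Seq (swap_reg (M + 4) (M + 2) (M + 1)) (Seq (swap_reg (M + 5) (M + 3) (M + 1))
            (RAssign 0 (NReg (M + 2)) (NReg (M + 3)) (Cell M (NReg (M + 4)) (NReg (M + 5)))))))))))"

text \<open>Register \<open>M + 1\<close> selects both the transposition and the output coordinate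
  to be read: after swapping \<open>0\<close> and \<open>j\<close>, the planted coordinate
  \<open>0\<close> sits at position \<open>j\<close>.\<close>

definition symm_prog :: "nat \<Rightarrow> com \<Rightarrow> com" where
  "symm_prog M c = Seq (save_input M) (Seq (For (M + 1) M (Seq (load_input M) (Seq c
       (RAssign (M + 2) (NConst 0) (NConst 0)
          (RAdd (Cell (M + 2) (NConst 0) (NConst 0)) (Cell 0 (NReg (M + 1)) (NConst 0)))))))
     (RAssign 0 (NConst 0) (NConst 0) (RDiv (Cell (M + 2) (NConst 0) (NConst 0)) (RNat (NReg M)))))"

definition stored :: "nat \<Rightarrow> nat \<Rightarrow> real \<Rightarrow> real \<Rightarrow> rmat \<Rightarrow> state \<Rightarrow> bool" where
  "stored M n snr \<rho> Y s \<longleftrightarrow> fst s M = n \<and> snd s M = Y \<and> snd s (M + 1) 0 0 = snr \<and> snd s (M + 1) 0 1 = \<rho>"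

lemma fill_block:
  fixes X :: rmat
  assumes "\<And>p q. n \<le> p \<or> n \<le> q \<Longrightarrow> X p q = 0"
  shows "(\<lambda>p q. if p < n \<and> q < n then X p q else 0) = X"
  by (intro ext) (auto simp: assms not_less)

lemma runs_save_input:
  assumes M: "2 \<le> M" and Y: "Y \<in> Sym n"
  shows "runs \<omega> (save_input M) (init n snr \<rho> Y) (3 + (n * (n * 3 + 4) + 2))
    (\<lambda>s. stored M n snr \<rho> Y s \<and> snd s (M + 2) = (\<lambda>_ _. 0))"
proof -
  define I where "I = (\<lambda>(i::nat) (s'::state). snd s' 0 = Y \<and> snd s' (M + 1) 0 0 = snr \<and> snd s' (M + 1) 0 1 = \<rho>
     \<and> snd s' (M + 2) = (\<lambda>_ _. 0) \<and> snd s' M = (\<lambda>p q. if p < i \<and> q < n then Y p q else 0))"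
  have inner: "runs \<omega> (For (M + 3) M
     (RAssign M (NReg (M + 2)) (NReg (M + 3)) (Cell 0 (NReg (M + 2)) (NReg (M + 3))))) s1 (n * (1 + 2) + 2)
     (\<lambda>s'. fst s' (M + 2) = i \<and> fst s' M = n \<and> I (Suc i) ((fst s')(M + 2 := Suc i), snd s'))"
    if i: "i < n" "I i s1" "fst s1 (M + 2) = i" "fst s1 M = n" for i s1
  proof -
    define J where "J = (\<lambda>(j::nat) (s'::state). fst s' (M + 2) = i \<and> snd s' 0 = Y
      \<and> snd s' (M + 1) 0 0 = snr \<and> snd s' (M + 1) 0 1 = \<rho> \<and> snd s' (M + 2) = (\<lambda>_ _. 0)
      \<and> snd s' M = (\<lambda>p q. if p < i \<and> q < n \<or> p = i \<and> q < j then Y p q else 0))"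
    show ?thesis
    proof (rule runs_weaken[OF runs_For[where I = J]])
      show "J 0 ((fst s1)(M + 3 := 0), snd s1)" using i by (auto simp: J_def I_def)
      show "runs \<omega> (RAssign M (NReg (M + 2)) (NReg (M + 3)) (Cell 0 (NReg (M + 2)) (NReg (M + 3)))) s2 1
        (\<lambda>s'. fst s' (M + 3) = j \<and> fst s' M = n \<and> J (Suc j) ((fst s')(M + 3 := Suc j), snd s'))"
        if "j < n" "J j s2" "fst s2 (M + 3) = j" "fst s2 M = n" for j s2
        apply (rule runs_RAssign)
        using that M by (auto simp: J_def fun_eq_iff)
      show "fst s' (M + 2) = i \<and> fst s' M = n \<and> I (Suc i) ((fst s')(M + 2 := Suc i), snd s')"
        if "J n s' \<and> fst s' M = n" for s'
        using that by (auto simp: J_def I_def less_Suc_eq fun_eq_iff)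
    qed (use i in simp_all)
  qed
  show ?thesis unfolding save_input_def
  proof (rule runs_Seq, rule runs_weaken[OF runs_save_params[OF M] order_refl],
      rule runs_weaken[OF runs_For[where I = I, OF _ _ _ inner]])
    fix s
    assume s: "agree M (init n snr \<rho> Y) s \<and> fst s M = n \<and> snd s M = (\<lambda>_ _. 0)
       \<and> snd s (M + 1) 0 0 = snr \<and> snd s (M + 1) 0 1 = \<rho> \<and> snd s (M + 2) = (\<lambda>_ _. 0)"
    show "fst s M = n" using s by simp
    have "snd s 0 = snd (init n snr \<rho> Y) 0" using s M by (simp add: agree_def)
    then have "snd s 0 = Y" by (simp add: init_def)
    then show "I 0 ((fst s)(M + 2 := 0), snd s)" using s by (simp add: I_def)
    show "stored M n snr \<rho> Y s' \<and> snd s' (M + 2) = (\<lambda>_ _. 0)" if "I n s' \<and> fst s' M = n" for s'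
      using that fill_block[of n Y] Y by (auto simp: I_def stored_def Sym_def)
  qed (simp_all add: algebra_simps)
qed

lemma runs_load_input:
  assumes M: "2 \<le> M" and Y: "Y \<in> Sym n" and s: "stored M n snr \<rho> Y s"
    and j: "fst s (M + 1) = j" "j < n"
  shows "runs \<omega> (load_input M) s (2 * M + 4 + (n * (n * 9 + 4) + 2))
    (\<lambda>s'. agree M (init n snr \<rho> (swap_mat j Y)) s' \<and> stored M n snr \<rho> Y s'
       \<and> fst s' (M + 1) = j \<and> snd s' (M + 2) = snd s (M + 2))"
proof -
  define X where "X = swap_mat j Y"
  \<comment> \<open>Everything the copying loops leave alone: they alter only array \<open>0\<close>
    and registers from \<open>M + 2\<close> on, which is the content of
    \<open>I0_cong\<close>.\<close>
  define I0 where "I0 = (\<lambda>s'::state. stored M n snr \<rho> Y s' \<and> fst s' (M + 1) = j \<and> snd s' (M + 2) = snd s (M + 2)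
     \<and> (\<forall>x<M. fst s' x = (if x = 0 then n else 0))
     \<and> snd s' 1 = (\<lambda>_. \<lambda>_. 0)(0 := (\<lambda>_. 0)(0 := snr, 1 := \<rho>))
     \<and> (\<forall>x<M. 2 \<le> x \<longrightarrow> snd s' x = (\<lambda>_ _. 0)))"
  have I0_cong: "I0 s2" if "I0 s1" "\<And>x. x \<le> M + 1 \<Longrightarrow> fst s2 x = fst s1 x" "\<And>x. 0 < x \<Longrightarrow> snd s2 x = snd s1 x" for s1 s2
    using that M unfolding I0_def stored_def by auto
  define I where "I = (\<lambda>(i::nat) (s'::state). I0 s' \<and> snd s' 0 = (\<lambda>p q. if p < i \<and> q < n then X p q else 0))"
  have inner: "runs \<omega> (For (M + 3) M
     (Seq (swap_reg (M + 4) (M + 2) (M + 1)) (Seq (swap_reg (M + 5) (M + 3) (M + 1))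
            (RAssign 0 (NReg (M + 2)) (NReg (M + 3)) (Cell M (NReg (M + 4)) (NReg (M + 5))))))) s1 (n * ((3 + (3 + 1)) + 2) + 2)
     (\<lambda>s'. fst s' (M + 2) = i \<and> fst s' M = n \<and> I (Suc i) ((fst s')(M + 2 := Suc i), snd s'))"
    if i: "i < n" "I i s1" "fst s1 (M + 2) = i" "fst s1 M = n" for i s1
  proof -
    define J where "J = (\<lambda>(k::nat) (s'::state). fst s' (M + 2) = i \<and> I0 s'
      \<and> snd s' 0 = (\<lambda>p q. if p < i \<and> q < n \<or> p = i \<and> q < k then X p q else 0))"
    show ?thesis
    proof (rule runs_weaken[OF runs_For[where I = J]])
      show "J 0 ((fst s1)(M + 3 := 0), snd s1)" using i by (auto simp: J_def I_def intro: I0_cong)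
      show "runs \<omega> (Seq (swap_reg (M + 4) (M + 2) (M + 1)) (Seq (swap_reg (M + 5) (M + 3) (M + 1))
            (RAssign 0 (NReg (M + 2)) (NReg (M + 3)) (Cell M (NReg (M + 4)) (NReg (M + 5)))))) s2 (3 + (3 + 1))
        (\<lambda>s'. fst s' (M + 3) = k \<and> fst s' M = n \<and> J (Suc k) ((fst s')(M + 3 := Suc k), snd s'))"
        if k: "k < n" "J k s2" "fst s2 (M + 3) = k" "fst s2 M = n" for k s2
      proof (rule runs_Seq, rule runs_swap_reg, simp, rule runs_Seq, rule runs_swap_reg, simp, rule runs_RAssign, intro conjI)
        have st: "snd s2 M = Y" "fst s2 (M + 1) = j" "fst s2 (M + 2) = i"
          using k(2) by (auto simp: J_def I0_def stored_def)
        let ?s3 = "((fst s2)(M + 4 := swap0 (fst s2 (M + 1)) (fst s2 (M + 2))), snd s2)"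
        let ?s4 = "((fst ?s3)(M + 5 := swap0 (fst ?s3 (M + 1)) (fst ?s3 (M + 3))), snd ?s3)"
        let ?s5 = "(fst ?s4, (snd ?s4)(0 := (snd ?s4 0)(nval ?s4 (NReg (M + 2)) := (snd ?s4 0 (nval ?s4 (NReg (M + 2))))
           (nval ?s4 (NReg (M + 3)) := rval \<omega> ?s4 (Cell M (NReg (M + 4)) (NReg (M + 5)))))))"
        show "fst ?s5 (M + 3) = k" "fst ?s5 M = n" using k by simp_all
        have "I0 ((fst ?s5)(M + 3 := Suc k), snd ?s5)"
          by (rule I0_cong[of s2]) (use k in \<open>auto simp: J_def\<close>)
        then show "J (Suc k) ((fst ?s5)(M + 3 := Suc k), snd ?s5)"
          using k st by (auto simp: J_def fun_eq_iff X_def swap_mat_def)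
      qed
      show "fst s' (M + 2) = i \<and> fst s' M = n \<and> I (Suc i) ((fst s')(M + 2 := Suc i), snd s')"
        if "J n s' \<and> fst s' M = n" for s'
        using that by (auto simp: J_def I_def less_Suc_eq fun_eq_iff intro: I0_cong)
    qed (use i in simp_all)
  qed
  have "runs \<omega> (load_input M) s ((2 * M + 1) + (1 + (1 + (1 + (n * ((n * ((3 + (3 + 1)) + 2) + 2) + 2) + 2)))))
    (\<lambda>s'. I n s' \<and> fst s' M = n)"
    unfolding load_input_def
  proof (rule runs_Seq, rule runs_reset_prog, rule runs_Seq, rule runs_NAssign, rule runs_Seq, rule runs_RAssign,
      rule runs_Seq, rule runs_RAssign, rule runs_For[where I = I, OF _ _ _ inner])
    fix s'
    assume s': "same_above (max 1 M) s s'" "\<forall>x<M. fst s' x = 0 \<and> snd s' x = (\<lambda>_ _. 0)"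
    let ?s1 = "((fst s')(0 := nval s' (NReg M)), snd s')"
    let ?s2 = "(fst ?s1, (snd ?s1)(1 := (snd ?s1 1)(nval ?s1 (NConst 0) := (snd ?s1 1 (nval ?s1 (NConst 0)))
           (nval ?s1 (NConst 0) := rval \<omega> ?s1 (Cell (M + 1) (NConst 0) (NConst 0))))))"
    let ?s3 = "(fst ?s2, (snd ?s2)(1 := (snd ?s2 1)(nval ?s2 (NConst 0) := (snd ?s2 1 (nval ?s2 (NConst 0)))
           (nval ?s2 (NConst 1) := rval \<omega> ?s2 (Cell (M + 1) (NConst 0) (NConst 1))))))"
    have ab: "\<forall>x\<ge>M. fst s' x = fst s x \<and> snd s' x = snd s x" using s'(1) M by (simp add: same_above_def max_def)
    show "fst ?s3 M = n" using ab s M by (simp add: stored_def)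
    show "I 0 ((fst ?s3)(M + 2 := 0), snd ?s3)"
      using ab s s'(2) M j by (auto simp: I_def I0_def stored_def fun_eq_iff)
  qed simp_all
  then show ?thesis
  proof (rule runs_weaken)
    show "agree M (init n snr \<rho> (swap_mat j Y)) s' \<and> stored M n snr \<rho> Y s'
       \<and> fst s' (M + 1) = j \<and> snd s' (M + 2) = snd s (M + 2)" if "I n s' \<and> fst s' M = n" for s'
    proof -
      have "X \<in> Sym n" unfolding X_def by (rule swap_mat_Sym[OF Y j(2)])
      then have x: "snd s' 0 = swap_mat j Y" using that fill_block[of n X] by (auto simp: I_def Sym_def X_def)
      have i0: "I0 s'" using that by (simp add: I_def)
      have "fst (init n snr \<rho> (swap_mat j Y)) x = fst s' x \<and> snd (init n snr \<rho> (swap_mat j Y)) x = snd s' x" if "x < M" for x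
      proof -
        consider "x = 0" | "x = 1" | "2 \<le> x" by linarith
        then show ?thesis using x i0 that M by cases (auto simp: init_def I0_def)
      qed
      then show ?thesis using i0 by (simp add: agree_def I0_def)
    qed
  qed (simp add: algebra_simps)
qed

lemma runs_symm_prog:
  assumes c: "com_bound c \<le> M" and M: "2 \<le> M" and Y: "Y \<in> Sym n" and n: "0 < n"
    and ex: "\<And>Y. Y \<in> Sym n \<Longrightarrow> \<exists>t s. exec \<omega> c (init n snr \<rho> Y) t s \<and> t \<le> T \<and> f Y = vector_out n s"
  shows "runs \<omega> (symm_prog M c) (init n snr \<rho> Y)
     (5 + n * (n * 3 + 4) + n * (2 * M + 9 + (n * (n * 9 + 4)) + T) + 3)
    (\<lambda>s. scalar_out n s = (\<Sum>j<n. f (swap_mat j Y) j) / real n)"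
proof -
  define I where "I = (\<lambda>(i::nat) (s'::state). stored M n snr \<rho> Y s' \<and> snd s' (M + 2) 0 0 = (\<Sum>j<i. f (swap_mat j Y) j))"
  have body: "runs \<omega> (Seq (load_input M) (Seq c
       (RAssign (M + 2) (NConst 0) (NConst 0)
          (RAdd (Cell (M + 2) (NConst 0) (NConst 0)) (Cell 0 (NReg (M + 1)) (NConst 0)))))) s
        ((2 * M + 4 + (n * (n * 9 + 4) + 2)) + (T + 1))
       (\<lambda>s'. fst s' (M + 1) = j \<and> fst s' M = n \<and> I (Suc j) ((fst s')(M + 1 := Suc j), snd s'))"
    if j: "j < n" "I j s" "fst s (M + 1) = j" "fst s M = n" for j s
  proof -
    obtain t s1 where ex1: "exec \<omega> c (init n snr \<rho> (swap_mat j Y)) t s1" "t \<le> T" "f (swap_mat j Y) = vector_out n s1"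
      using ex[OF swap_mat_Sym[OF Y j(1)]] by blast
    have st: "stored M n snr \<rho> Y s" using j(2) by (simp add: I_def)
    show ?thesis
    proof (rule runs_Seq, rule runs_weaken[OF runs_load_input[OF M Y st j(3,1)] order_refl],
        rule runs_Seq, rule runs_frame[OF ex1(1,2) c], blast)
      fix s2 s3
      assume s2: "agree M (init n snr \<rho> (swap_mat j Y)) s2 \<and> stored M n snr \<rho> Y s2
        \<and> fst s2 (M + 1) = j \<and> snd s2 (M + 2) = snd s (M + 2)"
        and s3: "agree M s1 s3" "same_above M s2 s3"
      have "snd s3 0 = snd s1 0" using s3(1) M by (simp add: agree_def)
      then have "snd s3 0 j 0 = f (swap_mat j Y) j" using ex1(3) j(1) by (simp add: vector_out_def)
      moreover have "fst s3 x = fst s2 x \<and> snd s3 x = snd s2 x" if "M \<le> x" for x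
        using s3(2) that by (simp add: same_above_def)
      ultimately show "runs \<omega> (RAssign (M + 2) (NConst 0) (NConst 0)
          (RAdd (Cell (M + 2) (NConst 0) (NConst 0)) (Cell 0 (NReg (M + 1)) (NConst 0)))) s3 1
        (\<lambda>s'. fst s' (M + 1) = j \<and> fst s' M = n \<and> I (Suc j) ((fst s')(M + 1 := Suc j), snd s'))"
        using s2 j(2) by (intro runs_RAssign) (auto simp: I_def stored_def)
    qed
  qed
  have "runs \<omega> (symm_prog M c) (init n snr \<rho> Y)
     ((3 + (n * (n * 3 + 4) + 2)) + ((n * (((2 * M + 4 + (n * (n * 9 + 4) + 2)) + (T + 1)) + 2) + 2) + 1))
    (\<lambda>s. scalar_out n s = (\<Sum>j<n. f (swap_mat j Y) j) / real n)"
    unfolding symm_prog_def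
  proof (rule runs_Seq, rule runs_weaken[OF runs_save_input[OF M Y] order_refl], rule runs_Seq,
      rule runs_weaken[OF runs_For[where I = I, OF _ _ _ body] order_refl])
    fix s assume s: "stored M n snr \<rho> Y s \<and> snd s (M + 2) = (\<lambda>_ _. 0)"
    show "fst s M = n" using s by (simp add: stored_def)
    show "I 0 ((fst s)(M + 1 := 0), snd s)" using s by (simp add: I_def stored_def)
    fix s' assume "I n s' \<and> fst s' M = n"
    then show "runs \<omega> (RAssign 0 (NConst 0) (NConst 0) (RDiv (Cell (M + 2) (NConst 0) (NConst 0)) (RNat (NReg M)))) s' 1
      (\<lambda>s. scalar_out n s = (\<Sum>j<n. f (swap_mat j Y) j) / real n)"
      by (intro runs_RAssign) (simp add: scalar_out_def I_def)
  qed simp_all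
  then show ?thesis by (rule runs_weaken) (auto simp: algebra_simps)
qed

lemma seedless_reset_prog [simp]: "seedless (reset_prog m)"
  by (induction m) auto

lemma poly_time_symmetrise:
  assumes "poly_time rnd lm rh vector_out f"
  shows "poly_time rnd lm rh scalar_out (\<lambda>n Y \<omega>. (\<Sum>j<n. f n (swap_mat j Y) \<omega> j) / real n)"
proof -
  obtain c C d where c: "rnd \<or> seedless c"
    "\<And>n Y \<omega>. 1 \<le> n \<Longrightarrow> Y \<in> Sym n \<Longrightarrow> \<exists>t s. exec \<omega> c (init n (lm n) (rh n) Y) t s \<and> t \<le> C * n ^ d \<and> f n Y \<omega> = vector_out n s"
    using assms unfolding poly_time_def by blast
  define M where "M = max 2 (com_bound c)"
  have M: "2 \<le> M" "com_bound c \<le> M" by (auto simp: M_def)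
  \<comment> \<open>\<open>M\<close> depends on the program alone, so the cost of resetting counts
    as a constant per call.\<close>
  have "\<exists>t s. exec \<omega> (symm_prog M c) (init n (lm n) (rh n) Y) t s \<and> t \<le> (8 + (13 + 2 * M) + 7 + 9 + C) * n ^ (d + 2 + 2)
      \<and> (\<Sum>j<n. f n (swap_mat j Y) \<omega> j) / real n = scalar_out n s" if n: "1 \<le> n" "Y \<in> Sym n" for n Y \<omega>
  proof -
    from runs_symm_prog[OF M(2,1) n(2) _ c(2)[OF n(1)], of \<omega>] n obtain t s where
      "exec \<omega> (symm_prog M c) (init n (lm n) (rh n) Y) t s"
      "t \<le> 5 + n * (n * 3 + 4) + n * (2 * M + 9 + (n * (n * 9 + 4)) + C * n ^ d) + 3"
      "scalar_out n s = (\<Sum>j<n. f n (swap_mat j Y) \<omega> j) / real n" unfolding runs_def by auto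
    moreover from this(2) have "t \<le> (8 + (13 + 2 * M) + 7 + 9 + C) * n ^ (d + 2 + 2)"
    proof (rule order_trans)
      have p: "n ^ i \<le> n ^ (d + 4)" if "i \<le> d + 4" for i using that n(1) by (intro power_increasing) auto
      have "5 + n * (n * 3 + 4) + n * (2 * M + 9 + (n * (n * 9 + 4)) + C * n ^ d) + 3
        = 8 * n ^ 0 + (13 + 2 * M) * n ^ 1 + 7 * n ^ 2 + 9 * n ^ 3 + C * n ^ Suc d"
        by (simp add: algebra_simps power2_eq_square power3_eq_cube)
      also have "\<dots> \<le> 8 * n ^ (d + 4) + (13 + 2 * M) * n ^ (d + 4) + 7 * n ^ (d + 4) + 9 * n ^ (d + 4) + C * n ^ (d + 4)"
        by (intro add_mono mult_le_mono order_refl p) auto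
      finally show "5 + n * (n * 3 + 4) + n * (2 * M + 9 + (n * (n * 9 + 4)) + C * n ^ d) + 3
        \<le> (8 + (13 + 2 * M) + 7 + 9 + C) * n ^ (d + 2 + 2)"
        by (simp only: distrib_right add.assoc[of d 2 2] one_add_one numeral_plus_numeral add_num_simps)
    qed
    ultimately show ?thesis by metis
  qed
  moreover have "rnd \<or> seedless (symm_prog M c)"
    using c(1) by (auto simp: symm_prog_def save_input_def save_params_def load_input_def swap_reg_def)
  ultimately show ?thesis unfolding poly_time_def by blast
qed

section \<open>Rounding\<close>

lemma prob_space_seed_space: "prob_space seed_space"
  unfolding seed_space_def by (intro prob_space_PiM prob_space_uniform_measure) auto

lemma prob_space_bernoulli_vec: "prob_space (bernoulli_vec n \<rho>)"
  unfolding bernoulli_vec_def by (intro prob_space_PiM prob_space_measure_pmf)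

lemma measurable_bernoulli_coord [measurable]:
  "i < n \<Longrightarrow> (\<lambda>v. g (v i)) \<in> borel_measurable (bernoulli_vec n \<rho>)"
proof -
  assume "i < n"
  then have "(\<lambda>v. v i) \<in> measurable (bernoulli_vec n \<rho>) (measure_pmf (bernoulli_pmf \<rho>))"
    unfolding bernoulli_vec_def by (intro measurable_component_singleton) simp
  then show ?thesis by (rule measurable_compose) simp
qed

section \<open>Concentration of the size of the planted set\<close>

definition count :: "nat \<Rightarrow> (nat \<Rightarrow> bool) \<Rightarrow> real" where
  "count n v = (\<Sum>i<n. of_bool (v i))"

lemma bernoulli_vec_covariance:
  assumes \<rho>: "0 \<le> \<rho>" "\<rho> \<le> 1" and ij: "i < n" "j < n"
  shows "integrable (bernoulli_vec n \<rho>) (\<lambda>v. (of_bool (v i) - \<rho>) * (of_bool (v j) - \<rho>))"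
    "(\<integral>v. (of_bool (v i) - \<rho>) * (of_bool (v j) - \<rho>) \<partial>bernoulli_vec n \<rho>) = (if i = j then \<rho> * (1 - \<rho>) else 0)"
proof -
  define B where "B = measure_pmf (bernoulli_pmf \<rho>)"
  interpret product_sigma_finite "\<lambda>_::nat. B"
    by (intro product_sigma_finite.intro prob_space_imp_sigma_finite) (simp add: B_def prob_space_measure_pmf)
  define x where "x = (\<lambda>b. of_bool b - \<rho>)"
  \<comment> \<open>A product over all coordinates with factor \<open>1\<close> away from
    \<open>i\<close> and \<open>j\<close>. For \<open>i = j\<close> both conditions hold at the same
    coordinate and produce the square, so one factorisation of the integral serves both
    cases.\<close>
  define f where "f = (\<lambda>l b. (if l = i then x b else 1) * (if l = j then x b else 1))"
  have prod: "x (v i) * x (v j) = (\<Prod>l<n. f l (v l))" for v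
    using ij by (simp add: f_def prod.distrib prod.delta)
  have int: "integrable B (f l)" for l
    unfolding B_def by (rule integrable_measure_pmf_finite) simp
  show "integrable (bernoulli_vec n \<rho>) (\<lambda>v. (of_bool (v i) - \<rho>) * (of_bool (v j) - \<rho>))"
  proof -
    have "integrable (PiM {..<n} (\<lambda>_. B)) (\<lambda>v. \<Prod>l<n. f l (v l))"
      by (rule product_integrable_prod) (auto intro: int)
    then show ?thesis by (simp only: prod[symmetric] bernoulli_vec_def B_def x_def)
  qed
  have "(\<integral>v. x (v i) * x (v j) \<partial>bernoulli_vec n \<rho>) = (\<Prod>l<n. \<integral>b. f l b \<partial>B)"
    unfolding prod bernoulli_vec_def B_def[symmetric]
    by (rule product_integral_prod) (auto intro: int)
  also have "\<dots> = (if i = j then \<rho> * (1 - \<rho>) else 0)"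
  proof (cases "i = j")
    case True
    have "(\<integral>b. f l b \<partial>B) = (if l = j then \<rho> * (1 - \<rho>) else 1)" for l
      using \<rho> True by (simp add: B_def f_def x_def algebra_simps)
    then show ?thesis using ij True by (simp add: prod.delta)
  next
    case False
    have "(\<integral>b. f i b \<partial>B) = 0"
      using \<rho> False by (simp add: B_def f_def x_def algebra_simps)
    then show ?thesis using ij False by (auto intro!: prod_zero)
  qed
  finally show "(\<integral>v. (of_bool (v i) - \<rho>) * (of_bool (v j) - \<rho>) \<partial>bernoulli_vec n \<rho>) = (if i = j then \<rho> * (1 - \<rho>) else 0)"
    by (simp add: x_def)
qed

lemma bernoulli_vec_variance:
  assumes \<rho>: "0 \<le> \<rho>" "\<rho> \<le> 1"
  shows "(\<integral>\<^sup>+v. ennreal ((count n v - \<rho> * n)\<^sup>2) \<partial>bernoulli_vec n \<rho>) \<le> ennreal (\<rho> * n)"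
proof -
  note cov = bernoulli_vec_covariance[OF \<rho>]
  have eq: "(count n v - \<rho> * n)\<^sup>2 = (\<Sum>i<n. \<Sum>j<n. (of_bool (v i) - \<rho>) * (of_bool (v j) - \<rho>))" for v
  proof -
    have "count n v - \<rho> * n = (\<Sum>i<n. of_bool (v i) - \<rho>)" by (simp add: count_def sum_subtractf)
    then show ?thesis by (simp add: power2_eq_square sum_product)
  qed
  have "integrable (bernoulli_vec n \<rho>) (\<lambda>v. (count n v - \<rho> * n)\<^sup>2)"
    unfolding eq by (intro Bochner_Integration.integrable_sum cov) auto
  then have "(\<integral>\<^sup>+v. ennreal ((count n v - \<rho> * n)\<^sup>2) \<partial>bernoulli_vec n \<rho>)
      = ennreal (\<integral>v. (count n v - \<rho> * n)\<^sup>2 \<partial>bernoulli_vec n \<rho>)"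
    by (rule nn_integral_eq_integral) simp
  also have "(\<integral>v. (count n v - \<rho> * n)\<^sup>2 \<partial>bernoulli_vec n \<rho>)
      = (\<Sum>i<n. \<integral>v. (\<Sum>j<n. (of_bool (v i) - \<rho>) * (of_bool (v j) - \<rho>)) \<partial>bernoulli_vec n \<rho>)"
    unfolding eq by (intro Bochner_Integration.integral_sum Bochner_Integration.integrable_sum cov) auto
  also have "\<dots> = (\<Sum>i<n. \<Sum>j<n. \<integral>v. (of_bool (v i) - \<rho>) * (of_bool (v j) - \<rho>) \<partial>bernoulli_vec n \<rho>)"
    by (intro sum.cong refl Bochner_Integration.integral_sum cov) auto
  also have "\<dots> = (\<Sum>i<n. \<Sum>j<n. if i = j then \<rho> * (1 - \<rho>) else 0)"
    by (intro sum.cong refl cov) auto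
  also have "\<dots> = n * (\<rho> * (1 - \<rho>))" by simp
  also have "\<dots> \<le> \<rho> * n" using mult_left_mono[of "\<rho> * (1 - \<rho>)" \<rho> "real n"] by (simp add: algebra_simps)
  finally show ?thesis by (auto intro: ennreal_leI)
qed

section \<open>Measurability in the planted model\<close>

lemma planted_Sym: "W \<in> Sym n \<Longrightarrow> planted n snr v W \<in> Sym n"
  by (auto simp: Sym_def planted_def)

lemma measurable_planted:
  "(\<lambda>(v, W, \<omega>). (planted n snr v W, \<omega>)) \<in>
     measurable (bernoulli_vec n \<rho> \<Otimes>\<^sub>M (noise n \<Otimes>\<^sub>M seed_space)) (sym_space n \<Otimes>\<^sub>M seed_space)"
proof -
  let ?P = "bernoulli_vec n \<rho> \<Otimes>\<^sub>M (noise n \<Otimes>\<^sub>M seed_space)"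
  have W: "(\<lambda>x. fst (snd x)) \<in> measurable ?P (sym_space n)"
    using measurable_fst''[OF measurable_snd] by (simp cong: measurable_cong_sets)
  have v: "(\<lambda>x. of_bool (fst x i) :: real) \<in> borel_measurable ?P" if "i < n" for i
    using measurable_compose[OF measurable_fst measurable_bernoulli_coord[OF that]] .
  have "(\<lambda>x. planted n snr (fst x) (fst (snd x))) \<in> measurable ?P (sym_space n)"
  proof (rule measurable_sym_spaceI)
    show "planted n snr (fst x) (fst (snd x)) \<in> Sym n" if "x \<in> space ?P" for x
      using that by (auto simp: space_pair_measure intro: planted_Sym)
    show "(\<lambda>x. planted n snr (fst x) (fst (snd x)) i j) \<in> borel_measurable ?P" for i j
      unfolding planted_def
      by (cases "i < n \<and> j < n") (auto intro!: borel_measurable_add borel_measurable_times v measurable_sym_spaceD[OF W])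
  qed
  then show ?thesis unfolding split_beta by (intro measurable_Pair) auto
qed

lemma planted_loss_measurable:
  assumes "case_prod f \<in> borel_measurable (sym_space n \<Otimes>\<^sub>M seed_space)" "j < n"
  shows "(\<lambda>(v, W, \<omega>). ennreal ((f (planted n snr v W) \<omega> i - of_bool (v j))\<^sup>2))
    \<in> borel_measurable (bernoulli_vec n \<rho> \<Otimes>\<^sub>M (noise n \<Otimes>\<^sub>M seed_space))"
proof -
  have "(\<lambda>x. case_prod f ((\<lambda>(v, W, \<omega>). (planted n snr v W, \<omega>)) x) i)
      \<in> borel_measurable (bernoulli_vec n \<rho> \<Otimes>\<^sub>M (noise n \<Otimes>\<^sub>M seed_space))"
    by (rule measurable_product_then_coordinatewise, rule measurable_compose[OF measurable_planted assms(1)])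
  moreover have "(\<lambda>x. of_bool (fst x j) :: real) \<in> borel_measurable (bernoulli_vec n \<rho> \<Otimes>\<^sub>M (noise n \<Otimes>\<^sub>M seed_space))"
    using measurable_compose[OF measurable_fst measurable_bernoulli_coord[OF assms(2)]] .
  ultimately show ?thesis
    unfolding split_beta by (intro measurable_compose[OF _ measurable_ennreal] borel_measurable_power borel_measurable_diff) simp_all
qed

section \<open>Loss of row thresholding\<close>

lemma frob_sq_planted:
  "frob_sq n (planted n snr v (\<lambda>_ _. 0)) = snr\<^sup>2 * (count n v)\<^sup>2"
proof -
  have "frob_sq n (planted n snr v (\<lambda>_ _. 0)) = (\<Sum>i<n. \<Sum>j<n. snr\<^sup>2 * (of_bool (v i) * of_bool (v j)))"
    unfolding frob_sq_def by (intro sum.cong refl) (auto simp: planted_def)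
  also have "\<dots> = snr\<^sup>2 * (count n v)\<^sup>2"
  proof -
    have "(count n v)\<^sup>2 = (\<Sum>i<n. \<Sum>j<n. of_bool (v i) * of_bool (v j))"
      by (simp only: count_def power2_eq_square sum_product)
    then show ?thesis by (simp only: sum_distrib_left)
  qed
  finally show ?thesis .
qed

text \<open>Let E be the squared error of row \<open>i\<close> in units of
  \<open>snr\<^sup>2 * k\<close>. A missed row has signal at least 9/10 but estimate below 1/4, so
  9/10 < 2E + 1/2 and E exceeds 1/5; a false detection has E at least 1/4. Either way
  \<open>5\<close> times E pays for one mistake.\<close>

lemma thresh_loss_row:
  fixes snr \<rho> :: real
  assumes k: "k = \<rho> * real n" "0 < k" and s: "0 < snr" and good: "9 / 10 * k \<le> count n v" and i: "i < n"
    and tot: "frob_sq n U \<le> 4 * (snr * snr) * (k * k)"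
  shows "(thresh n snr \<rho> U i - of_bool (v i))\<^sup>2
     \<le> 5 / (snr\<^sup>2 * k) * (\<Sum>j<n. (U i j - planted n snr v (\<lambda>_ _. 0) i j)\<^sup>2)"
proof -
  define R where "R = (\<Sum>j<n. (U i j)\<^sup>2)"
  define E where "E = (\<Sum>j<n. (U i j - planted n snr v (\<lambda>_ _. 0) i j)\<^sup>2)"
  have E: "0 \<le> E" by (simp add: E_def sum_nonneg)
  have sk: "0 < snr\<^sup>2 * k" using k s by simp
  have t: "thresh n snr \<rho> U i = (if snr\<^sup>2 * k / 4 \<le> R then 1 else 0)"
    using i tot by (simp add: thresh_def R_def k(1)[symmetric] power2_eq_square)
  consider "thresh n snr \<rho> U i = of_bool (v i)" | "v i" "R < snr\<^sup>2 * k / 4" | "\<not> v i" "snr\<^sup>2 * k / 4 \<le> R"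
    by (cases "v i"; cases "snr\<^sup>2 * k / 4 \<le> R") (auto simp: t not_le)
  then have "(thresh n snr \<rho> U i - of_bool (v i))\<^sup>2 \<le> 5 / (snr\<^sup>2 * k) * E"
  proof cases
    case 1
    then show ?thesis using E sk by simp
  next
    case 2
    have "snr\<^sup>2 * count n v = (\<Sum>j<n. (planted n snr v (\<lambda>_ _. 0) i j)\<^sup>2)"
      unfolding count_def sum_distrib_left using 2(1) i by (intro sum.cong refl) (auto simp: planted_def)
    also have "\<dots> \<le> (\<Sum>j<n. 2 * (U i j - planted n snr v (\<lambda>_ _. 0) i j)\<^sup>2 + 2 * (U i j)\<^sup>2)"
    proof (intro sum_mono)
      fix j
      show "(planted n snr v (\<lambda>_ _. 0) i j)\<^sup>2 \<le> 2 * (U i j - planted n snr v (\<lambda>_ _. 0) i j)\<^sup>2 + 2 * (U i j)\<^sup>2"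
        using zero_le_power2[of "2 * U i j - planted n snr v (\<lambda>_ _. 0) i j"]
        by (simp add: power2_eq_square algebra_simps)
    qed
    also have "\<dots> = 2 * E + 2 * R" by (simp add: E_def R_def sum.distrib sum_distrib_left)
    finally have "snr\<^sup>2 * (9 / 10 * k) \<le> 2 * E + 2 * R"
      using mult_left_mono[OF good, of "snr\<^sup>2"] by simp
    then have "snr\<^sup>2 * k \<le> 5 * E" using 2(2) sk by simp
    then show ?thesis using 2 sk by (simp add: t pos_le_divide_eq)
  next
    case 3
    have "R = E" unfolding R_def E_def using 3(1) by (intro sum.cong refl) (simp add: planted_def)
    then have "snr\<^sup>2 * k \<le> 5 * E" using 3(2) E by simp
    then show ?thesis using 3 sk by (simp add: t pos_le_divide_eq)
  qed
  then show ?thesis by (simp add: E_def)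
qed

text \<open>The cap does no harm here. When it is exceeded the output is \<open>0\<close> and the
  loss is at most 11/10 k; but the signal has squared norm at most 121/100 \<lambda>^2k^2 against
  more than 4 \<lambda>^2k^2 for \<open>U\<close>, so the error is at least 79/100 \<lambda>^2k^2,
  more than enough.\<close>

lemma thresh_loss_good:
  fixes snr \<rho> :: real
  assumes k: "k = \<rho> * real n" "0 < k" and s: "0 < snr" and good: "\<bar>count n v - k\<bar> \<le> k / 10"
  shows "(\<Sum>i<n. (thresh n snr \<rho> U i - of_bool (v i))\<^sup>2)
     \<le> 5 / (snr\<^sup>2 * k) * frob_sq n (\<lambda>i j. U i j - planted n snr v (\<lambda>_ _. 0) i j)"
    (is "?L \<le> _ * ?E")
proof (cases "frob_sq n U \<le> 4 * (snr * snr) * (k * k)")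
  case True
  have "?L \<le> (\<Sum>i<n. 5 / (snr\<^sup>2 * k) * (\<Sum>j<n. (U i j - planted n snr v (\<lambda>_ _. 0) i j)\<^sup>2))"
    using good unfolding abs_le_iff by (intro sum_mono thresh_loss_row k s True) auto
  then show ?thesis by (simp add: frob_sq_def sum_distrib_left)
next
  case False
  have sk: "0 < snr\<^sup>2 * k" using k s by simp
  have "?L = count n v"
    using False unfolding count_def by (intro sum.cong refl) (auto simp: thresh_def k(1)[symmetric])
  also have "\<dots> \<le> 11 / 10 * k" using good by linarith
  finally have L: "?L \<le> 11 / 10 * k" .
  have "frob_sq n U \<le> 2 * ?E + 2 * frob_sq n (planted n snr v (\<lambda>_ _. 0))"
  proof -
    have "frob_sq n U = frob_sq n (\<lambda>i j. (U i j - planted n snr v (\<lambda>_ _. 0) i j) + planted n snr v (\<lambda>_ _. 0) i j)"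
      by simp
    also have "\<dots> \<le> 2 * ?E + 2 * frob_sq n (planted n snr v (\<lambda>_ _. 0))"
      using frob_inner_le[of n "\<lambda>i j. U i j - planted n snr v (\<lambda>_ _. 0) i j" "planted n snr v (\<lambda>_ _. 0)"]
      unfolding frob_sq_add by linarith
    finally show ?thesis .
  qed
  moreover have "(count n v)\<^sup>2 \<le> (11 / 10 * k)\<^sup>2"
  proof (rule power_mono)
    show "count n v \<le> 11 / 10 * k" using good by linarith
    show "0 \<le> count n v" unfolding count_def by (intro sum_nonneg) simp
  qed
  then have "snr\<^sup>2 * (count n v)\<^sup>2 \<le> snr\<^sup>2 * (11 / 10 * k)\<^sup>2" by (intro mult_left_mono) auto
  then have "frob_sq n (planted n snr v (\<lambda>_ _. 0)) \<le> 121 / 100 * (snr\<^sup>2 * (k * k))"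
    unfolding frob_sq_planted by (simp add: power2_eq_square mult_ac)
  moreover have "4 * (snr\<^sup>2 * (k * k)) < frob_sq n U"
    using False by (simp add: power2_eq_square mult.assoc)
  ultimately have "4 * (snr\<^sup>2 * (k * k)) \<le> 2 * ?E + 2 * (121 / 100 * (snr\<^sup>2 * (k * k)))"
    by linarith
  then have "11 / 10 * (snr\<^sup>2 * k * k) \<le> 5 * ?E"
    using mult_pos_pos[OF sk k(2)] frob_sq_nonneg[of n "\<lambda>i j. U i j - planted n snr v (\<lambda>_ _. 0) i j"]
    unfolding mult.assoc by linarith
  then have "11 / 10 * k \<le> 5 / (snr\<^sup>2 * k) * ?E"
    using sk by (simp add: pos_le_divide_eq mult_ac)
  with L show ?thesis by linarith
qed

text \<open>Each output \<open>1\<close> consumes at least \<open>snr\<^sup>2 * k / 4\<close> of a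
  total norm capped at \<open>4 * snr\<^sup>2 * k\<^sup>2\<close>, so there are at most
  \<open>16 * k\<close> of them, for any \<open>U\<close> whatsoever.\<close>

lemma thresh_loss_always:
  fixes snr \<rho> :: real
  assumes k: "k = \<rho> * real n" "0 < k" and s: "0 < snr"
  shows "(\<Sum>i<n. (thresh n snr \<rho> U i - of_bool (v i))\<^sup>2) \<le> count n v + 16 * k"
proof -
  have sk: "0 < snr\<^sup>2 * k" using k s by simp
  have "(\<Sum>i<n. (thresh n snr \<rho> U i - of_bool (v i))\<^sup>2) \<le> (\<Sum>i<n. of_bool (v i) + thresh n snr \<rho> U i)"
    by (intro sum_mono) (auto simp: thresh_def)
  moreover have "(\<Sum>i<n. thresh n snr \<rho> U i) \<le> 16 * k"
  proof (cases "frob_sq n U \<le> 4 * (snr * snr) * (k * k)")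
    case True
    have "(\<Sum>i<n. thresh n snr \<rho> U i) \<le> (\<Sum>i<n. 4 / (snr\<^sup>2 * k) * (\<Sum>j<n. (U i j)\<^sup>2))"
    proof (intro sum_mono)
      fix i
      define c where "c = snr\<^sup>2 * k"
      have c: "0 < c" using sk by (simp add: c_def)
      have R: "0 \<le> (\<Sum>j<n. (U i j)\<^sup>2)" by (simp add: sum_nonneg)
      have "thresh n snr \<rho> U i \<le> 4 / c * (\<Sum>j<n. (U i j)\<^sup>2)"
      proof (cases "c / 4 \<le> (\<Sum>j<n. (U i j)\<^sup>2)")
        case True
        have "thresh n snr \<rho> U i \<le> 1" by (simp add: thresh_def)
        also have "1 = 4 / c * (c / 4)" using c by simp
        also have "\<dots> \<le> 4 / c * (\<Sum>j<n. (U i j)\<^sup>2)" using True c by (intro mult_left_mono) auto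
        finally show ?thesis .
      next
        case False
        then have "thresh n snr \<rho> U i = 0"
          by (simp add: thresh_def k(1)[symmetric] c_def power2_eq_square)
        then show ?thesis using R c by simp
      qed
      then show "thresh n snr \<rho> U i \<le> 4 / (snr\<^sup>2 * k) * (\<Sum>j<n. (U i j)\<^sup>2)" by (simp add: c_def)
    qed
    also have "\<dots> = 4 / (snr\<^sup>2 * k) * frob_sq n U" by (simp add: frob_sq_def sum_distrib_left)
    also have "\<dots> \<le> 4 / (snr\<^sup>2 * k) * (4 * (snr * snr) * (k * k))"
      using True sk by (intro mult_left_mono) auto
    also have "\<dots> = 16 * k" using k s by (simp add: power2_eq_square)
    finally show ?thesis .
  next
    case False
    then show ?thesis using k(2) by (simp add: thresh_def k(1)[symmetric])
  qed
  ultimately show ?thesis by (simp add: count_def sum.distrib)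
qed

section \<open>Risks in the planted model\<close>

text \<open>The witness is \<open>v v^T / kp\<close>: its trace is \<open>count n v / kp\<close>,
  and each planted row sums to \<open>count n v\<close> times the diagonal entry. The window for the
  size is thus exactly the row sum condition, and the scale \<open>snr * kp\<close> is forced by the
  trace.\<close>

lemma signal_in_scaled_body:
  assumes snr: "0 \<le> snr" and kp: "0 < kp" and count: "km \<le> count n v" "count n v \<le> kp"
  shows "planted n snr v (\<lambda>_ _. 0) \<in> scale (snr * kp) (body n km kp)"
proof -
  define Z where "Z = planted n (1 / kp) v (\<lambda>_ _. 0)"
  have row: "(\<Sum>j<n. Z i j) = of_bool (v i) * count n v / kp" if "i < n" for i
    unfolding count_def sum_distrib_left sum_divide_distrib using that
    by (intro sum.cong refl) (auto simp: Z_def planted_def)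
  have diag: "Z i i = of_bool (v i) / kp" if "i < n" for i using that by (simp add: Z_def planted_def)
  have "psd n Z" unfolding psd_def
  proof
    fix x :: "nat \<Rightarrow> real"
    have "(\<Sum>i<n. \<Sum>j<n. x i * Z i j * x j) = (\<Sum>i<n. \<Sum>j<n. (of_bool (v i) * x i) * (of_bool (v j) * x j)) / kp"
      unfolding sum_divide_distrib by (intro sum.cong refl) (auto simp: Z_def planted_def)
    also have "\<dots> = (\<Sum>i<n. of_bool (v i) * x i)\<^sup>2 / kp"
      by (simp only: power2_eq_square sum_product)
    finally show "0 \<le> (\<Sum>i<n. \<Sum>j<n. x i * Z i j * x j)" using kp by simp
  qed
  moreover have "Z \<in> Sym n" unfolding Z_def by (rule planted_Sym) (simp add: Sym_def)
  moreover have "0 \<le> Z i j \<and> Z i j \<le> Z i i \<and> Z i j \<le> Z j j" if "i < n" "j < n" for i j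
    using that kp by (auto simp: Z_def planted_def)
  moreover have "km * Z i i \<le> (\<Sum>j<n. Z i j) \<and> (\<Sum>j<n. Z i j) \<le> kp * Z i i" if "i < n" for i
    using that kp count by (auto simp: row diag divide_right_mono)
  moreover have "(\<Sum>i<n. Z i i) \<le> 1"
  proof -
    have "(\<Sum>i<n. Z i i) = count n v / kp"
      unfolding count_def sum_divide_distrib by (intro sum.cong refl) (simp add: diag)
    then show ?thesis using count(2) kp by simp
  qed
  ultimately have Z: "Z \<in> body_plus n km kp" by (simp add: body_plus_def cone_def)
  have "Z \<in> body n km kp"
    unfolding body_def conv_def mem_Collect_eq
    by (intro exI[of _ "{Z}"] exI[of _ "\<lambda>_. 1"]) (use Z in auto)
  moreover have "planted n snr v (\<lambda>_ _. 0) = (\<lambda>i j. snr * kp * Z i j)"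
    using kp by (auto simp: Z_def planted_def fun_eq_iff)
  ultimately show ?thesis unfolding scale_def by (intro image_eqI[of _ _ Z]) simp_all
qed

lemma planted_eq_signal_plus_noise:
  "W \<in> Sym n \<Longrightarrow> planted n snr v W = (\<lambda>i j. planted n snr v (\<lambda>_ _. 0) i j + W i j)"
  by (auto simp: planted_def Sym_def fun_eq_iff)

lemma measurable_thresh:
  assumes "case_prod mu \<in> measurable (sym_space n \<Otimes>\<^sub>M seed_space) (sym_space n)"
  shows "(\<lambda>(Y, \<omega>). thresh n snr \<rho> (mu Y \<omega>)) \<in> borel_measurable (sym_space n \<Otimes>\<^sub>M seed_space)"
proof (rule measurable_coordinatewise_then_product)
  fix i
  let ?P = "sym_space n \<Otimes>\<^sub>M seed_space"
  have [measurable]: "(\<lambda>x. case_prod mu x p q) \<in> borel_measurable ?P" for p q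
    by (rule measurable_sym_spaceD[OF assms])
  have [measurable]: "(\<lambda>x. frob_sq n (case_prod mu x)) \<in> borel_measurable ?P"
    by (rule frob_sq_measurable) measurable
  have "(\<lambda>x. thresh n snr \<rho> (case_prod mu x) i) \<in> borel_measurable ?P"
    unfolding thresh_def by measurable
  then show "(\<lambda>x. (case x of (Y, \<omega>) \<Rightarrow> thresh n snr \<rho> (mu Y \<omega>)) i) \<in> borel_measurable ?P"
    by (simp add: split_beta)
qed

lemma gauss_loss_measurable:
  assumes mu: "case_prod mu \<in> measurable (sym_space n \<Otimes>\<^sub>M seed_space) (sym_space n)" and m: "m \<in> Sym n"
  shows "(\<lambda>(W, \<omega>). ennreal (frob_sq n (\<lambda>i j. mu (\<lambda>i j. m i j + W i j) \<omega> i j - m i j)))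
    \<in> borel_measurable (noise n \<Otimes>\<^sub>M seed_space)"
proof -
  let ?P = "noise n \<Otimes>\<^sub>M seed_space"
  have W: "fst \<in> measurable ?P (sym_space n)"
    using measurable_fst[of "noise n" seed_space] by (simp cong: measurable_cong_sets)
  have "(\<lambda>x i j. m i j + fst x i j) \<in> measurable ?P (sym_space n)"
  proof (rule measurable_sym_spaceI)
    show "(\<lambda>i j. m i j + fst x i j) \<in> Sym n" if "x \<in> space ?P" for x
      using that m by (auto simp: space_pair_measure Sym_def)
    show "(\<lambda>x. m i j + fst x i j) \<in> borel_measurable ?P" for i j
      by (intro borel_measurable_add measurable_sym_spaceD[OF W]) simp
  qed
  then have "(\<lambda>x. (\<lambda>i j. m i j + fst x i j, snd x)) \<in> measurable ?P (sym_space n \<Otimes>\<^sub>M seed_space)"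
    by (intro measurable_Pair) simp_all
  from measurable_compose[OF this mu]
  have U: "(\<lambda>x. mu (\<lambda>i j. m i j + fst x i j) (snd x)) \<in> measurable ?P (sym_space n)" by simp
  show ?thesis unfolding split_beta
    by (intro measurable_compose[OF _ measurable_ennreal] frob_sq_measurable borel_measurable_diff
        measurable_sym_spaceD[OF U] borel_measurable_const)
qed

text \<open>For each fixed \<open>v\<close> the inner integral is bounded by the sum of two terms,
  of which one suffices in each case, so the outer integral need not be split. The second term is
  Chebyshev's inequality in pointwise form, integrated by
  \<open>bernoulli_vec_variance\<close>.\<close>

lemma planted_vec_risk_thresh:
  assumes mu: "case_prod mu \<in> measurable (sym_space n \<Otimes>\<^sub>M seed_space) (sym_space n)"
    and snr: "0 < snr" and \<rho>: "0 \<le> \<rho>" "\<rho> \<le> 1" and k: "k = \<rho> * real n" "0 < k"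
    and \<delta>: "0 < \<delta>" "\<delta> \<le> 1 / 10"
    and G: "\<And>v. \<bar>count n v - k\<bar> \<le> \<delta> * k \<Longrightarrow> gauss_risk n mu (planted n snr v (\<lambda>_ _. 0)) \<le> G"
  shows "planted_vec_risk n snr \<rho> (\<lambda>Y \<omega>. thresh n snr \<rho> (mu Y \<omega>))
     \<le> ennreal (5 / (snr\<^sup>2 * k)) * G + ennreal (18 / \<delta>\<^sup>2)"
proof -
  interpret N: prob_space "noise n" by (rule prob_space_noise)
  interpret S: prob_space seed_space by (rule prob_space_seed_space)
  interpret V: prob_space "bernoulli_vec n \<rho>" by (rule prob_space_bernoulli_vec)
  interpret NS: pair_prob_space "noise n" seed_space ..
  let ?P = "noise n \<Otimes>\<^sub>M seed_space"
  define f where "f = (\<lambda>Y \<omega>. thresh n snr \<rho> (mu Y \<omega>))"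
  define loss where "loss = (\<lambda>(v, W, \<omega>). ennreal (\<Sum>i<n. (f (planted n snr v W) \<omega> i - of_bool (v i))\<^sup>2))"
  have fm: "case_prod f \<in> borel_measurable (sym_space n \<Otimes>\<^sub>M seed_space)"
    using measurable_thresh[OF mu] by (simp add: f_def)
  have loss_m: "loss \<in> borel_measurable (bernoulli_vec n \<rho> \<Otimes>\<^sub>M ?P)"
  proof -
    have "loss = (\<lambda>x. \<Sum>i<n. (\<lambda>(v, W, \<omega>). ennreal ((f (planted n snr v W) \<omega> i - of_bool (v i))\<^sup>2)) x)"
      by (auto simp: loss_def fun_eq_iff sum_ennreal)
    then show ?thesis by (simp only:) (intro borel_measurable_sum planted_loss_measurable fm, simp)
  qed
  \<comment> \<open>Off the good event the deviation d exceeds \<open>\<delta> * k\<close>, so both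
    \<open>k\<close> and d are at most \<open>d^2 / (\<delta>^2 * k)\<close>; the loss is at most
    \<open>17 * k + d\<close>, whence \<open>18\<close>.\<close>
  define c where "c = 18 / (\<delta>\<^sup>2 * k)"
  have c: "0 \<le> c" using k by (simp add: c_def)
  have inner: "(\<integral>\<^sup>+x. loss (v, x) \<partial>?P) \<le> ennreal (5 / (snr\<^sup>2 * k)) * G + ennreal (c * (count n v - k)\<^sup>2)" for v
  proof (cases "\<bar>count n v - k\<bar> \<le> \<delta> * k")
    case True
    define m where "m = planted n snr v (\<lambda>_ _. 0)"
    have mS: "m \<in> Sym n" unfolding m_def by (rule planted_Sym) (simp add: Sym_def)
    have "\<delta> * k \<le> k / 10" using mult_right_mono[OF \<delta>(2), of k] k(2) by simp
    then have good: "\<bar>count n v - k\<bar> \<le> k / 10" using True by linarith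
    have "(\<integral>\<^sup>+x. loss (v, x) \<partial>?P) \<le> (\<integral>\<^sup>+x. ennreal (5 / (snr\<^sup>2 * k)) *
        (\<lambda>(W, \<omega>). ennreal (frob_sq n (\<lambda>i j. mu (\<lambda>i j. m i j + W i j) \<omega> i j - m i j))) x \<partial>?P)"
    proof (rule nn_integral_mono)
      fix x assume "x \<in> space ?P"
      then obtain W \<omega> where x: "x = (W, \<omega>)" "W \<in> Sym n" by (auto simp: space_pair_measure)
      have e: "planted n snr v W = (\<lambda>i j. m i j + W i j)"
        unfolding m_def by (rule planted_eq_signal_plus_noise[OF x(2)])
      have "(\<Sum>i<n. (f (planted n snr v W) \<omega> i - of_bool (v i))\<^sup>2)
          \<le> 5 / (snr\<^sup>2 * k) * frob_sq n (\<lambda>i j. mu (planted n snr v W) \<omega> i j - m i j)"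
        unfolding f_def m_def by (rule thresh_loss_good[OF k snr good])
      then show "loss (v, x) \<le> ennreal (5 / (snr\<^sup>2 * k)) *
          (\<lambda>(W, \<omega>). ennreal (frob_sq n (\<lambda>i j. mu (\<lambda>i j. m i j + W i j) \<omega> i j - m i j))) x"
        using k(2) by (auto simp: loss_def x(1) e ennreal_mult[symmetric] frob_sq_nonneg intro!: ennreal_leI)
    qed
    also have "\<dots> = ennreal (5 / (snr\<^sup>2 * k)) * gauss_risk n mu m"
      unfolding gauss_risk_def by (rule nn_integral_cmult[OF gauss_loss_measurable[OF mu mS]])
    also have "\<dots> \<le> ennreal (5 / (snr\<^sup>2 * k)) * G"
      using G[OF True] by (intro mult_left_mono) (auto simp: m_def)
    also have "\<dots> \<le> ennreal (5 / (snr\<^sup>2 * k)) * G + ennreal (c * (count n v - k)\<^sup>2)" by simp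
    finally show ?thesis .
  next
    case False
    define d where "d = \<bar>count n v - k\<bar>"
    have d: "\<delta> * k < d" using False by (simp add: d_def)
    have dk: "0 < \<delta> * k" using \<delta> k by simp
    have sq: "(\<delta> * k) * (\<delta> * k) \<le> d * d" using d dk by (intro mult_mono) auto
    have "k \<le> d\<^sup>2 / (\<delta>\<^sup>2 * k)"
      using sq k \<delta> by (simp add: pos_le_divide_eq power2_eq_square mult_ac)
    moreover have "d \<le> d\<^sup>2 / (\<delta>\<^sup>2 * k)"
    proof -
      have "\<delta>\<^sup>2 * k \<le> \<delta> * k" using \<delta> k by (intro mult_right_mono) (auto simp: power2_eq_square mult_left_le)
      then have "d * (\<delta>\<^sup>2 * k) \<le> d * d" using d dk by (intro mult_left_mono) auto
      then show ?thesis using k \<delta> by (simp add: pos_le_divide_eq power2_eq_square)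
    qed
    moreover have "count n v \<le> k + d" by (simp add: d_def)
    ultimately have "count n v + 16 * k \<le> 18 * (d\<^sup>2 / (\<delta>\<^sup>2 * k))" by linarith
    also have "\<dots> = c * (count n v - k)\<^sup>2" by (simp add: c_def d_def)
    finally have b: "count n v + 16 * k \<le> c * (count n v - k)\<^sup>2" .
    have "(\<integral>\<^sup>+x. loss (v, x) \<partial>?P) \<le> (\<integral>\<^sup>+x. ennreal (c * (count n v - k)\<^sup>2) \<partial>?P)"
    proof (rule nn_integral_mono)
      fix x :: "rmat \<times> seed"
      obtain W \<omega> where x: "x = (W, \<omega>)" by (cases x)
      show "loss (v, x) \<le> ennreal (c * (count n v - k)\<^sup>2)"
        unfolding loss_def x split f_def
        by (intro ennreal_leI order_trans[OF thresh_loss_always[OF k snr] b])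
    qed
    also have "\<dots> = ennreal (c * (count n v - k)\<^sup>2)" by (simp add: NS.emeasure_space_1)
    finally show ?thesis by (rule order_trans) simp
  qed
  have cm: "(\<lambda>v. ennreal ((count n v - k)\<^sup>2)) \<in> borel_measurable (bernoulli_vec n \<rho>)"
    unfolding count_def
    by (intro measurable_compose[OF _ measurable_ennreal] borel_measurable_power borel_measurable_diff
        borel_measurable_sum measurable_bernoulli_coord[of _ n of_bool]) auto
  have "planted_vec_risk n snr \<rho> f = (\<integral>\<^sup>+x. loss x \<partial>(bernoulli_vec n \<rho> \<Otimes>\<^sub>M ?P))"
    by (simp add: planted_vec_risk_def loss_def)
  also have "\<dots> = (\<integral>\<^sup>+v. \<integral>\<^sup>+x. loss (v, x) \<partial>?P \<partial>bernoulli_vec n \<rho>)"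
    by (rule NS.nn_integral_fst[symmetric, OF loss_m])
  also have "\<dots> \<le> (\<integral>\<^sup>+v. ennreal (5 / (snr\<^sup>2 * k)) * G + ennreal c * ennreal ((count n v - k)\<^sup>2) \<partial>bernoulli_vec n \<rho>)"
    using inner c by (intro nn_integral_mono) (simp add: ennreal_mult)
  also have "\<dots> = ennreal (5 / (snr\<^sup>2 * k)) * G + ennreal c * (\<integral>\<^sup>+v. ennreal ((count n v - k)\<^sup>2) \<partial>bernoulli_vec n \<rho>)"
    using cm by (simp add: nn_integral_add nn_integral_cmult V.emeasure_space_1)
  also have "\<dots> \<le> ennreal (5 / (snr\<^sup>2 * k)) * G + ennreal c * ennreal k"
    using bernoulli_vec_variance[OF \<rho>, of n] by (intro add_left_mono mult_left_mono) (auto simp: k(1))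
  also have "ennreal c * ennreal k = ennreal (18 / \<delta>\<^sup>2)"
    using k(2) c by (simp add: c_def ennreal_mult[symmetric])
  finally show ?thesis by (simp add: f_def)
qed

section \<open>Invariance of the planted model under transpositions\<close>

text \<open>Restricted to \<open>{..<n}\<close> because points of the product space are
  \<open>undefined\<close> outside it.\<close>

definition swap_vec :: "nat \<Rightarrow> nat \<Rightarrow> (nat \<Rightarrow> bool) \<Rightarrow> nat \<Rightarrow> bool" where
  "swap_vec n j v = (\<lambda>i\<in>{..<n}. v (swap0 j i))"

lemma inj_swap0: "inj_on (swap0 j) A"
  by (metis inj_onI swap0_swap0)

lemma bernoulli_vec_swap:
  assumes "j < n"
  shows "distr (bernoulli_vec n \<rho>) (bernoulli_vec n \<rho>) (swap_vec n j) = bernoulli_vec n \<rho>"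
    "swap_vec n j \<in> measurable (bernoulli_vec n \<rho>) (bernoulli_vec n \<rho>)"
proof -
  show "distr (bernoulli_vec n \<rho>) (bernoulli_vec n \<rho>) (swap_vec n j) = bernoulli_vec n \<rho>"
    unfolding bernoulli_vec_def swap_vec_def
    by (rule distr_PiM_reindex[of "{..<n}" "\<lambda>_. measure_pmf (bernoulli_pmf \<rho>)" "swap0 j" "{..<n}"])
       (use assms in \<open>auto simp: prob_space_measure_pmf inj_swap0 swap0_less\<close>)
  show "swap_vec n j \<in> measurable (bernoulli_vec n \<rho>) (bernoulli_vec n \<rho>)"
    unfolding bernoulli_vec_def swap_vec_def
    by (intro measurable_restrict measurable_component_singleton) (use assms in \<open>auto simp: swap0_less\<close>)
qed

lemma measurable_swap_mat:
  assumes "j < n"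
  shows "swap_mat j \<in> measurable (sym_space n) (sym_space n)"
proof (rule measurable_sym_spaceI)
  show "swap_mat j x \<in> Sym n" if "x \<in> space (sym_space n)" for x
    using that assms by (simp add: swap_mat_Sym)
  show "(\<lambda>x. swap_mat j x p q) \<in> borel_measurable (sym_space n)" for p q
    unfolding swap_mat_def using measurable_sym_spaceD[of "\<lambda>Z. Z"] by simp
qed

lemma measurable_swap_arg:
  assumes "j < n" "case_prod f \<in> borel_measurable (sym_space n \<Otimes>\<^sub>M seed_space)"
  shows "(\<lambda>(Y, \<omega>). f (swap_mat j Y) \<omega>) \<in> borel_measurable (sym_space n \<Otimes>\<^sub>M seed_space)"
proof -
  have "(\<lambda>x. (swap_mat j (fst x), snd x)) \<in> measurable (sym_space n \<Otimes>\<^sub>M seed_space) (sym_space n \<Otimes>\<^sub>M seed_space)"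
    by (intro measurable_Pair measurable_compose[OF measurable_fst measurable_swap_mat[OF assms(1)]] measurable_snd)
  from measurable_compose[OF this assms(2)] show ?thesis by (simp add: split_beta)
qed

definition swap_pair :: "nat \<Rightarrow> nat \<times> nat \<Rightarrow> nat \<times> nat" where
  "swap_pair j = (\<lambda>(p, q). (min (swap0 j p) (swap0 j q), max (swap0 j p) (swap0 j q)))"

lemma swap0_eq_iff [simp]: "swap0 j p = swap0 j q \<longleftrightarrow> p = q"
  by (metis swap0_swap0)

text \<open>A simultaneous swap of rows and columns permutes the independent coordinates on the
  triangle, after reordering each pair. It maps diagonal to diagonal, so variances match and
  reindexing preserves the product measure.\<close>

lemma noise_swap:
  assumes j: "j < n"
  shows "distr (noise n) (noise n) (swap_mat j) = noise n"
proof -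
  have maps: "swap_pair j \<in> tri n \<rightarrow> tri n"
  proof
    fix p assume "p \<in> tri n"
    then obtain a b where "p = (a, b)" "a \<le> b" "b < n" by (cases p) (simp add: tri_def)
    then show "swap_pair j p \<in> tri n"
      using swap0_less[OF j, of a] swap0_less[OF j, of b]
      by (cases "swap0 j a \<le> swap0 j b") (simp_all add: swap_pair_def tri_def min_def max_def)
  qed
  have "swap_pair j (swap_pair j p) = p" if "p \<in> tri n" for p
  proof -
    obtain a b where "p = (a, b)" "a \<le> b" using \<open>p \<in> tri n\<close> by (cases p) (simp add: tri_def)
    then show ?thesis by (cases "swap0 j a \<le> swap0 j b") (simp_all add: swap_pair_def min_def max_def)
  qed
  then have inj: "inj_on (swap_pair j) (tri n)" by (metis inj_onI)
  have same: "gauss_coord (swap_pair j p) = gauss_coord p" for p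
    by (cases p) (auto simp: swap_pair_def min_def max_def)
  have reindex: "distr (PiM (tri n) gauss_coord) (PiM (tri n) gauss_coord) (\<lambda>g. \<lambda>p\<in>tri n. g (swap_pair j p))
      = PiM (tri n) gauss_coord"
    using distr_PiM_reindex[of "tri n" gauss_coord "swap_pair j" "tri n"] maps inj
    by (simp only: same prob_space_gauss_coord)
  have m: "(\<lambda>g. \<lambda>p\<in>tri n. g (swap_pair j p)) \<in> measurable (PiM (tri n) gauss_coord) (PiM (tri n) gauss_coord)"
  proof (rule measurable_restrict)
    fix p assume "p \<in> tri n"
    then have "swap_pair j p \<in> tri n" using maps by blast
    from measurable_component_singleton[OF this, of gauss_coord]
    show "(\<lambda>g. g (swap_pair j p)) \<in> measurable (PiM (tri n) gauss_coord) (gauss_coord p)" by (simp only: same)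
  qed
  have comm: "swap_mat j (sym_of_tri n g) = sym_of_tri n (\<lambda>p\<in>tri n. g (swap_pair j p))" for g
  proof (intro ext)
    fix p q
    show "swap_mat j (sym_of_tri n g) p q = sym_of_tri n (\<lambda>p\<in>tri n. g (swap_pair j p)) p q"
    proof (cases "p < n \<and> q < n")
      case True
      then have "(min p q, max p q) \<in> tri n" by (auto simp: tri_def)
      moreover have "swap_pair j (min p q, max p q) = (min (swap0 j p) (swap0 j q), max (swap0 j p) (swap0 j q))"
        by (auto simp: swap_pair_def min_def max_def)
      ultimately show ?thesis using True by (simp add: swap_mat_def sym_of_tri_def swap0_less[OF j])
    next
      case False
      then show ?thesis by (auto simp: swap_mat_def sym_of_tri_def swap0_less[OF j])
    qed
  qed
  have "distr (noise n) (noise n) (swap_mat j) = distr (noise n) (sym_space n) (swap_mat j)"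
    by (intro distr_cong) simp_all
  also have "\<dots> = distr (PiM (tri n) gauss_coord) (sym_space n) (swap_mat j \<circ> sym_of_tri n)"
    unfolding noise_eq by (rule distr_distr[OF measurable_swap_mat[OF j] measurable_sym_of_tri])
  also have "swap_mat j \<circ> sym_of_tri n = sym_of_tri n \<circ> (\<lambda>g. \<lambda>p\<in>tri n. g (swap_pair j p))"
    by (simp add: fun_eq_iff comm)
  also have "distr (PiM (tri n) gauss_coord) (sym_space n) \<dots>
      = distr (distr (PiM (tri n) gauss_coord) (PiM (tri n) gauss_coord) (\<lambda>g. \<lambda>p\<in>tri n. g (swap_pair j p))) (sym_space n) (sym_of_tri n)"
    by (rule distr_distr[OF measurable_sym_of_tri m, symmetric])
  also have "\<dots> = noise n" unfolding reindex noise_eq ..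
  finally show ?thesis .
qed

lemma planted_swap:
  "j < n \<Longrightarrow> planted n snr (swap_vec n j v) (swap_mat j W) = swap_mat j (planted n snr v W)"
  by (auto simp: planted_def swap_mat_def swap_vec_def swap0_less fun_eq_iff)

lemma planted_model_swap:
  assumes j: "j < n"
    and h: "h \<in> borel_measurable (bernoulli_vec n \<rho> \<Otimes>\<^sub>M (noise n \<Otimes>\<^sub>M seed_space))"
  shows "(\<integral>\<^sup>+x. h x \<partial>(bernoulli_vec n \<rho> \<Otimes>\<^sub>M (noise n \<Otimes>\<^sub>M seed_space)))
    = (\<integral>\<^sup>+(v, W, \<omega>). h (swap_vec n j v, swap_mat j W, \<omega>) \<partial>(bernoulli_vec n \<rho> \<Otimes>\<^sub>M (noise n \<Otimes>\<^sub>M seed_space)))"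
proof -
  let ?B = "bernoulli_vec n \<rho>" and ?N = "noise n" and ?S = seed_space
  let ?TW = "\<lambda>(W, \<omega>). (swap_mat j W, \<omega>)" and ?T = "\<lambda>(v, x). (swap_vec n j v, case x of (W, \<omega>) \<Rightarrow> (swap_mat j W, \<omega>))"
  interpret N: prob_space ?N by (rule prob_space_noise)
  interpret S: prob_space ?S by (rule prob_space_seed_space)
  interpret NS: pair_prob_space ?N ?S ..
  have mW: "swap_mat j \<in> measurable ?N ?N"
    using measurable_swap_mat[OF j] by (simp cong: measurable_cong_sets)
  have mI: "(\<lambda>\<omega>. \<omega>) \<in> measurable ?S ?S" by simp
  have idS: "distr ?S ?S (\<lambda>\<omega>. \<omega>) = ?S" by (rule distr_id2) simp
  have mT: "?TW \<in> measurable (?N \<Otimes>\<^sub>M ?S) (?N \<Otimes>\<^sub>M ?S)"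
    unfolding split_beta by (intro measurable_Pair measurable_compose[OF measurable_fst mW] measurable_snd)
  have NS: "distr (?N \<Otimes>\<^sub>M ?S) (?N \<Otimes>\<^sub>M ?S) ?TW = ?N \<Otimes>\<^sub>M ?S"
    using pair_measure_distr[OF mW mI] by (simp add: noise_swap[OF j] idS S.sigma_finite_measure_axioms)
  have T: "distr (?B \<Otimes>\<^sub>M (?N \<Otimes>\<^sub>M ?S)) (?B \<Otimes>\<^sub>M (?N \<Otimes>\<^sub>M ?S)) ?T = ?B \<Otimes>\<^sub>M (?N \<Otimes>\<^sub>M ?S)"
    using pair_measure_distr[OF bernoulli_vec_swap(2)[OF j] mT, of \<rho>]
    by (simp only: NS bernoulli_vec_swap(1)[OF j] NS.sigma_finite_measure_axioms)
  have "?T \<in> measurable (?B \<Otimes>\<^sub>M (?N \<Otimes>\<^sub>M ?S)) (?B \<Otimes>\<^sub>M (?N \<Otimes>\<^sub>M ?S))"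
    unfolding split_beta[of "\<lambda>v x. (swap_vec n j v, case x of (W, \<omega>) \<Rightarrow> (swap_mat j W, \<omega>))"]
    by (intro measurable_Pair measurable_compose[OF measurable_fst bernoulli_vec_swap(2)[OF j]]
        measurable_compose[OF measurable_snd mT])
  then have "(\<integral>\<^sup>+x. h x \<partial>distr (?B \<Otimes>\<^sub>M (?N \<Otimes>\<^sub>M ?S)) (?B \<Otimes>\<^sub>M (?N \<Otimes>\<^sub>M ?S)) ?T)
      = (\<integral>\<^sup>+x. h (?T x) \<partial>(?B \<Otimes>\<^sub>M (?N \<Otimes>\<^sub>M ?S)))"
    by (rule nn_integral_distr) (use h in simp)
  then show ?thesis unfolding T by (simp add: case_prod_unfold)
qed

text \<open>Jensen's inequality for the square, from non-negativity of the empirical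
  variance.\<close>

lemma average_square_le:
  fixes a :: "nat \<Rightarrow> real"
  assumes "0 < n"
  shows "((\<Sum>j<n. a j) / real n - t)\<^sup>2 \<le> (\<Sum>j<n. (a j - t)\<^sup>2) / real n"
proof -
  define m where "m = (\<Sum>j<n. a j) / real n"
  have s: "(\<Sum>j<n. a j) = real n * m" using assms by (simp add: m_def)
  have cross: "(\<Sum>j<n. 2 * (m - t) * a j) = 2 * (m - t) * (real n * m)"
    by (simp only: sum_distrib_left[symmetric] s)
  have "0 \<le> (\<Sum>j<n. (a j - m)\<^sup>2)" by (simp add: sum_nonneg)
  also have "\<dots> = (\<Sum>j<n. (a j - t)\<^sup>2 - 2 * (m - t) * a j + (m\<^sup>2 - t\<^sup>2))"
    by (intro sum.cong refl) (simp add: power2_eq_square algebra_simps)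
  also have "\<dots> = (\<Sum>j<n. (a j - t)\<^sup>2) - real n * (m - t)\<^sup>2"
    unfolding sum.distrib sum_subtractf cross by (simp add: power2_eq_square algebra_simps)
  finally show ?thesis using assms by (simp add: m_def[symmetric] pos_le_divide_eq mult.commute)
qed

text \<open>By invariance of the model, the error made at \<open>v 0\<close> by coordinate
  \<open>j\<close> on swapped data has the law of the error made at \<open>v j\<close> on the
  original data. Convexity bounds the error of the average by the average of these errors.\<close>

lemma planted_coord_risk_symmetrise:
  assumes n: "0 < n" and f: "case_prod f \<in> borel_measurable (sym_space n \<Otimes>\<^sub>M seed_space)"
  shows "planted_coord_risk n snr \<rho> (\<lambda>Y \<omega>. (\<Sum>j<n. f (swap_mat j Y) \<omega> j) / real n)
     \<le> ennreal (1 / real n) * planted_vec_risk n snr \<rho> f"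
proof -
  let ?P = "bernoulli_vec n \<rho> \<Otimes>\<^sub>M (noise n \<Otimes>\<^sub>M seed_space)"
  define h where "h = (\<lambda>j (v, W, \<omega>). ennreal ((f (planted n snr v W) \<omega> j - of_bool (v j))\<^sup>2))"
  have hm: "h j \<in> borel_measurable ?P" if "j < n" for j
    unfolding h_def by (rule planted_loss_measurable[OF f that])
  define g where "g = (\<lambda>j (v, W, \<omega>). h j (swap_vec n j v, swap_mat j W, \<omega>))"
  have g: "g j (v, W, \<omega>) = ennreal ((f (swap_mat j (planted n snr v W)) \<omega> j - of_bool (v 0))\<^sup>2)" if "j < n" for j v W \<omega>
    using that by (simp add: g_def h_def planted_swap) (simp add: swap_vec_def swap0_def)
  have int: "(\<integral>\<^sup>+x. h j x \<partial>?P) = (\<integral>\<^sup>+x. g j x \<partial>?P)" if "j < n" for j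
    using planted_model_swap[OF that hm[OF that]] by (simp add: g_def)
  have gm: "g j \<in> borel_measurable ?P" if j: "j < n" for j
  proof -
    note sw = measurable_swap_arg[OF j f]
    have "g j = (\<lambda>(v, W, \<omega>). ennreal ((f (swap_mat j (planted n snr v W)) \<omega> j - of_bool (v 0))\<^sup>2))"
      by (auto simp: fun_eq_iff g[OF j])
    then show ?thesis using planted_loss_measurable[of "\<lambda>Y \<omega>. f (swap_mat j Y) \<omega>", OF sw n, of snr j \<rho>] by simp
  qed
  have "planted_coord_risk n snr \<rho> (\<lambda>Y \<omega>. (\<Sum>j<n. f (swap_mat j Y) \<omega> j) / real n)
      \<le> (\<integral>\<^sup>+x. ennreal (1 / real n) * (\<Sum>j<n. g j x) \<partial>?P)"
    unfolding planted_coord_risk_def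
  proof (rule nn_integral_mono)
    fix x :: "(nat \<Rightarrow> bool) \<times> rmat \<times> seed"
    obtain v W \<omega> where x: "x = (v, W, \<omega>)" by (cases x)
    let ?a = "\<lambda>j. f (swap_mat j (planted n snr v W)) \<omega> j"
    have "(\<Sum>j<n. g j x) = ennreal (\<Sum>j<n. (?a j - of_bool (v 0))\<^sup>2)"
      by (simp add: x g sum_ennreal)
    then have "ennreal (1 / real n) * (\<Sum>j<n. g j x) = ennreal ((\<Sum>j<n. (?a j - of_bool (v 0))\<^sup>2) / real n)"
      by (simp add: ennreal_mult[symmetric] sum_nonneg)
    then show "(case x of (v, W, \<omega>) \<Rightarrow> ennreal (((\<Sum>j<n. f (swap_mat j (planted n snr v W)) \<omega> j) / real n - of_bool (v 0))\<^sup>2))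
      \<le> ennreal (1 / real n) * (\<Sum>j<n. g j x)"
      using average_square_le[OF n, of ?a "of_bool (v 0)"] by (simp add: x ennreal_leI)
  qed
  also have "\<dots> = ennreal (1 / real n) * (\<Sum>j<n. \<integral>\<^sup>+x. g j x \<partial>?P)"
  proof -
    have "(\<integral>\<^sup>+x. (\<Sum>j<n. g j x) \<partial>?P) = (\<Sum>j<n. \<integral>\<^sup>+x. g j x \<partial>?P)"
      using gm by (intro nn_integral_sum) auto
    moreover have "(\<lambda>x. \<Sum>j<n. g j x) \<in> borel_measurable ?P"
      using gm by (intro borel_measurable_sum) auto
    ultimately show ?thesis by (simp only: nn_integral_cmult)
  qed
  also have "(\<Sum>j<n. \<integral>\<^sup>+x. g j x \<partial>?P) = (\<Sum>j<n. \<integral>\<^sup>+x. h j x \<partial>?P)"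
    by (intro sum.cong refl) (simp add: int)
  also have "\<dots> = (\<integral>\<^sup>+x. (\<Sum>j<n. h j x) \<partial>?P)"
    using hm by (intro nn_integral_sum[symmetric]) auto
  also have "\<dots> = planted_vec_risk n snr \<rho> f"
    unfolding planted_vec_risk_def by (intro nn_integral_cong) (auto simp: h_def sum_ennreal split: prod.splits)
  finally show ?thesis .
qed

section \<open>Rates and the limit\<close>

lemma lam_square_kval:
  assumes "0 < n"
  shows "(lam a n)\<^sup>2 * kval b n = real n powr (1 - b - 2 * a)"
proof -
  have "(lam a n)\<^sup>2 * kval b n = real n powr (- a) * real n powr (- a) * (real n powr (- b) * real n powr 1)"
    using assms by (simp add: lam_def kval_def rho_def power2_eq_square)
  also have "\<dots> = real n powr (- a + - a + (- b + 1))" by (simp only: powr_add)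
  also have "- a + - a + (- b + 1) = 1 - b - 2 * a" by simp
  finally show ?thesis .
qed

lemma minimax_risk_theta_body:
  assumes n: "3 \<le> n" and b: "0 < b" "b < 1" and c: "0 < c" "c \<le> 1" "1 - b - 2 * a = 4 * c"
    and \<delta>: "0 < \<delta> n" "\<delta> n \<le> 1"
  shows "minimax_risk n (theta_body a b \<delta> n)
    \<le> ennreal ((lam a n)\<^sup>2 * (kval b n)\<^sup>2
        * (2592 * real n powr - c + 3392 * (real n powr (- 2 * c) * ln (real n))))"
proof -
  define k where "k = kval b n"
  define kp where "kp = (1 + \<delta> n) * k"
  define x where "x = real n powr c"
  define l where "l = ln (real n)"
  define r where "r = nat \<lceil>x\<rceil>"
  define s where "s = nat \<lceil>real r * kp\<rceil>"
  define w where "w = n * (2 * (n * r) + 1)"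
  have n0: "0 < n" "1 \<le> real n" "3 \<le> real n" using n by auto
  have x: "1 \<le> x" "x \<le> real n"
    using c n0 powr_mono[of c 1 "real n"] by (auto simp: x_def ge_one_powr_ge_zero)
  have "k = real n powr (1 - b)"
    using n0 by (simp add: k_def kval_def rho_def powr_diff powr_minus field_simps)
  then have k: "1 \<le> k" using b n0 by (simp add: ge_one_powr_ge_zero)
  have kp: "0 < kp" "kp \<le> 2 * k" using \<delta> k by (auto simp: kp_def intro: mult_right_mono)
  \<comment> \<open>This is why \<open>n\<close> is at least \<open>3\<close>: the logarithm then
    absorbs additive constants.\<close>
  have l: "1 \<le> l" using exp_le n0(1,3) order_trans[of "exp 1" 3 "real n"] by (simp add: l_def ln_ge_iff)
  have r: "x \<le> real r" "real r \<le> 2 * x" "0 < r"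
  proof -
    show "x \<le> real r" unfolding r_def using x by linarith
    have "real r \<le> x + 1" unfolding r_def using x by linarith
    then show "real r \<le> 2 * x" using x by linarith
    show "0 < r" using \<open>x \<le> real r\<close> x by linarith
  qed
  have xk: "1 \<le> x * k" using x k mult_mono[of 1 x 1 k] by simp
  have s: "real r * kp \<le> real s" "real s \<le> 5 * (x * k)"
  proof -
    have p: "0 \<le> real r * kp" using kp by simp
    show "real r * kp \<le> real s" unfolding s_def using p by linarith
    have "real s \<le> real r * kp + 1" unfolding s_def using p by linarith
    also have "real r * kp \<le> (2 * x) * (2 * k)" using r kp x by (intro mult_mono) auto
    finally show "real s \<le> 5 * (x * k)" using xk by simp
  qed
  have w_pos: "0 < w" unfolding w_def using n0(1) by (rule mult_pos_pos) simp
  \<comment> \<open>The chain \<open>w \<le> 5 * n^3 \<le> n^5\<close> uses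
    \<open>5 \<le> 9 \<le> n^2\<close>.\<close>
  have w: "ln (real w) \<le> 5 * l"
  proof -
    have "real w = real n * (2 * (real n * real r) + 1)" by (simp add: w_def algebra_simps)
    also have "\<dots> \<le> real n * (2 * (real n * (2 * real n)) + real n * real n)"
    proof (intro mult_left_mono add_mono)
      show "real r \<le> 2 * real n" using r x by linarith
      show "1 \<le> real n * real n" using n0 mult_mono[of 1 "real n" 1 "real n"] by simp
    qed auto
    also have "\<dots> = 5 * real n ^ 3" by (simp add: power3_eq_cube)
    also have "\<dots> \<le> real n ^ 2 * real n ^ 3"
      using n0 power_mono[of 3 "real n" 2] by (intro mult_right_mono) auto
    also have "\<dots> = real n ^ 5" by (simp add: power_add[symmetric])
    finally have "real w \<le> real n ^ 5" .
    with w_pos have "ln (real w) \<le> ln (real n ^ 5)" using n0(1) by (intro ln_mono) auto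
    then show ?thesis using n0 by (simp add: l_def ln_realpow)
  qed
  have w0: "0 \<le> ln (real w)" using w_pos by (intro ln_ge_zero) simp
  have theta: "theta_body a b \<delta> n = scale (lam a n * kp) (body n ((1 - \<delta> n) * k) kp)"
    by (simp add: theta_body_def kp_def k_def Let_def)
  \<comment> \<open>\<open>2592 = 648 * 4\<close>, the \<open>4\<close> coming from
    \<open>kp \<le> 2 * k\<close>.\<close>
  have T1: "648 * (lam a n * kp)\<^sup>2 / r \<le> (lam a n)\<^sup>2 * k\<^sup>2 * (2592 * real n powr - c)"
  proof -
    have "(lam a n * kp)\<^sup>2 \<le> (lam a n)\<^sup>2 * (2 * k)\<^sup>2"
      unfolding power_mult_distrib[of "lam a n" kp] using kp by (intro mult_left_mono power_mono) auto
    then have "648 * (lam a n * kp)\<^sup>2 / r \<le> 648 * ((lam a n)\<^sup>2 * (2 * k)\<^sup>2) / x"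
      using r x by (intro frac_le mult_left_mono) auto
    also have "\<dots> = (lam a n)\<^sup>2 * k\<^sup>2 * (2592 * real n powr - c)"
      by (simp add: x_def powr_minus field_simps power2_eq_square)
    finally show ?thesis .
  qed
  \<comment> \<open>\<open>3392 = 64 * 53\<close>: the bounds \<open>5 * (x * k)\<close> for
    \<open>s\<close> and \<open>5 * l\<close> for the logarithm give \<open>26 = 1 + 25\<close>, the
    bound \<open>2 * x\<close> for \<open>r\<close> gives \<open>52\<close>, and the last summand
    adds \<open>1\<close>.\<close>
  have T2: "64 * (real r * (1 + real s * ln w) + 1)
      \<le> (lam a n)\<^sup>2 * k\<^sup>2 * (3392 * (real n powr (- 2 * c) * ln (real n)))"
  proof -
    have kl: "1 \<le> (x * k) * l" using xk l mult_mono[of 1 "x * k" 1 l] by simp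
    have "real s * ln w \<le> (5 * (x * k)) * (5 * l)" using s w w0 by (intro mult_mono) auto
    then have "1 + real s * ln w \<le> 26 * ((x * k) * l)" using kl by simp
    then have "real r * (1 + real s * ln w) \<le> (2 * x) * (26 * ((x * k) * l))"
      using r x w0 by (intro mult_mono) auto
    moreover have "1 \<le> x * ((x * k) * l)" using x kl mult_mono[of 1 x 1 "(x * k) * l"] by simp
    ultimately have "64 * (real r * (1 + real s * ln w) + 1) \<le> 3392 * (x * ((x * k) * l))" by simp
    also have "x * ((x * k) * l) = k * (real n powr (2 * c) * l)"
      using powr_add[of "real n" c c] by (simp add: x_def)
    also have "k * (real n powr (2 * c) * l) = (lam a n)\<^sup>2 * k\<^sup>2 * (real n powr (- 2 * c) * l)"
    proof -
      have "real n powr (4 * c) * real n powr (- 2 * c) = real n powr (2 * c)"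
        by (simp flip: powr_add)
      then have "real n powr (2 * c) = (lam a n)\<^sup>2 * k * real n powr (- 2 * c)"
        using lam_square_kval[OF n0(1), of a b] c(3) by (simp add: k_def)
      then show ?thesis by (simp add: power2_eq_square)
    qed
    finally show ?thesis by (simp add: l_def mult_ac)
  qed
  have "minimax_risk n (theta_body a b \<delta> n)
      \<le> ennreal (648 * (lam a n * kp)\<^sup>2 / r + 64 * (real r * (1 + real s * ln w) + 1))"
    unfolding theta w_def using minimax_risk_body[OF kp(1) n0(1) r(3) s(1), of "lam a n * kp" "(1 - \<delta> n) * k"]
    by (simp add: algebra_simps)
  also have "\<dots> \<le> ennreal ((lam a n)\<^sup>2 * (kval b n)\<^sup>2
        * (2592 * real n powr - c + 3392 * (real n powr (- 2 * c) * ln (real n))))"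
    using T1 T2 by (intro ennreal_leI) (simp add: distrib_left k_def)
  finally show ?thesis .
qed

text \<open>The prefactor \<open>5 / (\<lambda>^2 k)\<close> from thresholding and the division by
  \<open>k\<close> together cancel the \<open>\<lambda>^2 k^2\<close> in the minimax bound, leaving
  only the relative rate.\<close>

lemma rounded_risk_bound:
  assumes n: "3 \<le> n" and b: "0 < b" "b < 1" and c: "0 < c" "c \<le> 1" "1 - b - 2 * a = 4 * c"
    and \<delta>: "0 < \<delta> n" "\<delta> n \<le> 1 / 10"
    and mu: "case_prod mu \<in> measurable (sym_space n \<Otimes>\<^sub>M seed_space) (sym_space n)"
    and L: "L \<le> ln (real n) powr A"
    and near: "(SUP \<mu>\<in>theta_body a b \<delta> n. gauss_risk n mu \<mu>) \<le> ennreal L * minimax_risk n (theta_body a b \<delta> n)"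
  shows "planted_vec_risk n (lam a n) (rho b n) (\<lambda>Y \<omega>. thresh n (lam a n) (rho b n) (mu Y \<omega>)) / ennreal (kval b n)
    \<le> ennreal (5 * (ln (real n) powr A * (2592 * real n powr - c + 3392 * (real n powr (- 2 * c) * ln (real n))))
        + 18 / ((\<delta> n)\<^sup>2 * kval b n))"
proof -
  define k where "k = kval b n"
  define \<beta> where "\<beta> = 2592 * real n powr - c + 3392 * (real n powr (- 2 * c) * ln (real n))"
  define G where "G = (SUP \<mu>\<in>theta_body a b \<delta> n. gauss_risk n mu \<mu>)"
  have n0: "0 < n" "1 \<le> real n" using n by auto
  have lam: "0 < lam a n" using n0 by (simp add: lam_def)
  have rho: "0 < rho b n" "rho b n \<le> 1"
    using n0 b powr_mono[of "- b" 0 "real n"] by (auto simp: rho_def)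
  have k: "k = rho b n * real n" "0 < k" using rho n0 by (auto simp: k_def kval_def)
  have \<beta>: "0 \<le> \<beta>" using n0 by (simp add: \<beta>_def)
  have "G \<le> ennreal L * minimax_risk n (theta_body a b \<delta> n)" using near by (simp add: G_def)
  also have "\<dots> \<le> ennreal (ln (real n) powr A) * ennreal ((lam a n)\<^sup>2 * k\<^sup>2 * \<beta>)"
    using minimax_risk_theta_body[OF n b c, of \<delta>] \<delta> L
    by (intro mult_mono ennreal_leI) (auto simp: k_def \<beta>_def)
  also have "\<dots> = ennreal (ln (real n) powr A * ((lam a n)\<^sup>2 * k\<^sup>2 * \<beta>))"
    using \<beta> by (simp add: ennreal_mult)
  finally have G: "G \<le> ennreal (ln (real n) powr A * ((lam a n)\<^sup>2 * k\<^sup>2 * \<beta>))" .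
  have "planted_vec_risk n (lam a n) (rho b n) (\<lambda>Y \<omega>. thresh n (lam a n) (rho b n) (mu Y \<omega>))
      \<le> ennreal (5 / ((lam a n)\<^sup>2 * k)) * G + ennreal (18 / (\<delta> n)\<^sup>2)"
  proof (rule planted_vec_risk_thresh[OF mu lam _ rho(2) k \<delta>])
    show "gauss_risk n mu (planted n (lam a n) v (\<lambda>_ _. 0)) \<le> G" if v: "\<bar>count n v - k\<bar> \<le> \<delta> n * k" for v
    proof -
      have "planted n (lam a n) v (\<lambda>_ _. 0) \<in> theta_body a b \<delta> n"
        unfolding theta_body_def Let_def k_def[symmetric]
        using v lam k(2) \<delta> by (intro signal_in_scaled_body) (auto simp: algebra_simps abs_le_iff)
      then show ?thesis unfolding G_def by (rule SUP_upper)
    qed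
  qed (use rho in auto)
  also have "\<dots> \<le> ennreal (5 / ((lam a n)\<^sup>2 * k)) * ennreal (ln (real n) powr A * ((lam a n)\<^sup>2 * k\<^sup>2 * \<beta>))
      + ennreal (18 / (\<delta> n)\<^sup>2)"
    by (intro add_right_mono mult_left_mono G) simp
  also have "\<dots> = ennreal (5 * (ln (real n) powr A * \<beta>) * k + 18 / (\<delta> n)\<^sup>2)"
  proof -
    have "5 / ((lam a n)\<^sup>2 * k) * (ln (real n) powr A * ((lam a n)\<^sup>2 * k\<^sup>2 * \<beta>)) = 5 * (ln (real n) powr A * \<beta>) * k"
      using lam k by (simp add: field_simps power2_eq_square)
    then show ?thesis using k(2) \<beta> by (simp add: ennreal_mult[symmetric] ennreal_plus[symmetric] del: ennreal_plus)
  qed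
  finally have "planted_vec_risk n (lam a n) (rho b n) (\<lambda>Y \<omega>. thresh n (lam a n) (rho b n) (mu Y \<omega>)) / ennreal k
      \<le> ennreal (5 * (ln (real n) powr A * \<beta>) * k + 18 / (\<delta> n)\<^sup>2) / ennreal k"
    by (rule divide_right_mono_ennreal)
  also have "\<dots> = ennreal ((5 * (ln (real n) powr A * \<beta>) * k + 18 / (\<delta> n)\<^sup>2) / k)"
    using k(2) \<beta> by (intro divide_ennreal) auto
  also have "(5 * (ln (real n) powr A * \<beta>) * k + 18 / (\<delta> n)\<^sup>2) / k = 5 * (ln (real n) powr A * \<beta>) + 18 / ((\<delta> n)\<^sup>2 * k)"
    using k(2) by (simp add: add_divide_distrib)
  finally show ?thesis by (simp add: k_def \<beta>_def)
qed

lemma error_bound_tendsto_0: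
  fixes A c :: real and \<delta> k :: "nat \<Rightarrow> real"
  assumes c: "0 < c" and \<delta>: "filterlim (\<lambda>n. (\<delta> n)\<^sup>2 * k n) at_top sequentially"
  shows "(\<lambda>n. ennreal (5 * (ln (real n) powr A * (2592 * real n powr - c + 3392 * (real n powr (- 2 * c) * ln (real n))))
        + 18 / ((\<delta> n)\<^sup>2 * k n))) \<longlonglongrightarrow> 0"
proof -
  have "(\<lambda>n. 5 * (ln (real n) powr A * (2592 * real n powr - c + 3392 * (real n powr (- 2 * c) * ln (real n))))) \<longlonglongrightarrow> 0"
    using c by real_asymp
  moreover have "(\<lambda>n. 18 / ((\<delta> n)\<^sup>2 * k n)) \<longlonglongrightarrow> 0"
    by (rule real_tendsto_divide_at_top[OF tendsto_const \<delta>])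
  ultimately have "(\<lambda>n. 5 * (ln (real n) powr A * (2592 * real n powr - c + 3392 * (real n powr (- 2 * c) * ln (real n))))
        + 18 / ((\<delta> n)\<^sup>2 * k n)) \<longlonglongrightarrow> 0 + 0"
    by (rule tendsto_add)
  then show ?thesis using tendsto_ennrealI by fastforce
qed

text \<open>Symmetrisation gains a factor \<open>1 / n\<close>, and
  \<open>kval b n = rho b n * n\<close>, so both normalised risks are compared on the same
  scale.\<close>

lemma coord_error_small_symmetrise:
  assumes f: "\<And>n. 1 \<le> n \<Longrightarrow> case_prod (f n) \<in> borel_measurable (sym_space n \<Otimes>\<^sub>M seed_space)"
    and small: "vector_error_small a b f"
  shows "coord_error_small a b (\<lambda>n Y \<omega>. (\<Sum>j<n. f n (swap_mat j Y) \<omega> j) / real n)"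
  unfolding coord_error_small_def
proof (rule tendsto_sandwich[OF _ _ tendsto_const small[unfolded vector_error_small_def]])
  show "\<forall>\<^sub>F n in sequentially. planted_coord_risk n (lam a n) (rho b n)
      (\<lambda>Y \<omega>. (\<Sum>j<n. f n (swap_mat j Y) \<omega> j) / real n) / ennreal (rho b n)
    \<le> planted_vec_risk n (lam a n) (rho b n) (f n) / ennreal (kval b n)"
    using eventually_ge_at_top[of 1]
  proof eventually_elim
    case (elim n)
    have rho: "0 < rho b n" using elim by (simp add: rho_def)
    have "planted_coord_risk n (lam a n) (rho b n) (\<lambda>Y \<omega>. (\<Sum>j<n. f n (swap_mat j Y) \<omega> j) / real n) / ennreal (rho b n)
        \<le> (ennreal (1 / real n) * planted_vec_risk n (lam a n) (rho b n) (f n)) / ennreal (rho b n)"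
      using elim by (intro divide_right_mono_ennreal planted_coord_risk_symmetrise f) auto
    also have "\<dots> = planted_vec_risk n (lam a n) (rho b n) (f n) * (ennreal (1 / real n) * ennreal (1 / rho b n))"
      using rho by (simp add: divide_ennreal_def inverse_ennreal inverse_eq_divide mult_ac)
    also have "ennreal (1 / real n) * ennreal (1 / rho b n) = inverse (ennreal (kval b n))"
      using rho elim by (simp add: kval_def inverse_ennreal inverse_eq_divide mult.commute flip: ennreal_mult)
    finally show ?case by (simp add: divide_ennreal_def)
  qed
qed simp

theorem propositionG4:
  fixes a b :: real and \<delta> :: "nat \<Rightarrow> real" and rnd :: bool
  assumes b: "0 < b" "b < 1/2"
    and a: "1/2 - b < a" "a < 1/2 - b/2"
    and \<delta>_decreasing: "antimono_on {1..} \<delta>"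
    and \<delta>_tendsto: "\<delta> \<longlonglongrightarrow> 0"
    and \<delta>_large: "filterlim (\<lambda>n. (\<delta> n)\<^sup>2 * kval b n) at_top sequentially"
  shows
    "(\<forall>L muhat.
        polylog L \<and> poly_time_matrix_estimator rnd a b muhat \<and> near_minimax a b \<delta> L muhat \<longrightarrow>
          (\<exists>vt. poly_time_vector_estimator rnd a b vt
             \<and> (\<forall>n\<ge>1. \<forall>Y\<in>Sym n. \<forall>\<omega>. \<forall>i<n. 0 \<le> vt n Y \<omega> i \<and> vt n Y \<omega> i \<le> 1)
             \<and> vector_error_small a b vt)
        \<and> (\<exists>v1. poly_time_scalar_estimator rnd a b v1 \<and> coord_error_small a b v1))
     \<and> (low_degree_conjecture rnd \<longrightarrow>
          \<not> (\<exists>L muhat.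
               polylog L \<and> poly_time_matrix_estimator rnd a b muhat \<and> near_minimax a b \<delta> L muhat))"
proof -
  define c where "c = (1 - b - 2 * a) / 4"
  have c: "0 < c" "c \<le> 1" "1 - b - 2 * a = 4 * c" using a b by (auto simp: c_def)
  \<comment> \<open>Decrease to the limit \<open>0\<close> excludes negative values, and divergence
    of \<open>\<delta>\<^sup>2 * k\<close> eventually excludes the value \<open>0\<close>.\<close>
  have "\<forall>\<^sub>F n in sequentially. 0 < \<delta> n"
  proof -
    have "\<forall>\<^sub>F n in sequentially. 0 < (\<delta> n)\<^sup>2 * kval b n"
      using \<delta>_large by (simp add: filterlim_at_top_dense)
    then show ?thesis using eventually_ge_at_top[of 1]
    proof eventually_elim
      case (elim n)
      have "0 \<le> \<delta> n"
      proof (rule tendsto_upperbound[OF \<delta>_tendsto])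
        show "\<forall>\<^sub>F m in sequentially. \<delta> m \<le> \<delta> n"
          using eventually_ge_at_top[of n] by eventually_elim
            (use monotone_onD[OF \<delta>_decreasing] elim(2) in auto)
      qed simp
      then show ?case using elim(1) by (cases "\<delta> n = 0") auto
    qed
  qed
  \<comment> \<open>\<open>1 / 10\<close> is the relative deviation of the planted size that
    \<open>thresh_loss_good\<close> tolerates.\<close>
  moreover have "\<forall>\<^sub>F n in sequentially. \<delta> n < 1 / 10"
    using order_tendstoD(2)[OF \<delta>_tendsto, of "1 / 10"] by simp
  ultimately have \<delta>: "\<forall>\<^sub>F n in sequentially. 0 < \<delta> n \<and> \<delta> n \<le> 1 / 10"
    by eventually_elim simp
  have main: "(\<exists>vt. poly_time_vector_estimator rnd a b vt
             \<and> (\<forall>n\<ge>1. \<forall>Y\<in>Sym n. \<forall>\<omega>. \<forall>i<n. 0 \<le> vt n Y \<omega> i \<and> vt n Y \<omega> i \<le> 1)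
             \<and> vector_error_small a b vt)
        \<and> (\<exists>v1. poly_time_scalar_estimator rnd a b v1 \<and> coord_error_small a b v1)"
    if L: "polylog L" and est: "poly_time_matrix_estimator rnd a b muhat" and near: "near_minimax a b \<delta> L muhat"
    for L muhat
  proof -
    define vt where "vt = (\<lambda>n Y \<omega>. thresh n (lam a n) (rho b n) (muhat n Y \<omega>))"
    define v1 where "v1 = (\<lambda>n Y \<omega>. (\<Sum>j<n. vt n (swap_mat j Y) \<omega> j) / real n)"
    have mu: "case_prod (muhat n) \<in> measurable (sym_space n \<Otimes>\<^sub>M seed_space) (sym_space n)" if "1 \<le> n" for n
      using est that by (simp add: poly_time_matrix_estimator_def)
    have vt_meas: "case_prod (vt n) \<in> borel_measurable (sym_space n \<Otimes>\<^sub>M seed_space)" if "1 \<le> n" for n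
      unfolding vt_def by (rule measurable_thresh[OF mu[OF that]])
    have vt_pt: "poly_time rnd (lam a) (rho b) vector_out vt"
      unfolding vt_def by (rule poly_time_round) (use est in \<open>simp add: poly_time_matrix_estimator_def\<close>)
    have v1_meas: "case_prod (v1 n) \<in> borel_measurable (sym_space n \<Otimes>\<^sub>M seed_space)" if "1 \<le> n" for n
    proof -
      have "(\<lambda>x. (case x of (Y, \<omega>) \<Rightarrow> vt n (swap_mat j Y) \<omega>) j) \<in> borel_measurable (sym_space n \<Otimes>\<^sub>M seed_space)"
        if "j < n" for j
        by (rule measurable_product_then_coordinatewise[OF measurable_swap_arg[OF that vt_meas]]) fact
      then have "(\<lambda>x. (\<Sum>j<n. (case x of (Y, \<omega>) \<Rightarrow> vt n (swap_mat j Y) \<omega>) j) / real n)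
          \<in> borel_measurable (sym_space n \<Otimes>\<^sub>M seed_space)"
        by (intro borel_measurable_divide borel_measurable_sum) auto
      then show ?thesis by (simp add: v1_def case_prod_unfold)
    qed
    have v1_pt: "poly_time rnd (lam a) (rho b) scalar_out v1"
      unfolding v1_def by (rule poly_time_symmetrise[OF vt_pt])
    obtain A where A: "\<forall>\<^sub>F n in sequentially. L n \<le> ln (real n) powr A"
      using L by (auto simp: polylog_def)
    have small: "vector_error_small a b vt"
      unfolding vector_error_small_def
    proof (rule tendsto_sandwich[OF _ _ tendsto_const error_bound_tendsto_0[OF c(1) \<delta>_large]])
      show "\<forall>\<^sub>F n in sequentially. planted_vec_risk n (lam a n) (rho b n) (vt n) / ennreal (kval b n)
        \<le> ennreal (5 * (ln (real n) powr A * (2592 * real n powr - c + 3392 * (real n powr (- 2 * c) * ln (real n))))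
            + 18 / ((\<delta> n)\<^sup>2 * kval b n))"
        using \<delta> A near[unfolded near_minimax_def] eventually_ge_at_top[of 3]
      proof eventually_elim
        case (elim n)
        then show ?case
          unfolding vt_def using b by (intro rounded_risk_bound c mu) auto
      qed
    qed simp
    have "coord_error_small a b v1"
      unfolding v1_def by (rule coord_error_small_symmetrise[OF vt_meas small])
    moreover have "0 \<le> vt n Y \<omega> i \<and> vt n Y \<omega> i \<le> 1" for n Y \<omega> i
      by (simp add: vt_def thresh_def)
    ultimately show ?thesis
      using vt_pt vt_meas v1_pt v1_meas small
      unfolding poly_time_vector_estimator_def poly_time_scalar_estimator_def by blast
  qed
  \<comment> \<open>Both constructions keep seedless programs seedless, so the same flag
    \<open>rnd\<close> serves hypothesis and conjecture; the scalar estimator contradicts the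
    conjecture at this very pair \<open>a\<close>, \<open>b\<close>.\<close>
  show ?thesis
    using main b a(1) unfolding low_degree_conjecture_def by blast
qed

end
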